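(* Let $\alpha>0$, and let $f$, $\mathcal{D}_s^{\alpha+1}f$ and their Fourier transforms belong to $L_1(\mathbb{R})$. For a step size $h>0$ put $$A^{1,\alpha}f(x)=\frac{1}{h^{\alpha}}\sum_{m=0}^{\infty}g_m^{1,\alpha}f(x-mh),$$ where $g_0^{1,\alpha}=1$ and $g_m^{1,\alpha}=e^{-\sigma h}\left(1-\frac{\alpha+1}{m}\right)g_{m-1}^{1,\alpha}$ for $m\ge 1$. Then $$\mathcal{D}_s^{\alpha}f(x)=A^{1,\alpha}f(x)+\mathcal{O}(h)\qquad (h\to 0).$$
   Context: $\sigma$ is a constant (a quantity not depending on $x$). For $\nu>0$, $$\mathcal{I}_s^\nu f(x)=\frac{1}{\Gamma(\nu)}\int_{-\infty}^x (x-\tau)^{\nu-1}e^{-\sigma(x-\tau)}f(\tau)\,d\tau .$$ For $\nu>0$, let $m$ be the smallest integer that exceeds $\nu$; then $\mathcal{D}_s^\nu f(x)=D_s^m[\mathcal{I}_s^{m-\nu}f(x)]$, where $D_s=\frac{\partial}{\partial x}+\sigma$ and $D_s^m$ is its $m$-fold composition. The Fourier transform is $\widehat f(\omega)=\int_{\mathbb{R}}e^{i\omega x}f(x)\,dx$. The coefficients $g_m^{1,\alpha}$ are the power series coefficients of $(1-e^{-\sigma h}\zeta)^{\alpha}=\sum_{m\ge0}g_m^{1,\alpha}\zeta^m$. *)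

theory Defs
  imports "HOL-Analysis.Analysis"
begin

definition subst_kernel :: "complex \<Rightarrow> real \<Rightarrow> (real \<Rightarrow> complex) \<Rightarrow> real \<Rightarrow> real \<Rightarrow> complex" where
  "subst_kernel \<sigma> \<nu> f x \<tau> =
     complex_of_real ((x - \<tau>) powr (\<nu> - 1)) * exp (- \<sigma> * complex_of_real (x - \<tau>)) * f \<tau>"

definition subst_integral :: "complex \<Rightarrow> real \<Rightarrow> (real \<Rightarrow> complex) \<Rightarrow> real \<Rightarrow> complex" where
  "subst_integral \<sigma> \<nu> f x =
     complex_of_real (1 / Gamma \<nu>) * (LINT \<tau>:{..x}|lebesgue. subst_kernel \<sigma> \<nu> f x \<tau>)"

definition Ds :: "complex \<Rightarrow> (real \<Rightarrow> complex) \<Rightarrow> real \<Rightarrow> complex" where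
  "Ds \<sigma> F x = vector_derivative F (at x) + \<sigma> * F x"

definition subst_order :: "real \<Rightarrow> nat" where
  "subst_order \<nu> = (LEAST m. \<nu> < real m)"

definition subst_deriv :: "complex \<Rightarrow> real \<Rightarrow> (real \<Rightarrow> complex) \<Rightarrow> real \<Rightarrow> complex" where
  "subst_deriv \<sigma> \<nu> f =
     (Ds \<sigma> ^^ subst_order \<nu>) (subst_integral \<sigma> (real (subst_order \<nu>) - \<nu>) f)"

text \<open>Lebesgue integrals and \<^const>\<open>vector_derivative\<close> are total functions with arbitrary values
  where the integral or the derivative does not exist, so that the derivative of order \<open>\<nu>\<close> exists
  (on the whole line, in the classical sense) has to be said separately.\<close>

definition has_subst_deriv :: "complex \<Rightarrow> real \<Rightarrow> (real \<Rightarrow> complex) \<Rightarrow> bool" where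
  "has_subst_deriv \<sigma> \<nu> f \<longleftrightarrow>
     (\<forall>x. set_integrable lebesgue {..x} (subst_kernel \<sigma> (real (subst_order \<nu>) - \<nu>) f x)) \<and>
     (\<forall>k<subst_order \<nu>. \<forall>x.
        (Ds \<sigma> ^^ k) (subst_integral \<sigma> (real (subst_order \<nu>) - \<nu>) f) differentiable (at x))"

definition fourier :: "(real \<Rightarrow> complex) \<Rightarrow> real \<Rightarrow> complex" where
  "fourier f \<omega> = (LINT x|lebesgue. exp (\<i> * complex_of_real (\<omega> * x)) * f x)"

primrec g1 :: "complex \<Rightarrow> real \<Rightarrow> real \<Rightarrow> nat \<Rightarrow> complex" where
  "g1 \<sigma> \<alpha> h 0 = 1"
| "g1 \<sigma> \<alpha> h (Suc n) =
     exp (- \<sigma> * complex_of_real h) * complex_of_real (1 - (\<alpha> + 1) / real (Suc n)) * g1 \<sigma> \<alpha> h n"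

definition A1 :: "complex \<Rightarrow> real \<Rightarrow> real \<Rightarrow> (real \<Rightarrow> complex) \<Rightarrow> real \<Rightarrow> complex" where
  "A1 \<sigma> \<alpha> h f x = complex_of_real (1 / h powr \<alpha>) * (\<Sum>m. g1 \<sigma> \<alpha> h m * f (x - real m * h))"

lemma g1_eq_gchoose:
  "g1 \<sigma> \<alpha> h m = (complex_of_real \<alpha> gchoose m) * (- exp (- \<sigma> * complex_of_real h)) ^ m"
proof (induction m)
  case 0
  then show ?case by simp
next
  case (Suc m)
  let ?a = "complex_of_real \<alpha>"
  have eq: "complex_of_real (1 - (\<alpha> + 1) / real (Suc m)) = - ((?a - of_nat m) / of_nat (Suc m))"
    by (simp add: field_simps del: of_nat_Suc) (simp add: algebra_simps)
  have "?a gchoose Suc m = ((?a - of_nat m) / of_nat (Suc m)) * (?a gchoose m)"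
    using gbinomial_absorb_comp[of ?a m] gbinomial_absorption[of m ?a]
    by (simp add: field_simps del: of_nat_Suc)
  with Suc show ?case unfolding g1.simps eq by (simp del: of_nat_Suc)
qed

text \<open>The recursion for \<^const>\<open>g1\<close> yields the coefficients of the generating function.\<close>

lemma g1_generating_function:
  assumes "norm (exp (- \<sigma> * complex_of_real h) * \<zeta>) < 1"
  shows "(\<lambda>m. g1 \<sigma> \<alpha> h m * \<zeta> ^ m) sums
           (1 - exp (- \<sigma> * complex_of_real h) * \<zeta>) powr complex_of_real \<alpha>"
proof -
  have "(\<lambda>m. (complex_of_real \<alpha> gchoose m) * (- (exp (- \<sigma> * complex_of_real h) * \<zeta>)) ^ m) sums
          (1 + (- (exp (- \<sigma> * complex_of_real h) * \<zeta>))) powr complex_of_real \<alpha>"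
    using assms by (intro gen_binomial_complex) simp
  then show ?thesis
    by (simp add: g1_eq_gchoose mult.assoc flip: power_mult_distrib)
qed

end

theory Submission
  imports Defs "HOL-Probability.Characteristic_Functions" "HOL-Complex_Analysis.Conformal_Mappings"
    "HOL-Real_Asymp.Real_Asymp"
begin

text \<open>
  Put \<open>p = \<sigma> - \<i>\<omega>\<close> and \<open>\<phi> = D\<^sub>s\<^bsup>\<alpha>+1\<^esup> f\<close>. By Fourier inversion \<open>f\<close> and \<open>\<phi>\<close> may be
  replaced by continuous functions \<open>f x = \<integral> a(\<omega>) e\<^bsup>-\<i>\<omega>x\<^esup> d\<omega>\<close> and \<open>\<phi> x = \<integral> b(\<omega>) e\<^bsup>-\<i>\<omega>x\<^esup> d\<omega>\<close>
  with integrable \<open>a\<close>, \<open>b\<close>.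

  If \<open>Re \<sigma> \<ge> 0\<close>, then \<open>b = p\<^bsup>\<alpha>+1\<^esup> a\<close>, the derivative \<open>D\<^sub>s\<^bsup>\<alpha>\<^esup> f\<close> has the multiplier \<open>p\<^bsup>\<alpha>\<^esup>\<close>, and
  \<open>A\<^bsup>1,\<alpha>\<^esup> f\<close> has the multiplier \<open>h\<^bsup>-\<alpha>\<^esup> (1 - e\<^bsup>-ph\<^esup>)\<^bsup>\<alpha>\<^esup>\<close>; the two differ by at most \<open>C h \<bar>p\<bar>\<^bsup>\<alpha>+1\<^esup>\<close>. For
  \<open>Re \<sigma> = 0\<close> the fractional kernel is not integrable, so the relation between \<open>a\<close> and \<open>b\<close> is derived for
  iterated differences \<open>g x - e\<^bsup>-\<sigma>\<^esup> g (x - 1)\<close>, whose kernels are integrable.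

  If \<open>Re \<sigma> < 0\<close> and \<open>\<alpha>\<close> is an integer, everything is local and the classical estimate for
  finite differences applies.

  If \<open>Re \<sigma> < 0\<close> and \<open>\<alpha>\<close> is not an integer, then \<open>f = 0\<close>. With \<open>F x = e\<^bsup>\<sigma>x\<^esup> f x\<close>, the Weyl integral
  \<open>I\<^bsup>\<nu>\<^esup> F\<close> decays like \<open>e\<^bsup>Re \<sigma> x\<^esup>\<close> at \<open>+\<infinity>\<close>, because all of its derivatives up to the bounded last one
  tend to \<open>0\<close>. Writing \<open>t\<^bsup>\<nu>-1\<^esup>\<close> as a Laplace transform of \<open>\<lambda>\<^bsup>-\<nu>\<^esup>\<close>, this decay says that the Laplace
  transform of \<open>\<lambda>\<^bsup>-\<nu>\<^esup> \<integral> e\<^bsup>\<lambda>\<tau>\<^esup> F(\<tau>) d\<tau>\<close> on \<open>0 < \<lambda> < - Re \<sigma>\<close> decays as fast as if this function were \<open>0\<close>,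
  hence it is \<open>0\<close>; analytic continuation to the strip \<open>0 < Re z < - Re \<sigma>\<close> gives \<open>F = 0\<close>.
\<close>

section \<open>Fourier inversion\<close>

text \<open>The orders \<open>\<alpha>\<close> and \<open>\<alpha> + 1\<close> are built on the same
  fractional integral, so the second derivative is D_s of the first. The intermediate derivatives
  are only known to be differentiable: no decay and no integrability, hence no Fourier transform of
  their own. The unit difference removes this obstacle: it annihilates exp(- \<sigma> x), the null
  space of D_s, and therefore inverts D_s by integration over an interval of length one, whatever
  the growth. What differences cannot see, the integration constants, is settled at - infinity (at +
  infinity if Re \<sigma> < 0), where the fractional integral itself tends to 0. The order h is paid
  for by the extra derivative: the symbol error carries one more power of |p| than the symbol of
  order \<open>\<alpha>\<close>, and the L1 norm of \<open>b\<close> absorbs it. The sign of Re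
  \<sigma> matters because |exp(- p h)| = exp(- h Re \<sigma>): if this exceeds 1, the binomial
  series of a non-integer power diverges, and multipliers are of no help.\<close>

lemma AE_eq_0_if_interval_integrals_eq_0:
  fixes f :: "real \<Rightarrow> complex"
  assumes f: "integrable lborel f"
    and 0: "\<And>a b. a \<le> b \<Longrightarrow> (LBINT x:{a..b}. f x) = 0"
  shows "AE x in lborel. f x = 0"
proof (rule sigma_finite_measure.density_zero[OF sigma_finite_lborel f])
  have si: "set_integrable lborel A f" if "A \<in> sets borel" for A
    using that f unfolding set_integrable_def by (intro integrable_mult_indicator) auto
  have le: "(LBINT x:{..b}. f x) = 0" for b
  proof (rule LIMSEQ_unique)
    show "(\<lambda>n. LBINT x:{b - real n..b}. f x) \<longlonglongrightarrow> (LBINT x:{..b}. f x)"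
    proof -
      have "(\<Union>n. {b - real n..b}) = {..b}"
        by auto (metis diff_le_eq add.commute real_arch_simple le_diff_eq)
      moreover have "(\<lambda>n. LBINT x:{b - real n..b}. f x) \<longlonglongrightarrow> (LINT x:(\<Union>n. {b - real n..b})|lborel. f x)"
        by (rule set_integral_cont_up) (auto simp: incseq_def intro!: si)
      ultimately show ?thesis by simp
    qed
    show "(\<lambda>n. LBINT x:{b - real n..b}. f x) \<longlonglongrightarrow> 0"
      by (simp add: 0)
  qed
  have top: "(LBINT x:UNIV. f x) = 0"
  proof (rule LIMSEQ_unique)
    have "(\<Union>n. {..real n}) = UNIV"
      by (auto intro: real_arch_simple)
    moreover have "(\<lambda>n. LBINT x:{..real n}. f x) \<longlonglongrightarrow> (LINT x:(\<Union>n. {..real n})|lborel. f x)"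
      by (rule set_integral_cont_up) (auto simp: incseq_def intro!: si)
    ultimately show "(\<lambda>n. LBINT x:{..real n}. f x) \<longlonglongrightarrow> (LBINT x:UNIV. f x)"
      by simp
    show "(\<lambda>n. LBINT x:{..real n}. f x) \<longlonglongrightarrow> 0"
      by (simp add: le)
  qed
  fix A :: "real set" assume "A \<in> sets lborel"
  \<comment> \<open>Half-lines form an intersection-stable generator of the Borel sets, so Dynkin
    induction carries the vanishing from them to all Borel sets.\<close>
  then have A: "A \<in> sigma_sets UNIV (range atMost)"
    by (simp add: borel_eq_atMost)
  have G: "Int_stable (range (atMost :: real \<Rightarrow> _))" "range atMost \<subseteq> Pow (UNIV :: real set)"
    by (auto simp: Int_stable_def)
  show "(LBINT x:A. f x) = 0"
    using G A
  proof (induction A rule: sigma_sets_induct_disjoint)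
    case (compl A)
    then have [measurable]: "A \<in> sets borel" by (simp add: borel_eq_atMost)
    have "(LINT x:A \<union> (UNIV - A)|lborel. f x) = (LBINT x:A. f x) + (LBINT x:UNIV - A. f x)"
      by (intro set_integral_Un si) auto
    with compl top show ?case by simp
  next
    case (union A)
    then have [measurable]: "\<And>i. A i \<in> sets borel" by (auto simp: borel_eq_atMost)
    have "(LINT x:(\<Union>i. A i)|lborel. f x) = (\<Sum>i. LBINT x:A i. f x)"
      using union by (intro lebesgue_integral_countable_add si) (auto simp: disjoint_family_on_def)
    with union show ?case by simp
  qed (use le in \<open>auto simp: set_lebesgue_integral_def\<close>)
qed

text \<open>Boundedness of \<open>k\<close> reduces integrability on the product to that of
  \<open>f\<close> and \<open>g\<close>. Below, \<open>k\<close> is a unimodular exponential, except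
  in \<open>fourier_inversion_interval\<close>, where it is a Gaussian.\<close>

lemma lborel_Fubini_bounded:
  fixes f g :: "real \<Rightarrow> complex" and k :: "real \<Rightarrow> real \<Rightarrow> complex"
  assumes f: "integrable lborel f" and g: "integrable lborel g"
    and k[measurable]: "case_prod k \<in> borel_measurable (borel \<Otimes>\<^sub>M borel)"
    and bound: "\<And>x y. norm (k x y) \<le> B"
  shows "(LBINT x. f x * (LBINT y. g y * k x y)) =
         (LBINT y. g y * (LBINT x. f x * k x y))"
proof -
  note [measurable] = borel_measurable_integrable[OF f] borel_measurable_integrable[OF g]
  have k1[measurable]: "(\<lambda>y. k x y) \<in> borel_measurable borel" for x
    using k by measurable
  have B: "0 \<le> B" using bound[of 0 0] norm_ge_zero order_trans by blast
  have int: "integrable (lborel \<Otimes>\<^sub>M lborel) (\<lambda>(x, y). f x * (g y * k x y))"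
  proof (rule lborel_pair.Fubini_integrable)
    show "(\<lambda>(x, y). f x * (g y * k x y)) \<in> borel_measurable (lborel \<Otimes>\<^sub>M lborel)"
      by measurable
    have *: "integrable lborel (\<lambda>y. g y * k x y)" for x
      by (rule Bochner_Integration.integrable_bound[of _ "\<lambda>y. B * norm (g y)"])
         (use g bound B in \<open>auto simp: norm_mult mult.commute[of B] intro!: mult_left_mono\<close>)
    show "AE x in lborel. integrable lborel (\<lambda>y. case (x, y) of (x, y) \<Rightarrow> f x * (g y * k x y))"
      using * by simp
    show "integrable lborel (\<lambda>x. LBINT y. norm (case (x, y) of (x, y) \<Rightarrow> f x * (g y * k x y)))"
    proof (rule Bochner_Integration.integrable_bound[of _ "\<lambda>x. norm (f x) * (B * (LBINT y. norm (g y)))"])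
      show "AE x in lborel. norm (LBINT y. norm (case (x, y) of (x, y) \<Rightarrow> f x * (g y * k x y)))
        \<le> norm (norm (f x) * (B * (LBINT y. norm (g y))))"
      proof (rule AE_I2)
        fix x
        have "(LBINT y. norm (f x * (g y * k x y))) \<le> (LBINT y. norm (f x) * (B * norm (g y)))"
          using g bound integrable_norm[OF integrable_mult_right[OF *[of x], of "f x"]]
          by (intro integral_mono) (auto simp: norm_mult mult.commute[of B] intro!: mult_left_mono)
        then show "norm (LBINT y. norm (case (x, y) of (x, y) \<Rightarrow> f x * (g y * k x y)))
        \<le> norm (norm (f x) * (B * (LBINT y. norm (g y))))"
          using B by (simp add: abs_mult)
      qed
    qed (use f in auto)
  qed
  have "(LBINT x. f x * (LBINT y. g y * k x y)) =
        (LBINT x. LBINT y. f x * (g y * k x y))"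
    by simp
  also have "\<dots> = (LBINT y. LBINT x. f x * (g y * k x y))"
    using lborel_pair.Fubini_integral[OF int] by simp
  also have "\<dots> = (LBINT y. LBINT x. g y * (f x * k x y))"
    by (simp add: mult_ac)
  finally show ?thesis by simp
qed

text \<open>A non-integrable \<open>f\<close> has integral 0 by convention, and \<open>g\<close> is
  nonnegative almost everywhere, so this case is covered too.\<close>

lemma norm_integral_le:
  fixes f :: "'a \<Rightarrow> 'b :: {banach, second_countable_topology}"
  assumes g: "integrable M g" and le: "AE x in M. norm (f x) \<le> g x"
  shows "norm (integral\<^sup>L M f) \<le> integral\<^sup>L M g"
proof (cases "integrable M f")
  case True
  have "norm (integral\<^sup>L M f) \<le> (LINT x|M. norm (f x))"
    by (rule integral_norm_bound)
  also have "\<dots> \<le> integral\<^sup>L M g"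
    using True g le by (intro integral_mono_AE integrable_norm)
  finally show ?thesis .
next
  case False
  have "AE x in M. 0 \<le> g x"
    using le by eventually_elim (rule order_trans[OF norm_ge_zero])
  then show ?thesis
    using False by (simp add: not_integrable_integral_eq integral_nonneg_AE)
qed

text \<open>The sign is opposite to that of \<open>fourier\<close>; the factor 1/(2 pi) of the
  inversion formula is left to the density \<open>a\<close>.\<close>

definition fourier_synth :: "(real \<Rightarrow> complex) \<Rightarrow> real \<Rightarrow> complex" where
  "fourier_synth a x = (LBINT w. a w * iexp (- (w * x)))"

lemma integrable_mult_bounded:
  fixes f g :: "'a \<Rightarrow> complex"
  assumes "integrable M f" "g \<in> borel_measurable M" "\<And>x. x \<in> space M \<Longrightarrow> norm (g x) \<le> B"
  shows "integrable M (\<lambda>x. f x * g x)" "integrable M (\<lambda>x. g x * f x)"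
proof -
  have "integrable M (\<lambda>x. f x * g x)"
  proof (rule Bochner_Integration.integrable_bound[of _ "\<lambda>x. B * norm (f x)"])
    show "AE x in M. norm (f x * g x) \<le> norm (B * norm (f x))"
    proof (rule AE_I2)
      fix x assume "x \<in> space M"
      from assms(3)[OF this] have "norm (f x) * norm (g x) \<le> norm (f x) * \<bar>B\<bar>"
        by (intro mult_left_mono) auto
      then show "norm (f x * g x) \<le> norm (B * norm (f x))"
        by (simp add: norm_mult abs_mult mult.commute)
    qed
  qed (use assms in auto)
  then show "integrable M (\<lambda>x. f x * g x)" "integrable M (\<lambda>x. g x * f x)"
    by (simp_all add: mult.commute)
qed

lemma iexp_borel_measurable [measurable]: "iexp \<in> borel_measurable borel"
  by (intro borel_measurable_continuous_onI continuous_intros)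

lemma fourier_synth_integrable:
  assumes "integrable lborel a"
  shows "integrable lborel (\<lambda>w. a w * iexp (- (w * x)))"
  by (rule integrable_mult_bounded[OF assms, where B=1]) (auto intro!: borel_measurable_continuous_onI continuous_intros)

lemma fourier_synth_bound:
  assumes "integrable lborel a"
  shows "norm (fourier_synth a x) \<le> (LBINT w. norm (a w))"
  unfolding fourier_synth_def by (rule norm_integral_le) (use assms in \<open>auto simp: norm_mult\<close>)

lemma continuous_fourier_synth:
  assumes a: "integrable lborel a"
  shows "continuous_on UNIV (fourier_synth a)"
proof (rule continuous_at_imp_continuous_on, rule ballI)
  fix x :: real
  note [measurable] = borel_measurable_integrable[OF a]
  show "isCont (fourier_synth a) x"
    unfolding continuous_at_sequentially o_def
  proof (intro allI impI)
    fix X :: "nat \<Rightarrow> real" assume X: "X \<longlonglongrightarrow> x"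
    show "(\<lambda>n. fourier_synth a (X n)) \<longlonglongrightarrow> fourier_synth a x"
      unfolding fourier_synth_def
    proof (rule integral_dominated_convergence)
      show "integrable lborel (\<lambda>w. norm (a w))" using a by simp
      show "AE w in lborel. (\<lambda>n. a w * iexp (- (w * X n))) \<longlonglongrightarrow> a w * iexp (- (w * x))"
        using X by (intro AE_I2 tendsto_intros) 
    qed (auto simp: norm_mult)
  qed
qed

lemma fourier_synth_borel [measurable]:
  "integrable lborel a \<Longrightarrow> fourier_synth a \<in> borel_measurable borel"
  by (intro borel_measurable_continuous_onI continuous_fourier_synth)

lemma integral_std_normal: 
  "(LBINT t. complex_of_real (exp (- (t\<^sup>2) / 2)) * iexp (t * z)) = sqrt (2 * pi) * exp (- (z\<^sup>2) / 2)"
proof -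
  have "complex_of_real (exp (- (z\<^sup>2) / 2)) = char std_normal_distribution z"
    by (simp add: char_std_normal_distribution)
  also have "\<dots> = (LBINT t. std_normal_density t *\<^sub>R iexp (z * t))"
    unfolding char_def by (subst integral_density) (auto simp: normal_density_nonneg)
  also have "\<dots> = (LBINT t. complex_of_real (1 / sqrt (2 * pi)) * (complex_of_real (exp (- (t\<^sup>2) / 2)) * iexp (t * z)))"
    by (intro Bochner_Integration.integral_cong) (auto simp: std_normal_density_def scaleR_conv_of_real mult_ac)
  also have "\<dots> = complex_of_real (1 / sqrt (2 * pi)) * (LBINT t. complex_of_real (exp (- (t\<^sup>2) / 2)) * iexp (t * z))"
    by simp
  finally show ?thesis by (simp add: field_simps)
qed

lemma integrable_gauss: "integrable lborel (\<lambda>t::real. exp (- (t\<^sup>2) / 2))"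
proof -
  have "integrable lborel (\<lambda>t. sqrt (2*pi) * std_normal_density t)"
    by (intro integrable_mult_right integrable_normal_density) auto
  then show ?thesis by (simp add: std_normal_density_def)
qed

lemma gauss_fourier:
  assumes "e > 0"
  shows "(LBINT w. complex_of_real (exp (- ((e * w)\<^sup>2) / 2)) * iexp (w * z)) =
         complex_of_real (sqrt (2 * pi) / e * exp (- ((z / e)\<^sup>2) / 2))"
proof -
  let ?F = "\<lambda>t. complex_of_real (exp (- (t\<^sup>2) / 2)) * iexp (t * (z / e))"
  have "(LBINT t. ?F t) = \<bar>e\<bar> *\<^sub>R (LBINT w. ?F (0 + e * w))"
    using assms by (intro lborel_integral_real_affine) auto
  moreover have "?F (0 + e * w) = complex_of_real (exp (- ((e * w)\<^sup>2) / 2)) * iexp (w * z)" for w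
    using assms by simp
  ultimately show ?thesis
    using assms unfolding integral_std_normal by (simp add: scaleR_conv_of_real field_simps)
qed

text \<open>The Gaussian makes the frequency integral absolutely convergent, so Fubini applies and
  turns the damped inversion integral into an average of \<open>g\<close> against a Gaussian of
  width \<open>e\<close> about \<open>x\<close>.\<close>

lemma integral_iexp_gauss_swap:
  fixes g :: "real \<Rightarrow> complex"
  assumes g: "integrable lborel g" and e: "e > 0"
  shows "(LBINT w. (LBINT y. g y * iexp (w * y)) * complex_of_real (exp (- ((e * w)\<^sup>2) / 2)) * iexp (- (w * x)))
       = (LBINT y. g y * complex_of_real (sqrt (2 * pi) / e * exp (- (((y - x) / e)\<^sup>2) / 2)))"
proof -
  have gi: "integrable lborel (\<lambda>w. complex_of_real (exp (- ((e * w)\<^sup>2) / 2)))"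
    using lborel_integrable_real_affine[OF integrable_gauss, of e 0] e by simp
  have "(LBINT w. (LBINT y. g y * iexp (w * y)) * complex_of_real (exp (- ((e * w)\<^sup>2) / 2)) * iexp (- (w * x)))
     = (LBINT w. complex_of_real (exp (- ((e * w)\<^sup>2) / 2)) * (LBINT y. g y * iexp (w * (y - x))))"
  proof (rule Bochner_Integration.integral_cong[OF refl])
    fix w
    have "(LBINT y. g y * iexp (w * (y - x))) = (LBINT y. g y * iexp (w * y)) * iexp (- (w * x))"
      unfolding integral_mult_left_zero[symmetric]
      by (intro Bochner_Integration.integral_cong) (auto simp: algebra_simps exp_diff exp_minus divide_inverse)
    then show "(LBINT y. g y * iexp (w * y)) * complex_of_real (exp (- ((e * w)\<^sup>2) / 2)) * iexp (- (w * x))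
      = complex_of_real (exp (- ((e * w)\<^sup>2) / 2)) * (LBINT y. g y * iexp (w * (y - x)))"
      by simp
  qed
  also have "\<dots> = (LBINT y. g y * (LBINT w. complex_of_real (exp (- ((e * w)\<^sup>2) / 2)) * iexp (w * (y - x))))"
    by (rule lborel_Fubini_bounded[OF gi g, where B=1]) auto
  finally show ?thesis
    by (simp only: gauss_fourier[OF e])
qed

text \<open>Testing against an interval moves the Gaussian average from \<open>g\<close> to an
  indicator function, whose averages converge pointwise off the endpoints; convergence at Lebesgue
  points of \<open>g\<close> is thereby avoided.\<close>

lemma fourier_inversion_interval:
  fixes g :: "real \<Rightarrow> complex" and a b :: real
  defines "G \<equiv> \<lambda>w. LBINT y. g y * iexp (w * y)"
  assumes g: "integrable lborel g" and G: "integrable lborel G"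
  shows "(LBINT x:{a..b}. fourier_synth G x) = 2 * pi * (LBINT x:{a..b}. g x)"
proof -
  note [measurable] = borel_measurable_integrable[OF g] borel_measurable_integrable[OF G] fourier_synth_borel[OF G]
  define e where "e n = inverse (real (Suc n))" for n
  have e: "e n > 0" for n by (simp add: e_def)
  have e0: "e \<longlonglongrightarrow> 0"
    unfolding e_def by (rule LIMSEQ_inverse_real_of_nat)
  let ?q = "\<lambda>n w. complex_of_real (exp (- ((e n * w)\<^sup>2) / 2))"
  let ?i = "\<lambda>x. complex_of_real (indicator {a..b} x)"
  let ?n = "\<lambda>t. complex_of_real (exp (- (t\<^sup>2) / 2))"
  define J where "J n x = (LBINT w. G w * ?q n w * iexp (- (w * x)))" for n x
  define N where "N n z = complex_of_real (sqrt (2 * pi) / e n * exp (- ((z / e n)\<^sup>2) / 2))" for n z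
  define P where "P n y = (LBINT x. ?i x * N n (y - x))" for n y
  have Nm[measurable]: "N n \<in> borel_measurable borel" for n
    unfolding N_def by measurable
  have Nb: "norm (N n z) \<le> sqrt (2 * pi) / e n" for n z
    using e[of n] unfolding N_def norm_of_real by (auto simp: abs_mult intro!: divide_right_mono mult_left_le)
  have J: "J n x = (LBINT y. g y * N n (y - x))" for n x
    unfolding J_def G_def N_def by (rule integral_iexp_gauss_swap[OF g e])
  have Jm[measurable]: "J n \<in> borel_measurable borel" for n
    unfolding J_def by measurable
  have Jb: "norm (J n x) \<le> (LBINT w. norm (G w))" for n x
    unfolding J_def by (rule norm_integral_le) (use G in \<open>auto simp: norm_mult intro!: mult_left_le\<close>)
  have lim1: "(\<lambda>n. LBINT x. ?i x * J n x) \<longlonglongrightarrow>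
     (LBINT x. ?i x * fourier_synth G x)"
  proof (rule integral_dominated_convergence)
    show "integrable lborel (\<lambda>x. (LBINT w. norm (G w)) * indicator {a..b} x)"
      by (intro integrable_mult_right) (auto simp: integrable_indicator_iff emeasure_lborel_Icc_eq)
    show "AE x in lborel. norm (?i x * J n x) \<le> (LBINT w. norm (G w)) * indicator {a..b} x" for n
      using Jb[of n] by (auto simp: indicator_def)
    show "AE x in lborel. (\<lambda>n. ?i x * J n x) \<longlonglongrightarrow> ?i x * fourier_synth G x"
    proof (intro AE_I2 tendsto_mult tendsto_const)
      fix x
      show "(\<lambda>n. J n x) \<longlonglongrightarrow> fourier_synth G x"
        unfolding J_def fourier_synth_def
      proof (rule integral_dominated_convergence)
        show "integrable lborel (\<lambda>w. norm (G w))" using G by simp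
        show "AE w in lborel. norm (G w * ?q n w * iexp (- (w * x))) \<le> norm (G w)" for n
          by (auto simp: norm_mult intro!: mult_left_le)
        show "AE w in lborel. (\<lambda>n. G w * ?q n w * iexp (- (w * x))) \<longlonglongrightarrow> G w * iexp (- (w * x))"
        proof (rule AE_I2)
          fix w
          have "(\<lambda>n. G w * ?q n w * iexp (- (w * x))) \<longlonglongrightarrow> 
            G w * complex_of_real (exp (- ((0 * w)\<^sup>2) / 2)) * iexp (- (w * x))"
            by (intro tendsto_intros e0) auto
          then show "(\<lambda>n. G w * ?q n w * iexp (- (w * x))) \<longlonglongrightarrow> G w * iexp (- (w * x))"
            by simp
        qed
      qed auto
    qed
  qed auto
  have ii: "integrable lborel (\<lambda>x. ?i x)"
    by (auto simp: integrable_indicator_iff emeasure_lborel_Icc_eq)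
  have swap: "(LBINT x. ?i x * J n x) = (LBINT y. g y * P n y)" for n
    unfolding J P_def by (rule lborel_Fubini_bounded[OF ii g _ Nb]) measurable
  \<comment> \<open>Rescaling by \<open>e n\<close> fixes the Gaussian and puts the dependence on
    \<open>n\<close> into the indicator, as dominated convergence requires.\<close>
  have P: "P n y = (LBINT t. complex_of_real (sqrt (2 * pi)) * (?i (y + e n * t) * ?n t))" for n y
  proof -
    have "P n y = \<bar>e n\<bar> *\<^sub>R (LBINT t. ?i (y + e n * t) * N n (y - (y + e n * t)))"
      unfolding P_def using e[of n] by (intro lborel_integral_real_affine) auto
    also have "\<dots> = (LBINT t. complex_of_real (sqrt (2 * pi)) * (?i (y + e n * t) * ?n t))"
      unfolding integral_scaleR_right[symmetric] using e[of n]
      by (intro Bochner_Integration.integral_cong) (auto simp: N_def scaleR_conv_of_real mult_ac)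
    finally show ?thesis .
  qed
  have gi2: "integrable lborel (\<lambda>t. sqrt (2 * pi) * exp (- (t\<^sup>2) / 2))"
    by (intro integrable_mult_right integrable_gauss)
  have gi3: "(LBINT t. sqrt (2 * pi) * exp (- (t\<^sup>2) / 2)) = 2 * pi"
  proof -
    have "complex_of_real (LBINT t. exp (- (t\<^sup>2) / 2)) = sqrt (2 * pi)"
      using integral_std_normal[of 0] by (simp flip: of_real_eq_iff integral_complex_of_real)
    then have "(LBINT t. exp (- (t\<^sup>2) / 2)) = sqrt (2 * pi)"
      by (simp only: of_real_eq_iff)
    then show ?thesis by simp
  qed
  have Pb: "norm (P n y) \<le> 2 * pi" for n y
    unfolding P by (rule order_trans[OF norm_integral_le[OF gi2] eq_refl[OF gi3]])
      (auto simp: norm_mult indicator_def)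
  have Pm[measurable]: "P n \<in> borel_measurable borel" for n
    unfolding P_def by measurable
  \<comment> \<open>If a < b, a Gaussian centred at an endpoint leaves half of its mass outside the
    interval; the endpoints form a null set.\<close>
  have Pl: "(\<lambda>n. P n y) \<longlonglongrightarrow> 2 * pi * ?i y" if ne: "y \<noteq> a" "y \<noteq> b" for y
  proof -
    have "(\<lambda>n. P n y) \<longlonglongrightarrow> (LBINT t. complex_of_real (sqrt (2 * pi)) * (?i y * ?n t))"
      unfolding P
    proof (rule integral_dominated_convergence[OF _ _ gi2])
      show "AE t in lborel. norm (complex_of_real (sqrt (2 * pi)) * (?i (y + e n * t) * ?n t)) \<le> sqrt (2 * pi) * exp (- (t\<^sup>2) / 2)" for n
        by (auto simp: norm_mult indicator_def)
      have "\<forall>\<^sub>F n in sequentially. indicator {a..b} (y + e n * t) = (indicator {a..b} y :: real)" for t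
      proof -
        have l: "(\<lambda>n. y + e n * t) \<longlonglongrightarrow> y" using tendsto_add[OF tendsto_const tendsto_mult_left_zero[OF e0]] by force
        consider "y < a" | "y > b" | "a < y" "y < b" using ne by linarith
        then show ?thesis
        proof cases
          case 1
          then show ?thesis using order_tendstoD(2)[OF l 1] by (auto elim!: eventually_mono)
        next
          case 2
          then show ?thesis using order_tendstoD(1)[OF l 2] by (auto elim!: eventually_mono)
        next
          case 3
          show ?thesis using order_tendstoD(1)[OF l 3(1)] order_tendstoD(2)[OF l 3(2)]
            by eventually_elim (use 3 in auto)
        qed
      qed
      then show "AE t in lborel. (\<lambda>n. complex_of_real (sqrt (2 * pi)) * (?i (y + e n * t) * ?n t)) \<longlonglongrightarrow>
         complex_of_real (sqrt (2 * pi)) * (?i y * ?n t)"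
        by (intro AE_I2 tendsto_eventually) (auto elim!: eventually_mono)
    qed auto
    also have "(LBINT t. complex_of_real (sqrt (2 * pi)) * (?i y * ?n t))
      = (LBINT t. ?i y * complex_of_real (sqrt (2 * pi) * exp (- (t\<^sup>2) / 2)))"
      by (simp add: mult_ac)
    also have "\<dots> = ?i y * complex_of_real (2 * pi)"
      by (simp only: integral_mult_right_zero integral_complex_of_real gi3[unfolded integral_mult_right_zero])
    finally show ?thesis by (simp add: mult_ac)
  qed
  have lim2: "(\<lambda>n. LBINT y. g y * P n y) \<longlonglongrightarrow> (LBINT y. g y * (2 * pi * ?i y))"
  proof (rule integral_dominated_convergence)
    show "integrable lborel (\<lambda>y. norm (g y) * (2 * pi))" using g by simp
    show "AE y in lborel. norm (g y * P n y) \<le> norm (g y) * (2 * pi)" for n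
      using Pb by (auto simp: norm_mult intro!: mult_left_mono)
    have "AE y in lborel. y \<noteq> a" "AE y in lborel. y \<noteq> b" by (rule AE_lborel_singleton)+
    then show "AE y in lborel. (\<lambda>n. g y * P n y) \<longlonglongrightarrow> g y * (2 * pi * ?i y)"
      by eventually_elim (intro tendsto_intros Pl)
  qed auto
  have "(LBINT x. ?i x * fourier_synth G x) = (LBINT y. g y * (2 * pi * ?i y))"
    using LIMSEQ_unique[OF lim1[unfolded swap] lim2] .
  also have "\<dots> = (LBINT y. (2 * pi) * (?i y * g y))"
    by (simp add: mult_ac)
  finally show ?thesis
    by (simp add: set_lebesgue_integral_def scaleR_conv_of_real)
qed

theorem fourier_inversion:
  fixes g :: "real \<Rightarrow> complex"
  defines "G \<equiv> \<lambda>w. LBINT y. g y * iexp (w * y)"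
  assumes g: "integrable lborel g" and G: "integrable lborel G"
  shows "AE x in lborel. g x = fourier_synth (\<lambda>w. G w / (2 * pi)) x"
proof -
  note [measurable] = borel_measurable_integrable[OF g] borel_measurable_integrable[OF G] fourier_synth_borel[OF G]
  have si: "set_integrable lborel A g" if "A \<in> sets borel" for A
    using that g unfolding set_integrable_def by (intro integrable_mult_indicator) auto
  define h where "h x = g x - fourier_synth G x / (2 * pi)" for x
  have FI: "set_integrable lborel {a..b} (\<lambda>x. fourier_synth G x / (2 * pi))" for a b :: real
    using borel_integrable_atLeastAtMost'[of a b "fourier_synth G"] continuous_fourier_synth[OF G]
    by (intro set_integrable_divide) (auto intro: continuous_on_subset)
  have hI: "set_integrable lborel {a..b} h" for a b
    unfolding h_def by (intro set_integral_diff FI si) auto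
  have h0: "(LBINT x:{a..b}. h x) = 0" for a b
    unfolding h_def
  proof (subst set_integral_diff[OF si FI])
    show "(LBINT x:{a..b}. g x) - (LBINT x:{a..b}. fourier_synth G x / (2 * pi)) = 0"
      using fourier_inversion_interval[OF g, of a b] G unfolding G_def by simp
  qed auto
  \<comment> \<open>\<open>h\<close> is so far integrable only over bounded intervals, hence the
    cut-off to [-n, n].\<close>
  have "AE x in lborel. indicator {- real n..real n} x *\<^sub>R h x = 0" for n
  proof (rule AE_eq_0_if_interval_integrals_eq_0)
    show "integrable lborel (\<lambda>x. indicator {- real n..real n} x *\<^sub>R h x)"
      using hI by (simp add: set_integrable_def)
    fix a b :: real
    have "(LBINT x:{a..b}. indicator {- real n..real n} x *\<^sub>R h x) = (LINT x:{max a (- real n)..min b (real n)}|lborel. h x)"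
      unfolding set_lebesgue_integral_def by (intro Bochner_Integration.integral_cong) (auto simp: indicator_def)
    then show "(LBINT x:{a..b}. indicator {- real n..real n} x *\<^sub>R h x) = 0"
      by (simp add: h0)
  qed
  then have "AE x in lborel. \<forall>n. indicator {- real n..real n} x *\<^sub>R h x = 0"
    unfolding AE_all_countable by blast
  then show ?thesis
  proof eventually_elim
    case (elim x)
    obtain n where "\<bar>x\<bar> \<le> real n" using real_arch_simple by blast
    with elim[rule_format, of n] have "h x = 0" by (auto simp: indicator_def split: if_splits)
    then show ?case by (simp add: h_def fourier_synth_def)
  qed
qed

text \<open>A vanishing synthesis at -w is a vanishing transform of \<open>a\<close> at w, and
  inversion then recovers \<open>a\<close> from the zero function.\<close>

corollary fourier_synth_eq_0_imp:
  assumes a: "integrable lborel a" and 0: "\<And>x. fourier_synth a x = 0"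
  shows "AE w in lborel. a w = 0"
proof -
  have "(LBINT y. a y * iexp (w * y)) = 0" for w
    using 0[of "-w"] by (simp add: fourier_synth_def mult.commute)
  then show ?thesis
    using fourier_inversion[OF a] by (simp add: fourier_synth_def)
qed

corollary fourier_synth_unique:
  assumes a: "integrable lborel a" and b: "integrable lborel b"
    and eq: "\<And>x. fourier_synth a x = fourier_synth b x"
  shows "AE w in lborel. a w = b w"
proof -
  have "AE w in lborel. a w - b w = 0"
  proof (rule fourier_synth_eq_0_imp)
    fix x
    have "fourier_synth (\<lambda>w. a w - b w) x = fourier_synth a x - fourier_synth b x"
      unfolding fourier_synth_def left_diff_distrib
      by (intro Bochner_Integration.integral_diff fourier_synth_integrable a b)
    then show "fourier_synth (\<lambda>w. a w - b w) x = 0" by (simp add: eq)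
  qed (use a b in auto)
  then show ?thesis by simp
qed

section \<open>Limits of iterated derivatives, Laplace transforms\<close>

text \<open>Passing to \<open>W k x - W k (x - 1)\<close> keeps the chain of derivatives and the
  limit 0 at the bottom, while the mean value theorem moves the limit \<open>c\<close> one level
  down. This removes integration constants when only the two ends of the chain are
  controlled.\<close>

lemma iterated_derivative_limit_zero:
  fixes W :: "nat \<Rightarrow> real \<Rightarrow> complex"
  assumes F: "F = at_top \<or> F = at_bot"
    and der: "\<And>k x. k < m \<Longrightarrow> (W k has_vector_derivative W (Suc k) x) (at x)"
    and W0: "(W 0 \<longlongrightarrow> 0) F" and Wm: "(W m \<longlongrightarrow> c) F"
  shows "c = 0"
  using der W0 Wm
proof (induction m arbitrary: W)
  case 0
  have "F \<noteq> bot" using F by (metis trivial_limit_at_top_linorder trivial_limit_at_bot_linorder)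
  then show ?case using tendsto_unique 0 by blast
next
  case (Suc m)
  have sh: "filterlim (\<lambda>x. x - 1) F F"
    using F
  proof
    assume [simp]: "F = at_top"
    show ?thesis
      by (simp add: filterlim_at_top) (metis (mono_tags, lifting) eventually_at_top_linorder le_diff_eq)
  next
    assume [simp]: "F = at_bot"
    show ?thesis
      by (simp add: filterlim_at_bot) (metis (mono_tags, lifting) diff_le_eq eventually_at_bot_linorder)
  qed
  have win: "\<forall>\<^sub>F x in F. \<forall>y\<in>{x - 1..x}. P y" if "\<forall>\<^sub>F x in F. P x" for P
    using F
  proof
    assume [simp]: "F = at_top"
    obtain N where N: "\<And>x. x \<ge> N \<Longrightarrow> P x" using \<open>\<forall>\<^sub>F x in F. P x\<close> by (auto simp: eventually_at_top_linorder)
    show ?thesis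
      by (simp, subst eventually_at_top_linorder) (auto intro!: exI[of _ "N + 1"] N)
  next
    assume [simp]: "F = at_bot"
    obtain N where N: "\<And>x. x \<le> N \<Longrightarrow> P x" using \<open>\<forall>\<^sub>F x in F. P x\<close> by (auto simp: eventually_at_bot_linorder)
    show ?thesis
      by (simp, subst eventually_at_bot_linorder) (auto intro!: exI[of _ "N"] N)
  qed
  define V where "V k x = W k x - W k (x - 1)" for k x
  show ?case
  proof (rule Suc.IH[of V])
    fix k x assume "k < m"
    then have d: "(W k has_vector_derivative W (Suc k) x) (at x)" for x using Suc.prems(1) by simp
    have "((\<lambda>x. W k (x - 1)) has_vector_derivative 1 *\<^sub>R W (Suc k) (x - 1)) (at x)"
      by (rule vector_diff_chain_at[of "\<lambda>x. x - 1" 1 x "W k", unfolded o_def])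
         (auto intro!: derivative_eq_intros d)
    with d show "(V k has_vector_derivative V (Suc k) x) (at x)"
      unfolding V_def by (auto intro!: has_vector_derivative_diff)
  next
    have "((\<lambda>x. W 0 x - W 0 (x - 1)) \<longlongrightarrow> 0 - 0) F"
      by (intro tendsto_diff Suc.prems filterlim_compose[OF Suc.prems(2) sh])
    then show "(V 0 \<longlongrightarrow> 0) F" by (simp add: V_def[abs_def])
  next
    show "(V m \<longlongrightarrow> c) F"
    proof (rule tendstoI)
      fix e :: real assume e: "e > 0"
      then have "\<forall>\<^sub>F x in F. dist (W (Suc m) x) c < e / 2"
        using Suc.prems(3) half_gt_zero tendstoD by blast
      from win[OF this] show "\<forall>\<^sub>F x in F. dist (V m x) c < e"
      proof eventually_elim
        case (elim x)
        \<comment> \<open>Subtracting the linear function of slope \<open>c\<close> leaves the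
          derivative \<open>W (Suc m) y - c\<close>, which is small on the whole unit
          window.\<close>
        have "norm ((W m x - x *\<^sub>R c) - (W m (x - 1) - (x - 1) *\<^sub>R c)) \<le> e / 2 * norm (x - (x - 1))"
        proof (rule differentiable_bound[where S="{x - 1..x}"])
          fix y assume y: "y \<in> {x - 1..x}"
          have "((\<lambda>x. W m x - x *\<^sub>R c) has_vector_derivative (W (Suc m) y - c)) (at y within {x-1..x})"
            using Suc.prems(1)[of m y]
            by (auto intro!: derivative_eq_intros intro: has_vector_derivative_at_within)
          then show "((\<lambda>x. W m x - x *\<^sub>R c) has_derivative (\<lambda>h. h *\<^sub>R (W (Suc m) y - c))) (at y within {x-1..x})"
            by (simp add: has_vector_derivative_def)
          show "onorm (\<lambda>h. h *\<^sub>R (W (Suc m) y - c)) \<le> e / 2"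
          proof (rule onorm_le)
            fix h :: real
            have "norm (W (Suc m) y - c) \<le> e / 2"
              using elim y by (simp add: dist_norm less_imp_le)
            then show "norm (h *\<^sub>R (W (Suc m) y - c)) \<le> e / 2 * norm h"
              using mult_left_mono[of "norm (W (Suc m) y - c)" "e / 2" "\<bar>h\<bar>"] by (simp add: mult.commute)
          qed
        qed auto
        then have "norm (V m x - c) \<le> e / 2"
          by (simp add: V_def algebra_simps)
        with e show ?case by (simp add: dist_norm)
      qed
    qed
  qed
qed

section \<open>Laplace transforms and the Gamma integral\<close>

text \<open>Expanding the exponential about \<open>z0\<close> and integrating term by term gives a
  power series; holomorphy follows without differentiating under the integral.\<close>

lemma laplace_transform_holomorphic:
  fixes g :: "real \<Rightarrow> complex"
  assumes g[measurable]: "g \<in> borel_measurable borel" and S: "open S"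
    and int: "\<And>z. z \<in> S \<Longrightarrow> integrable lborel (\<lambda>x. exp (z * x) * g x)"
  shows "(\<lambda>z. LBINT x. exp (z * x) * g x) holomorphic_on S"
proof -
  have "\<exists>r>0. ball z0 r \<subseteq> S \<and> (\<lambda>z. LBINT x. exp (z * x) * g x) holomorphic_on ball z0 r" if z0: "z0 \<in> S" for z0
  proof -
    obtain r where r: "r > 0" "cball z0 r \<subseteq> S"
      using S z0 open_contains_cball by blast
    have "(\<lambda>z. LBINT x. exp (z * x) * g x) holomorphic_on ball z0 r"
    proof (rule power_series_holomorphic)
      fix w assume w: "w \<in> ball z0 r"
      define \<rho> where "\<rho> = norm (w - z0)"
      have \<rho>: "0 \<le> \<rho>" "\<rho> < r" using w by (auto simp: \<rho>_def dist_norm norm_minus_commute)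
      define f where "f n x = exp (z0 * x) * g x * complex_of_real (x ^ n / fact n) * (w - z0) ^ n" for n and x :: real
      \<comment> \<open>On each half-line, the growth exp(|x| \<rho>) is that of one of the real
        shifts of \<open>z0\<close> by \<rho>. Both shifts lie in \<open>S\<close>, so
        \<open>u\<close> is an integrable majorant of all partial sums.\<close>
      define u where "u x = norm (exp ((z0 + of_real \<rho>) * x) * g x) + norm (exp ((z0 - of_real \<rho>) * x) * g x)" for x :: real
      have "z0 + of_real \<rho> \<in> S" "z0 - of_real \<rho> \<in> S"
        using r \<rho> by (auto simp: subset_iff dist_norm)
      then have u: "integrable lborel u"
        unfolding u_def by (intro Bochner_Integration.integrable_add integrable_norm int)
      have nf: "norm (f n x) = norm (exp (z0 * x) * g x) * ((\<bar>x\<bar> * \<rho>) ^ n /\<^sub>R fact n)" for n x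
        by (simp add: f_def norm_mult norm_power \<rho>_def power_mult_distrib norm_divide power_abs abs_mult divide_inverse mult_ac del: of_real_mult of_real_divide)
      have snf: "(\<lambda>n. norm (f n x)) sums (norm (exp (z0 * x) * g x) * exp (\<bar>x\<bar> * \<rho>))" for x
        unfolding nf by (intro sums_mult exp_converges)
      have le_u: "norm (exp (z0 * x) * g x) * exp (\<bar>x\<bar> * \<rho>) \<le> u x" for x
      proof (cases "x \<ge> 0")
        case True
        then have "norm (exp (z0 * x) * g x) * exp (\<bar>x\<bar> * \<rho>) = norm (exp ((z0 + of_real \<rho>) * x) * g x)"
          by (simp add: norm_mult algebra_simps exp_add)
        then show ?thesis by (simp add: u_def)
      next
        case False
        then have "norm (exp (z0 * x) * g x) * exp (\<bar>x\<bar> * \<rho>) = norm (exp ((z0 - of_real \<rho>) * x) * g x)"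
          by (simp add: norm_mult algebra_simps exp_diff exp_minus divide_inverse norm_inverse flip: exp_of_real)
        then show ?thesis by (simp add: u_def)
      qed
      have sum_le: "(\<Sum>n<N. norm (f n x)) \<le> u x" for N x
        using sum_le_suminf[OF sums_summable[OF snf[of x]], of "{..<N}"] sums_unique[OF snf[of x]] le_u[of x] by simp
      have fm[measurable]: "f n \<in> borel_measurable borel" for n
        unfolding f_def by measurable
      have fi: "integrable lborel (f n)" for n
      proof (rule Bochner_Integration.integrable_bound[OF u])
        show "AE x in lborel. norm (f n x) \<le> norm (u x)"
        proof (rule AE_I2)
          fix x
          have "norm (f n x) \<le> (\<Sum>k<Suc n. norm (f k x))"
            by (rule member_le_sum) auto
          also have "\<dots> \<le> u x" by (rule sum_le)
          finally show "norm (f n x) \<le> norm (u x)" by simp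
        qed
      qed auto
      have sI: "summable (\<lambda>n. LBINT x. norm (f n x))"
      proof (rule summableI_nonneg_bounded)
        fix N
        have "(\<Sum>n<N. LBINT x. norm (f n x)) = (LBINT x. (\<Sum>n<N. norm (f n x)))"
          using fi by (subst Bochner_Integration.integral_sum) auto
        also have "\<dots> \<le> (LBINT x. u x)"
          using fi u by (intro integral_mono sum_le) auto
        finally show "(\<Sum>n<N. LBINT x. norm (f n x)) \<le> (LBINT x. u x)" .
      qed auto
      have "(\<lambda>n. LBINT x. f n x) sums (LBINT x. (\<Sum>n. f n x))"
        by (rule sums_integral[OF fi _ sI]) (use snf in \<open>auto intro: sums_summable\<close>)
      moreover have "(\<Sum>n. f n x) = exp (w * x) * g x" for x
      proof -
        have "(\<lambda>n. exp (z0 * x) * g x * ((of_real x * (w - z0)) ^ n /\<^sub>R fact n)) sums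
               (exp (z0 * x) * g x * exp (of_real x * (w - z0)))"
          by (intro sums_mult exp_converges)
        moreover have "exp (z0 * x) * g x * ((of_real x * (w - z0)) ^ n /\<^sub>R fact n) = f n x" for n
          by (simp add: f_def power_mult_distrib scaleR_conv_of_real divide_inverse mult_ac)
        ultimately have "(\<lambda>n. f n x) sums (exp (z0 * x) * g x * exp (of_real x * (w - z0)))" by simp
        moreover have "exp (z0 * x) * g x * exp (of_real x * (w - z0)) = exp (w * x) * g x"
          by (simp add: algebra_simps exp_diff)
        ultimately show ?thesis by (simp add: sums_iff)
      qed
      moreover have "(LBINT x. f n x) = (LBINT x. exp (z0 * x) * g x * complex_of_real (x ^ n / fact n)) * (w - z0) ^ n" for n
        unfolding f_def by (rule integral_mult_left_zero)
      ultimately show "(\<lambda>n. (LBINT x. exp (z0 * x) * g x * complex_of_real (x ^ n / fact n)) * (w - z0) ^ n) sums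
          (LBINT x. exp (w * x) * g x)"
        by simp
    qed
    with r show ?thesis using ball_subset_cball by blast
  qed
  then show ?thesis
    by (subst holomorphic_on_def)
      (meson centre_in_ball field_differentiable_at_within holomorphic_on_imp_differentiable_at open_ball)
qed

lemma powr_exp_has_integral_real:
  fixes \<nu> r :: real
  assumes \<nu>: "\<nu> > 0" and r: "r > 0"
  shows "has_bochner_integral lborel (\<lambda>t. indicator {0..} t * t powr (\<nu> - 1) * exp (- r * t)) (Gamma \<nu> * r powr - \<nu>)"
proof -
  have 1: "has_bochner_integral lborel (\<lambda>t. indicator {0..} t * t powr (\<nu> - 1) / exp t) (Gamma \<nu>)"
    using \<nu> Gamma_conv_nn_integral_real[OF \<nu>]
    by (intro has_bochner_integral_nn_integral) (auto simp: Gamma_real_pos less_imp_le)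
  have "has_bochner_integral lborel (\<lambda>t. indicator {0..} (0 + r * t) * (0 + r * t) powr (\<nu> - 1) / exp (0 + r * t)) (Gamma \<nu> /\<^sub>R \<bar>r\<bar>)"
    using r 1 by (subst (asm) lborel_has_bochner_integral_real_affine_iff[of r _ _ 0]) auto
  then have "has_bochner_integral lborel (\<lambda>t. r powr (1 - \<nu>) * (indicator {0..} (0 + r * t) * (0 + r * t) powr (\<nu> - 1) / exp (0 + r * t))) (r powr (1 - \<nu>) * (Gamma \<nu> /\<^sub>R \<bar>r\<bar>))"
    by (rule has_bochner_integral_mult_right)
  moreover have "r powr (1 - \<nu>) * (indicator {0..} (0 + r * t) * (0 + r * t) powr (\<nu> - 1) / exp (0 + r * t)) = indicator {0..} t * t powr (\<nu> - 1) * exp (- r * t)" for t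
    using r by (auto simp: indicator_def powr_mult exp_minus divide_inverse zero_le_mult_iff powr_add[symmetric])
  moreover have "r powr (1 - \<nu>) * (Gamma \<nu> /\<^sub>R \<bar>r\<bar>) = Gamma \<nu> * r powr - \<nu>"
    using r by (simp add: powr_diff powr_minus field_simps)
  ultimately show ?thesis by (simp only:)
qed

lemma powr_exp_integrable:
  fixes \<nu> :: real and p :: complex
  assumes \<nu>: "\<nu> > 0" and p: "Re p > 0"
  shows "integrable lborel (\<lambda>t. exp (- p * of_real t) * complex_of_real (indicator {0..} t * t powr (\<nu> - 1)))"
proof (rule Bochner_Integration.integrable_bound)
  show "integrable lborel (\<lambda>t. indicator {0..} t * t powr (\<nu> - 1) * exp (- Re p * t))"
    using powr_exp_has_integral_real[OF \<nu> p] by (simp add: has_bochner_integral_iff)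
qed (auto simp: norm_mult abs_mult mult_ac)

text \<open>Both sides are holomorphic in the half-plane and agree for real \<open>p\<close> by
  scaling the Gamma integral. The proof uses the variable z = -p to match the sign in
  \<open>laplace_transform_holomorphic\<close>.\<close>

lemma powr_exp_integral:
  fixes \<nu> :: real and p :: complex
  assumes \<nu>: "\<nu> > 0" and p: "Re p > 0"
  shows "(LBINT t. exp (- p * of_real t) * complex_of_real (indicator {0..} t * t powr (\<nu> - 1))) = Gamma \<nu> * p powr (- \<nu>)"
proof -
  define J where "J (z :: complex) = (LBINT t. exp (z * of_real t) * complex_of_real (indicator {0..} t * t powr (\<nu> - 1)))" for z
  define S where "S = {z. Re z < 0}"
  have holJ: "J holomorphic_on S"
    unfolding J_def S_def
  proof (rule laplace_transform_holomorphic)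
    show "open {z. Re z < 0}" by (rule open_halfspace_Re_lt)
    fix z :: complex assume "z \<in> {z. Re z < 0}"
    then show "integrable lborel (\<lambda>t. exp (z * of_real t) * complex_of_real (indicator {0..} t * t powr (\<nu> - 1)))"
      using powr_exp_integrable[OF \<nu>, of "- z"] by simp
  qed simp
  define D where "D (z :: complex) = J z - complex_of_real (Gamma \<nu>) * (- z) powr (- complex_of_real \<nu>)" for z
  have holD: "D holomorphic_on S"
    unfolding D_def by (intro holomorphic_intros holJ) (auto simp: S_def complex_nonpos_Reals_iff)
  have "D (- p) = 0"
  proof (rule analytic_continuation[OF holD, where U="of_real ` {..<0}" and \<xi>="-1"])
    show "open S" unfolding S_def by (rule open_halfspace_Re_lt)
    show "connected S" unfolding S_def by (intro convex_connected convex_halfspace_Re_lt)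
    show "complex_of_real ` {..<0} \<subseteq> S" by (auto simp: S_def)
    show "-1 \<in> S" "- p \<in> S" using p by (auto simp: S_def)
    show "-1 islimpt complex_of_real ` {..<0}"
      unfolding islimpt_approachable
    proof (intro allI impI)
      fix e :: real assume "e > 0"
      define y where "y = complex_of_real (- 1 - e / 2)"
      have y: "y - (- 1) = complex_of_real (- (e / 2))" by (simp add: y_def)
      have "norm (y - (- 1)) = e / 2" unfolding y norm_of_real using \<open>e > 0\<close> by simp
      then have "y \<noteq> - 1" "dist y (- 1) < e" using \<open>e > 0\<close> by (auto simp: dist_norm)
      moreover have "y \<in> complex_of_real ` {..<0}" using \<open>e > 0\<close> by (auto simp: y_def simp del: of_real_diff)
      ultimately show "\<exists>x'\<in>complex_of_real ` {..<0}. x' \<noteq> - 1 \<and> dist x' (- 1) < e" by blast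
    qed
    fix z assume "z \<in> complex_of_real ` {..<0}"
    then obtain x where x: "z = of_real x" "x < 0" by auto
    define r where "r = - x"
    have r: "z = - complex_of_real r" "r > 0" using x by (auto simp: r_def)
    have "exp (z * of_real t) = complex_of_real (exp (- r * t))" for t
      by (simp add: r exp_of_real[symmetric])
    then have "J z = (LBINT t. complex_of_real (indicator {0..} t * t powr (\<nu> - 1) * exp (- r * t)))"
      unfolding J_def by (intro Bochner_Integration.integral_cong) (simp_all add: mult_ac)
    also have "\<dots> = Gamma \<nu> * r powr - \<nu>"
      using powr_exp_has_integral_real[OF \<nu> r(2)] by (simp only: has_bochner_integral_iff integral_complex_of_real)
    finally have "J z = complex_of_real (Gamma \<nu> * r powr - \<nu>)" .
    moreover have "(- z) powr (- complex_of_real \<nu>) = complex_of_real (r powr - \<nu>)"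
      using r powr_of_real[of r "- \<nu>"] by simp
    ultimately show "D z = 0"
      by (simp add: D_def)
  qed
  then show ?thesis by (simp add: D_def J_def)
qed

section \<open>The multiplier of the difference operator\<close>

text \<open>The coefficients are O(n^(- \<alpha> - 1)) by the asymptotics of the binomial
  coefficient. This gives absolute convergence on the closed disc, whose boundary is reached when Re
  \<sigma> = 0.\<close>

lemma summable_norm_gbinomial:
  fixes \<alpha> :: real
  assumes \<alpha>: "\<alpha> > 0"
  shows "summable (\<lambda>n. norm (complex_of_real \<alpha> gchoose n))"
proof (rule summable_comparison_test_bigo)
  show "summable (\<lambda>n. norm (real n powr (- (\<alpha> + 1))))"
    using \<alpha> by (simp add: summable_real_powr_iff)
  have "convergent (\<lambda>n. (complex_of_real \<alpha> gchoose n) / ((-1)^n / exp ((complex_of_real \<alpha> + 1) * of_real (ln (real n)))))"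
    using gbinomial_asymptotic[of "complex_of_real \<alpha>"] by (auto simp: convergent_def)
  then have "Bseq (\<lambda>n. (complex_of_real \<alpha> gchoose n) / ((-1)^n / exp ((complex_of_real \<alpha> + 1) * of_real (ln (real n)))))"
    by (rule convergent_imp_Bseq)
  then obtain K where K: "\<And>n. norm ((complex_of_real \<alpha> gchoose n) / ((-1)^n / exp ((complex_of_real \<alpha> + 1) * of_real (ln (real n))))) \<le> K"
    by (auto simp: Bseq_def)
  show "(\<lambda>n. norm (complex_of_real \<alpha> gchoose n)) \<in> O(\<lambda>n. real n powr (- (\<alpha> + 1)))"
  proof (rule bigoI[of _ K], rule eventually_sequentiallyI[of 1])
    fix n :: nat assume n: "n \<ge> 1"
    have "norm (complex_of_real \<alpha> gchoose n) * exp ((\<alpha> + 1) * ln (real n)) \<le> K"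
      using K[of n] by (simp add: norm_divide norm_mult norm_power)
    moreover have "exp ((\<alpha> + 1) * ln (real n)) = real n powr (\<alpha> + 1)"
      using n by (simp add: powr_def)
    ultimately have "norm (complex_of_real \<alpha> gchoose n) * real n powr (\<alpha> + 1) \<le> K"
      by simp
    then have "norm (complex_of_real \<alpha> gchoose n) \<le> K / real n powr (\<alpha> + 1)"
      using n by (simp add: pos_le_divide_eq)
    also have "\<dots> = K * norm (real n powr (- (\<alpha> + 1)))"
      by (simp only: powr_minus divide_inverse real_norm_def abs_of_nonneg inverse_nonnegative_iff_nonnegative powr_ge_zero)
    finally show "norm (norm (complex_of_real \<alpha> gchoose n)) \<le> K * norm (real n powr (- (\<alpha> + 1)))"
      by simp
  qed
qed

text \<open>Extends the binomial series to the unit circle by a radial limit: the series passes to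
  the limit by Tannery's theorem, the power by continuity.\<close>

lemma one_minus_powr_sums:
  fixes \<alpha> :: real and z :: complex
  assumes \<alpha>: "\<alpha> > 0" and z: "norm z \<le> 1"
  shows "(\<lambda>n. (complex_of_real \<alpha> gchoose n) * (- z) ^ n) sums ((1 - z) powr \<alpha>)"
proof -
  let ?c = "\<lambda>n. complex_of_real \<alpha> gchoose n"
  have bd: "norm (?c n * (- w) ^ n) \<le> norm (?c n)" if "norm w \<le> 1" for n w
    using that by (simp add: norm_mult norm_power mult_left_le power_le_one)
  have sm: "summable (\<lambda>n. ?c n * (- z) ^ n)"
    by (rule summable_comparison_test[OF _ summable_norm_gbinomial[OF \<alpha>]]) (use bd z in auto)
  define r where "r k = real k / real (Suc k)" for k
  have r: "0 \<le> r k" "r k < 1" for k by (auto simp: r_def)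
  have r1: "r \<longlonglongrightarrow> 1" unfolding r_def by (rule LIMSEQ_n_over_Suc_n)
  have "(\<lambda>k. \<Sum>n. ?c n * (- (of_real (r k) * z)) ^ n) \<longlonglongrightarrow> (\<Sum>n. ?c n * (- z) ^ n)"
  proof (rule tannerys_theorem[where M="\<lambda>n. norm (?c n)", THEN conjunct2, THEN conjunct2])
    fix n
    have "(\<lambda>k. ?c n * (- (of_real (r k) * z)) ^ n) \<longlonglongrightarrow> ?c n * (- (of_real 1 * z)) ^ n"
      by (intro tendsto_intros r1)
    then show "(\<lambda>k. ?c n * (- (of_real (r k) * z)) ^ n) \<longlonglongrightarrow> ?c n * (- z) ^ n" by simp
  next
    show "\<forall>\<^sub>F (n, k) in at_top \<times>\<^sub>F sequentially. norm (?c n * (- (of_real (r k) * z)) ^ n) \<le> norm (?c n)"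
    proof (intro always_eventually, clarify)
      fix n k
      have "norm (of_real (r k) * z) \<le> 1"
        using r[of k] z by (simp add: norm_mult mult_le_one)
      then show "norm (?c n * (- (of_real (r k) * z)) ^ n) \<le> norm (?c n)" by (rule bd)
    qed
  qed (use summable_norm_gbinomial[OF \<alpha>] in auto)
  moreover have "(\<Sum>n. ?c n * (- (of_real (r k) * z)) ^ n) = (1 - of_real (r k) * z) powr \<alpha>" for k
  proof -
    have "norm (of_real (r k) * z) < 1"
      using r[of k] mult_left_mono[OF z, of "r k"] by (simp add: norm_mult)
    then have "(\<lambda>n. ?c n * (- (of_real (r k) * z)) ^ n) sums (1 + (- (of_real (r k) * z))) powr of_real \<alpha>"
      by (intro gen_binomial_complex) simp
    then show ?thesis by (simp add: sums_iff)
  qed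
  moreover have "(\<lambda>k. (1 - of_real (r k) * z) powr complex_of_real \<alpha>) \<longlonglongrightarrow> (1 - z) powr \<alpha>"
  proof (cases "z = 1")
    case False
    have "Re z < 1"
    proof (rule ccontr)
      assume "\<not> Re z < 1"
      moreover have "\<bar>Re z\<bar> \<le> norm z" by (rule abs_Re_le_cmod)
      ultimately have "Re z = 1" "norm z = 1" using z by linarith+
      then have "Im z = 0" using cmod_power2[of z] by simp
      with \<open>Re z = 1\<close> False show False by (simp add: complex_eq_iff)
    qed
    then have nn: "1 - z \<notin> \<real>\<^sub>\<le>\<^sub>0" by (simp add: complex_nonpos_Reals_iff)
    have "(\<lambda>k. (1 - of_real (r k) * z)) \<longlonglongrightarrow> 1 - of_real 1 * z"
      by (intro tendsto_intros r1)
    moreover have "isCont (\<lambda>w. w powr complex_of_real \<alpha>) (1 - z)"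
      using has_field_derivative_powr[OF nn] by (rule DERIV_isCont)
    ultimately show ?thesis
      using isCont_tendsto_compose[of "1 - z" "\<lambda>w. w powr complex_of_real \<alpha>"] by simp
  next
    case True
    have "(\<lambda>k. (1 - r k) powr \<alpha>) \<longlonglongrightarrow> (1 - 1) powr \<alpha>"
      using r \<alpha> by (intro tendsto_powr' tendsto_intros r1) (auto intro!: always_eventually less_imp_le)
    then have "(\<lambda>k. complex_of_real ((1 - r k) powr \<alpha>)) \<longlonglongrightarrow> complex_of_real ((1 - 1) powr \<alpha>)"
      by (rule tendsto_of_real)
    moreover have "complex_of_real ((1 - r k) powr \<alpha>) = (1 - of_real (r k) * z) powr \<alpha>" for k
      using r[of k] True powr_of_real[of "1 - r k" \<alpha>] by simp
    ultimately show ?thesis using True by simp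
  qed
  ultimately have "(\<Sum>n. ?c n * (- z) ^ n) = (1 - z) powr \<alpha>"
    using LIMSEQ_unique by simp
  with sm show ?thesis by (simp add: sums_iff)
qed

text \<open>Mean value bound on the disc of radius 1/2 about 1. There |z| lies between 1/2 and 2,
  which gives the factor 2 powr |\<alpha> - 1| for either sign of \<alpha> - 1.\<close>

lemma powr_near_one_bound:
  fixes \<alpha> :: real and w :: complex
  assumes \<alpha>: "\<alpha> > 0" and w: "norm (w - 1) \<le> 1 / 2"
  shows "norm (w powr \<alpha> - 1) \<le> \<alpha> * 2 powr \<bar>\<alpha> - 1\<bar> * norm (w - 1)"
proof -
  have "norm (w powr \<alpha> - 1 powr complex_of_real \<alpha>) \<le> \<alpha> * 2 powr \<bar>\<alpha> - 1\<bar> * norm (w - 1)"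
  proof (rule field_differentiable_bound[where S="cball 1 (1/2)"])
    fix z :: complex assume z: "z \<in> cball 1 (1/2)"
    then have nz: "norm (z - 1) \<le> 1/2" by (simp add: dist_norm norm_minus_commute)
    then have "Re z > 0" using abs_Re_le_cmod[of "z - 1"] by simp
    then have "z \<notin> \<real>\<^sub>\<le>\<^sub>0" by (simp add: complex_nonpos_Reals_iff)
    then show "((\<lambda>z. z powr \<alpha>) has_field_derivative \<alpha> * z powr (\<alpha> - 1)) (at z within cball 1 (1/2))"
      using has_field_derivative_powr[of z "complex_of_real \<alpha>"] by (simp add: has_field_derivative_at_within)
    have n: "1 / 2 \<le> norm z" "norm z \<le> 2"
      using nz norm_triangle_ineq3[of z 1] by auto
    then have "ln (1 / 2) \<le> ln (norm z)" "ln (norm z) \<le> ln 2"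
      by (simp_all only: ln_le_cancel_iff)
    then have "\<bar>ln (norm z)\<bar> \<le> ln 2"
      by (simp add: ln_div)
    then have "(\<alpha> - 1) * ln (norm z) \<le> \<bar>\<alpha> - 1\<bar> * ln 2"
      using abs_ge_self[of "(\<alpha> - 1) * ln (norm z)"] mult_left_mono[of "\<bar>ln (norm z)\<bar>" "ln 2" "\<bar>\<alpha> - 1\<bar>"]
      unfolding abs_mult by linarith
    then have "norm z powr (\<alpha> - 1) \<le> 2 powr \<bar>\<alpha> - 1\<bar>"
      using n by (auto simp: powr_def)
    then show "norm (\<alpha> * z powr (\<alpha> - 1)) \<le> \<alpha> * 2 powr \<bar>\<alpha> - 1\<bar>"
      using \<alpha> norm_powr_real_powr'[of "complex_of_real (\<alpha> - 1)" z] by (simp add: norm_mult)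
  qed (use w in \<open>auto simp: dist_norm norm_minus_commute\<close>)
  then show ?thesis by simp
qed

text \<open>Away from 0 both powers are separately dominated by the right-hand side. Near 0, 1 -
  exp(-z) = z q with q = 1 + O(z), and only the power of q has to be compared with 1.\<close>

lemma powr_one_minus_exp_bound:
  fixes \<alpha> :: real
  assumes \<alpha>: "\<alpha> > 0"
  shows "\<exists>C. \<forall>z. Re z \<ge> 0 \<longrightarrow> norm ((1 - exp (- z)) powr complex_of_real \<alpha> - z powr \<alpha>) \<le> C * norm z powr (\<alpha> + 1)"
proof -
  have np: "norm (w powr complex_of_real \<alpha>) = norm w powr \<alpha>" for w
    by (simp add: norm_powr_real_powr')
  \<comment> \<open>The split is at |z| = 1/4, so that |q - 1| \<le> 2 |z| gives at most 1/2 below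
    it. Above it, 1 \<le> (4 |z|) powr (\<alpha> + 1) yields the first summand and |z| powr \<alpha>
    \<le> 4 |z| powr (\<alpha> + 1) the second.\<close>
  define C1 where "C1 = 2 powr \<alpha> * 4 powr (\<alpha> + 1) + 4"
  define C2 where "C2 = \<alpha> * 2 powr \<bar>\<alpha> - 1\<bar> * 2"
  have C: "C1 \<ge> 0" "C2 \<ge> 0" using \<alpha> by (auto simp: C1_def C2_def)
  have "norm ((1 - exp (- z)) powr complex_of_real \<alpha> - z powr \<alpha>) \<le> max C1 C2 * norm z powr (\<alpha> + 1)" if z: "Re z \<ge> 0" for z
  proof (cases "norm z \<ge> 1 / 4")
    case True
    have "norm (1 - exp (- z)) \<le> 2"
    proof -
      have "norm (exp (- z)) \<le> 1" using z by (simp add: norm_exp_eq_Re)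
      then show ?thesis using norm_triangle_ineq4[of 1 "exp (- z)"] by (simp only: norm_one)
    qed
    then have "norm (1 - exp (- z)) powr \<alpha> \<le> 2 powr \<alpha>"
      using \<alpha> by (intro powr_mono2) auto
    also have "\<dots> \<le> 2 powr \<alpha> * (4 powr (\<alpha> + 1) * norm z powr (\<alpha> + 1))"
    proof -
      have "1 \<le> (4 * norm z) powr (\<alpha> + 1)" using True \<alpha> by (intro ge_one_powr_ge_zero) auto
      also have "\<dots> = 4 powr (\<alpha> + 1) * norm z powr (\<alpha> + 1)" by (simp add: powr_mult)
      finally show ?thesis by simp
    qed
    finally have 1: "norm (1 - exp (- z)) powr \<alpha> \<le> 2 powr \<alpha> * (4 powr (\<alpha> + 1) * norm z powr (\<alpha> + 1))" .
    have 2: "norm z powr \<alpha> \<le> 4 * norm z powr (\<alpha> + 1)"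
      using True mult_left_mono[of 1 "4 * norm z" "norm z powr \<alpha>"] by (simp add: powr_add mult_ac)
    have "norm ((1 - exp (- z)) powr complex_of_real \<alpha> - z powr \<alpha>) \<le> norm (1 - exp (- z)) powr \<alpha> + norm z powr \<alpha>"
      using norm_triangle_ineq4[of "(1 - exp (- z)) powr complex_of_real \<alpha>" "z powr \<alpha>"] by (simp add: np)
    also have "\<dots> \<le> C1 * norm z powr (\<alpha> + 1)"
      using 1 2 by (simp add: C1_def algebra_simps)
    also have "\<dots> \<le> max C1 C2 * norm z powr (\<alpha> + 1)"
      by (intro mult_right_mono) auto
    finally show ?thesis .
  next
    case False
    show ?thesis
    proof (cases "z = 0")
      case True
      then show ?thesis by simp
    next
      case z0: False
      define q where "q = (1 - exp (- z)) / z"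
      have zq: "1 - exp (- z) = z * q" using z0 by (simp add: q_def)
      have "norm (exp (- z) - (\<Sum>k\<le>1. (- z) ^ k / fact k)) \<le> exp \<bar>Re (- z)\<bar> * norm (- z) ^ Suc 1 / fact 1"
        by (rule Taylor_exp)
      then have "norm (exp (- z) - (1 - z)) \<le> exp \<bar>Re z\<bar> * norm z ^ 2"
        by (simp add: power2_eq_square)
      also have "\<dots> \<le> 2 * norm z ^ 2"
      proof -
        have "\<bar>Re z\<bar> \<le> 1/2" using False abs_Re_le_cmod[of z] by linarith
        then have "exp \<bar>Re z\<bar> \<le> 2" using exp_bound_half[of "\<bar>Re z\<bar>"] by simp
        then show ?thesis by (intro mult_right_mono) auto
      qed
      also have "exp (- z) - (1 - z) = z * (1 - q)"
        using zq by (simp add: algebra_simps)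
      finally have "norm (z * (1 - q)) \<le> 2 * norm z ^ 2" .
      then have q1: "norm (q - 1) \<le> 2 * norm z"
        using z0 by (simp add: norm_mult power2_eq_square norm_minus_commute)
      then have q2: "norm (q - 1) \<le> 1 / 2" using False by simp
      then have Req: "Re q > 0" using abs_Re_le_cmod[of "q - 1"] by simp
      then have "q \<noteq> 0" by auto
      \<comment> \<open>The two arguments add up to less than pi in modulus, so the principal power
        is multiplicative on z and q. This is where Re z \<ge> 0 enters.\<close>
      have "\<bar>Im (Ln z)\<bar> \<le> pi / 2" using Re_Ln_pos_le[OF z0] z by simp
      moreover have "\<bar>Im (Ln q)\<bar> < pi / 2" using Re_Ln_pos_lt_imp[OF Req] .
      ultimately have "Ln (z * q) = Ln z + Ln q"
        using z0 \<open>q \<noteq> 0\<close> by (intro Ln_times_simple) auto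
      then have "(z * q) powr complex_of_real \<alpha> = z powr \<alpha> * q powr \<alpha>"
        using z0 \<open>q \<noteq> 0\<close> by (simp add: powr_def algebra_simps exp_add)
      then have "norm ((1 - exp (- z)) powr complex_of_real \<alpha> - z powr \<alpha>) = norm z powr \<alpha> * norm (q powr \<alpha> - 1)"
        unfolding zq np[symmetric] norm_mult[symmetric] by (simp add: algebra_simps)
      also have "\<dots> \<le> norm z powr \<alpha> * (\<alpha> * 2 powr \<bar>\<alpha> - 1\<bar> * (2 * norm z))"
        using powr_near_one_bound[OF \<alpha> q2] q1 \<alpha>
        by (intro mult_left_mono) (auto intro: order_trans mult_left_mono)
      also have "\<dots> = C2 * norm z powr (\<alpha> + 1)"
        using z0 by (simp add: C2_def powr_add)
      also have "\<dots> \<le> max C1 C2 * norm z powr (\<alpha> + 1)"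
        by (intro mult_right_mono) auto
      finally show ?thesis .
    qed
  qed
  then show ?thesis by blast
qed

section \<open>The setting\<close>

lemma lborel_integral_minus:
  fixes g :: "real \<Rightarrow> 'a :: {banach, second_countable_topology}"
  shows "(LBINT t. g (x - t)) = (LBINT t. g t)"
  using lborel_integral_real_affine[of "-1" g x] by simp

lemma lborel_integrable_minus_iff:
  fixes g :: "real \<Rightarrow> 'a :: {banach, second_countable_topology}"
  shows "integrable lborel (\<lambda>t. g (x - t)) \<longleftrightarrow> integrable lborel g"
  using lborel_integrable_real_affine_iff[of "-1" g x] by simp

lemma lborel_integrable_shift_iff:
  fixes g :: "real \<Rightarrow> 'a :: {banach, second_countable_topology}"
  shows "integrable lborel (\<lambda>t. g (t - x)) \<longleftrightarrow> integrable lborel g"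
  using lborel_integrable_real_affine_iff[of 1 g "-x"] by simp

lemma lborel_integral_shift:
  fixes g :: "real \<Rightarrow> 'a :: {banach, second_countable_topology}"
  shows "(LBINT t. g (t - x)) = (LBINT t. g t)"
  using lborel_integral_real_affine[of 1 g "-x"] by simp

text \<open>The factor 1 / Gamma \<nu> stays outside. At t = 0 the value is 0 even for \<nu> = 1,
  since \<open>0 powr 0 = 0\<close>; comparisons with indicators therefore hold off one point
  only.\<close>

definition frac_kernel :: "real \<Rightarrow> real \<Rightarrow> real" where
  "frac_kernel \<nu> t = indicator {0..} t * t powr (\<nu> - 1)"

lemma frac_kernel_measurable [measurable]: "frac_kernel \<nu> \<in> borel_measurable borel"
  unfolding frac_kernel_def by measurable

lemma frac_kernel_nonneg [simp]: "0 \<le> frac_kernel \<nu> t"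
  by (simp add: frac_kernel_def)

lemma frac_kernel_neg: "t < 0 \<Longrightarrow> frac_kernel \<nu> t = 0"
  by (simp add: frac_kernel_def)

lemma frac_kernel_le:
  assumes "\<nu> \<le> 1" "0 < d" "d \<le> t"
  shows "frac_kernel \<nu> t \<le> d powr (\<nu> - 1)"
  using assms powr_mono2'[of "\<nu> - 1" d t] by (auto simp: frac_kernel_def)

lemma frac_kernel_has_integral:
  assumes "0 < \<nu>" "0 \<le> d"
  shows "has_bochner_integral lborel (\<lambda>t. indicator {..d} t * frac_kernel \<nu> t) (d powr \<nu> / \<nu>)"
proof (rule has_bochner_integral_nn_integral)
  have "((\<lambda>x. x powr (\<nu> - 1)) has_integral (d powr (\<nu> - 1 + 1) / (\<nu> - 1 + 1))) {0..d}"
    using assms by (intro has_integral_powr_from_0) auto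
  then have "(\<integral>\<^sup>+ x. ennreal (indicator {0..d} x * x powr (\<nu> - 1)) \<partial>lborel) = ennreal (d powr \<nu> / \<nu>)"
    using nn_integral_has_integral_lebesgue[of "{0..d}" "\<lambda>x. x powr (\<nu> - 1)"] by simp
  moreover have "indicator {..d} t * frac_kernel \<nu> t = indicator {0..d} t * t powr (\<nu> - 1)" for t
    by (auto simp: frac_kernel_def indicator_def)
  ultimately show "(\<integral>\<^sup>+ t. ennreal (indicator {..d} t * frac_kernel \<nu> t) \<partial>lborel) = ennreal (d powr \<nu> / \<nu>)"
    by simp
qed (use assms in auto)

text \<open>The setting after passing to continuous representatives: \<open>G k\<close> is the k-th
  D_s-derivative of the fractional integral, so \<open>G m\<close> has order \<alpha> and
  \<open>G (Suc m)\<close> order \<alpha> + 1. Spectral densities \<open>a\<close> and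
  \<open>b\<close> are available only for \<open>f\<close> and the top derivative.\<close>

locale subst_core =
  fixes \<alpha> \<nu> :: real and \<sigma> :: complex and f :: "real \<Rightarrow> complex" and G :: "nat \<Rightarrow> real \<Rightarrow> complex"
    and m :: nat and a b :: "real \<Rightarrow> complex"
  assumes \<alpha>: "\<alpha> > 0" and \<nu>_eq: "\<nu> = real m - \<alpha>" and \<nu>: "0 < \<nu>" "\<nu> \<le> 1"
    and a: "integrable lborel a" and f: "f = fourier_synth a" and fi: "integrable lborel f"
    and b: "integrable lborel b" and phi: "G (Suc m) = fourier_synth b" and phi_int: "integrable lborel (G (Suc m))"
    and kint: "\<And>x. set_integrable lborel {..x} (subst_kernel \<sigma> \<nu> f x)"
    and G0: "\<And>x. G 0 x = complex_of_real (1 / Gamma \<nu>) * (LBINT \<tau>:{..x}. subst_kernel \<sigma> \<nu> f x \<tau>)"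
    and Gd: "\<And>k x. k \<le> m \<Longrightarrow> (G k has_vector_derivative (G (Suc k) x - \<sigma> * G k x)) (at x)"
begin

text \<open>Multiplication by exp(\<sigma> x) conjugates D_s to the plain derivative
  (\<open>U_deriv\<close>) and the damped integral to the Weyl integral (\<open>U0\<close>).\<close>

definition F :: "real \<Rightarrow> complex" where "F x = exp (\<sigma> * x) * f x"
definition U :: "nat \<Rightarrow> real \<Rightarrow> complex" where "U k x = exp (\<sigma> * x) * G k x"

lemma f_cont: "continuous_on UNIV f"
  unfolding f by (rule continuous_fourier_synth[OF a])

lemma f_meas [measurable]: "f \<in> borel_measurable borel"
  using f_cont by (rule borel_measurable_continuous_onI)

lemma phi_cont: "continuous_on UNIV (G (Suc m))"
  unfolding phi by (rule continuous_fourier_synth[OF b])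

lemma phi_meas [measurable]: "G (Suc m) \<in> borel_measurable borel"
  using phi_cont by (rule borel_measurable_continuous_onI)

lemma F_meas [measurable]: "F \<in> borel_measurable borel"
  unfolding F_def by measurable

definition Mf :: real where "Mf = (LBINT w. norm (a w))"
definition Mphi :: real where "Mphi = (LBINT w. norm (b w))"

lemma f_bound: "norm (f x) \<le> Mf"
  unfolding f Mf_def by (rule fourier_synth_bound[OF a])

lemma phi_bound: "norm (G (Suc m) x) \<le> Mphi"
  unfolding phi Mphi_def by (rule fourier_synth_bound[OF b])

lemma Mf_nonneg: "0 \<le> Mf"
  using order_trans[OF norm_ge_zero f_bound] .

lemma norm_F: "norm (F x) = exp (Re \<sigma> * x) * norm (f x)"
  by (simp add: F_def norm_mult)

lemma U_deriv:
  assumes "k \<le> m"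
  shows "(U k has_vector_derivative U (Suc k) x) (at x)"
proof -
  have "((\<lambda>x. exp (\<sigma> * of_real x)) has_vector_derivative exp (\<sigma> * of_real x) * \<sigma>) (at x)"
    by (auto intro!: derivative_eq_intros has_vector_derivative_real_field)
  from has_vector_derivative_mult[OF this Gd[OF assms, of x]]
  show ?thesis
    unfolding U_def by (simp add: algebra_simps)
qed

lemma kernel_eq:
  "indicator {..x} \<tau> *\<^sub>R subst_kernel \<sigma> \<nu> f x \<tau> = exp (- \<sigma> * x) * (complex_of_real (frac_kernel \<nu> (x - \<tau>)) * F \<tau>)"
proof -
  have "exp (- \<sigma> * complex_of_real (x - \<tau>)) = exp (- \<sigma> * x) * exp (\<sigma> * \<tau>)"
    by (simp add: algebra_simps flip: exp_add)
  then show ?thesis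
    by (simp add: subst_kernel_def frac_kernel_def F_def indicator_def scaleR_conv_of_real)
qed

lemma frac_F_integrable: "integrable lborel (\<lambda>\<tau>. complex_of_real (frac_kernel \<nu> (x - \<tau>)) * F \<tau>)"
  using integrable_mult_right[OF kint[of x, unfolded set_integrable_def kernel_eq], of "exp (\<sigma> * x)"]
  by (simp add: exp_minus flip: mult.assoc)

lemma norm_frac_F_integrable: "integrable lborel (\<lambda>\<tau>. frac_kernel \<nu> (x - \<tau>) * norm (F \<tau>))"
  using integrable_norm[OF frac_F_integrable[of x]] by (simp add: norm_mult)

lemma U0: "U 0 x = complex_of_real (1 / Gamma \<nu>) * (LBINT \<tau>. complex_of_real (frac_kernel \<nu> (x - \<tau>)) * F \<tau>)"
proof -
  have "U 0 x = exp (\<sigma> * x) * (complex_of_real (1 / Gamma \<nu>) * (exp (- \<sigma> * x) * (LBINT \<tau>. complex_of_real (frac_kernel \<nu> (x - \<tau>)) * F \<tau>)))"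
    unfolding U_def G0 set_lebesgue_integral_def kernel_eq by (simp only: integral_mult_right_zero)
  then show ?thesis by (simp add: exp_minus)
qed

lemma Gamma_pos: "Gamma \<nu> > 0"
  using \<nu> by (simp add: Gamma_real_pos)

lemma Gamma_nonzero: "Gamma \<nu> \<noteq> 0"
  using Gamma_pos by linarith

text \<open>Near \<tau> = x the kernel is singular but integrable, so a supremum of F suffices
  there. The remainder, at distance at least d, is kept as an integral because its estimate differs
  at the two ends of the line.\<close>

lemma U0_bound:
  assumes d: "d > 0" and B: "\<And>\<tau>. x - d \<le> \<tau> \<Longrightarrow> \<tau> \<le> x \<Longrightarrow> norm (F \<tau>) \<le> B"
  shows "norm (U 0 x) \<le> (B * (d powr \<nu> / \<nu>) + (LBINT \<tau>. indicator {..x - d} \<tau> * (frac_kernel \<nu> (x - \<tau>) * norm (F \<tau>)))) / Gamma \<nu>"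
proof -
  let ?k = "\<lambda>\<tau>. frac_kernel \<nu> (x - \<tau>)"
  let ?I = "\<lambda>\<tau>. indicator {..x - d} \<tau> * (?k \<tau> * norm (F \<tau>))"
  have 1: "has_bochner_integral lborel (\<lambda>\<tau>. indicator {..d} (x - \<tau>) * ?k \<tau>) (d powr \<nu> / \<nu>)"
    using frac_kernel_has_integral[of \<nu> d] d \<nu>
    by (simp add: has_bochner_integral_iff lborel_integrable_minus_iff[of "\<lambda>t. indicator {..d} t * frac_kernel \<nu> t"]
      lborel_integral_minus[of "\<lambda>t. indicator {..d} t * frac_kernel \<nu> t"])
  have 2: "integrable lborel (\<lambda>\<tau>. ?I \<tau>)"
    using integrable_mult_indicator[OF _ norm_frac_F_integrable[of x], of "{..x - d}"] by simp
  let ?g = "\<lambda>\<tau>. B * (indicator {..d} (x - \<tau>) * ?k \<tau>) + ?I \<tau>"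
  have "norm (LBINT \<tau>. complex_of_real (?k \<tau>) * F \<tau>) \<le> (LBINT \<tau>. ?g \<tau>)"
  proof (rule norm_integral_le)
    show "integrable lborel ?g"
      using 1 2 by (intro Bochner_Integration.integrable_add integrable_mult_right) (auto simp: has_bochner_integral_iff)
    have B0: "B \<ge> 0" using B[of x] d order_trans[OF norm_ge_zero] by auto
    show "AE \<tau> in lborel. norm (complex_of_real (?k \<tau>) * F \<tau>) \<le> ?g \<tau>"
    proof (rule AE_I2)
      fix \<tau>
      consider "\<tau> \<le> x - d" | "x - d < \<tau>" "\<tau> \<le> x" | "x < \<tau>" by linarith
      then show "norm (complex_of_real (?k \<tau>) * F \<tau>) \<le> ?g \<tau>"
      proof cases
        case 1
        then show ?thesis using B0 by (simp add: norm_mult)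
      next
        case 2
        then show ?thesis using mult_left_mono[OF B[of \<tau>], of "?k \<tau>"] by (simp add: norm_mult mult.commute)
      next
        case 3
        then show ?thesis using d by (simp add: frac_kernel_neg)
      qed
    qed
  qed
  also have "\<dots> = B * (d powr \<nu> / \<nu>) + (LBINT \<tau>. ?I \<tau>)"
    using 1 2 by (simp add: has_bochner_integral_iff)
  finally show ?thesis
    unfolding U0 using Gamma_pos by (simp add: norm_mult norm_divide divide_right_mono)
qed

end

section \<open>Nonnegative real part of the damping\<close>

lemma tendsto_integral_atMost_at_bot:
  fixes g :: "real \<Rightarrow> 'a :: {banach, second_countable_topology}"
  assumes g[measurable]: "g \<in> borel_measurable borel" and "set_integrable lborel {..c} g"
  shows "((\<lambda>x. LBINT t:{..x}. g t) \<longlongrightarrow> 0) at_bot"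
proof -
  have "((\<lambda>y. LBINT t:{..-y}. g t) \<longlongrightarrow> (LINT (t::real)|lborel. 0)) at_top"
    unfolding set_lebesgue_integral_def
  proof (rule integral_dominated_convergence_at_top[where w="\<lambda>t. norm (indicator {..c} t *\<^sub>R g t)"])
    show "integrable lborel (\<lambda>t. norm (indicator {..c} t *\<^sub>R g t))"
      using assms(2) unfolding set_integrable_def by (rule integrable_norm)
    have le: "norm (indicator {..- y} t *\<^sub>R g t) \<le> norm (indicator {..c} t *\<^sub>R g t)" if "y \<ge> - c" for y t
      using that by (auto simp: indicator_def)
    show "\<forall>\<^sub>F y in at_top. AE t in lborel. norm (indicator {..- y} t *\<^sub>R g t) \<le> norm (indicator {..c} t *\<^sub>R g t)"
      using eventually_ge_at_top[of "- c"] by eventually_elim (use le in auto)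
    show "AE t in lborel. ((\<lambda>y. indicator {..- y} t *\<^sub>R g t) \<longlongrightarrow> 0) at_top"
    proof (rule AE_I2)
      fix t
      have "\<forall>\<^sub>F y in at_top. indicator {..- y} t *\<^sub>R g t = 0"
        using eventually_gt_at_top[of "- t"] by eventually_elim auto
      then show "((\<lambda>y. indicator {..- y} t *\<^sub>R g t) \<longlongrightarrow> 0) at_top" by (rule tendsto_eventually)
    qed
  qed auto
  then show ?thesis
    by (simp add: filterlim_at_bot_mirror)
qed

lemma has_vector_derivative_integral_atMost:
  fixes g :: "real \<Rightarrow> complex"
  assumes cont: "continuous_on UNIV g" and int: "\<And>x. set_integrable lborel {..x} g"
  shows "((\<lambda>x. LBINT t:{..x}. g t) has_vector_derivative g x) (at x)"
proof -
  define T where "T x = (LBINT t:{..x}. g t)" for x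
  have T: "T y = T z + integral {z..y} g" if "z \<le> y" for z y
  proof -
    have "T y = T z + (LBINT t:{z<..y}. g t)"
      unfolding T_def using that
      by (subst set_integral_Un[symmetric]) (auto intro!: set_integrable_subset[OF int[of y]] simp: ivl_disj_un)
    also have "(LBINT t:{z<..y}. g t) = (LBINT t:{z..y}. g t)"
    proof (rule set_integral_cong_set)
      have "g \<in> borel_measurable borel" by (intro borel_measurable_continuous_onI cont)
      then show "set_borel_measurable lborel {z<..y} g" "set_borel_measurable lborel {z..y} g"
        unfolding set_borel_measurable_def by measurable
      show "AE t in lborel. (t \<in> {z..y}) = (t \<in> {z<..y})"
        using AE_lborel_singleton[of z] by eventually_elim (use that in auto)
    qed
    also have "\<dots> = integral {z..y} g"
      by (rule set_borel_integral_eq_integral(2)) (auto intro!: set_integrable_subset[OF int[of y]])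
    finally show ?thesis .
  qed
  have "((\<lambda>y. integral {x - 1..y} g) has_vector_derivative g x) (at x within {x - 1..x + 1})"
    using cont by (intro integral_has_vector_derivative continuous_on_subset[OF cont]) auto
  then have "((\<lambda>y. integral {x - 1..y} g) has_vector_derivative g x) (at x)"
    by (simp add: at_within_Icc_at)
  then have "((\<lambda>y. T (x - 1) + integral {x - 1..y} g) has_vector_derivative g x) (at x)"
    by (auto intro!: derivative_eq_intros)
  then have "(T has_vector_derivative g x) (at x)"
  proof (rule has_vector_derivative_transform_within_open[where S="{x - 1<..<x + 1}"])
    fix y assume "y \<in> {x - 1<..<x + 1}"
    then show "T (x - 1) + integral {x - 1..y} g = T y"
      using T[of "x - 1" y] by simp
  qed auto
  then show ?thesis by (simp add: T_def[abs_def])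
qed

context subst_core
begin

text \<open>For x \<le> 0 the weight is at most 1, so |F| \<le> |f|. The near part is small by the
  choice of \<open>d\<close>, and the far part is d powr (\<nu> - 1) times a tail of the integral of
  |f|.\<close>

lemma U0_at_bot:
  assumes s: "Re \<sigma> \<ge> 0"
  shows "(U 0 \<longlongrightarrow> 0) at_bot"
proof (rule tendstoI)
  fix e :: real assume e: "e > 0"
  define T where "T x = (LBINT \<tau>:{..x}. norm (f \<tau>))" for x
  have fs: "set_integrable lborel {..x} (\<lambda>\<tau>. norm (f \<tau>))" for x
    using fi unfolding set_integrable_def by (intro integrable_mult_indicator) auto
  \<comment> \<open>The prescribed value of d powr \<nu>, solved from the demand that the near part
    stay below e/2; \<open>Mf + 1\<close> keeps the denominator positive when \<open>Mf\<close> is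
    0.\<close>
  define y where "y = e * \<nu> * Gamma \<nu> / (2 * (Mf + 1))"
  have y: "y > 0" using e \<nu> Gamma_pos Mf_nonneg by (simp add: y_def)
  define d where "d = y powr (1 / \<nu>)"
  have d: "d > 0" "d powr \<nu> = y" using y \<nu> by (auto simp: d_def powr_powr)
  have y2: "Mf * (y / \<nu>) / Gamma \<nu> < e / 2"
  proof -
    have "Mf * (y / \<nu>) / Gamma \<nu> = (e / 2) * (Mf / (Mf + 1))"
      using \<nu> Gamma_nonzero by (simp add: y_def)
    also have "\<dots> < (e / 2) * 1"
      using e Mf_nonneg by (intro mult_strict_left_mono) auto
    finally show ?thesis by simp
  qed
  have "((\<lambda>x. d powr (\<nu> - 1) * T x / Gamma \<nu>) \<longlongrightarrow> d powr (\<nu> - 1) * 0 / Gamma \<nu>) at_bot"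
    unfolding T_def using Gamma_pos by (intro tendsto_intros tendsto_integral_atMost_at_bot[OF _ fs]) auto
  then have "\<forall>\<^sub>F x in at_bot. dist (d powr (\<nu> - 1) * T x / Gamma \<nu>) (d powr (\<nu> - 1) * 0 / Gamma \<nu>) < e / 2"
    using e by (intro tendstoD) auto
  then show "\<forall>\<^sub>F x in at_bot. dist (U 0 x) 0 < e"
    using eventually_le_at_bot[of 0]
  proof eventually_elim
    case (elim x)
    have F_le: "norm (F \<tau>) \<le> norm (f \<tau>)" if "\<tau> \<le> x" for \<tau>
    proof -
      have "exp (Re \<sigma> * \<tau>) \<le> 1" using that elim s by (simp add: mult_nonneg_nonpos)
      from mult_right_mono[OF this norm_ge_zero[of "f \<tau>"]] show ?thesis by (simp add: norm_F)
    qed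
    have "norm (U 0 x) \<le> (Mf * (d powr \<nu> / \<nu>) + (LBINT \<tau>. indicator {..x - d} \<tau> * (frac_kernel \<nu> (x - \<tau>) * norm (F \<tau>)))) / Gamma \<nu>"
      using F_le f_bound by (intro U0_bound d) (auto intro: order_trans)
    also have "(LBINT \<tau>. indicator {..x - d} \<tau> * (frac_kernel \<nu> (x - \<tau>) * norm (F \<tau>))) \<le> (LBINT \<tau>. d powr (\<nu> - 1) * (indicator {..x} \<tau> *\<^sub>R norm (f \<tau>)))"
    proof (rule integral_mono)
      show "integrable lborel (\<lambda>\<tau>. indicator {..x - d} \<tau> * (frac_kernel \<nu> (x - \<tau>) * norm (F \<tau>)))"
        using integrable_mult_indicator[OF _ norm_frac_F_integrable[of x], of "{..x - d}"] by simp
      show "integrable lborel (\<lambda>\<tau>. d powr (\<nu> - 1) * (indicator {..x} \<tau> *\<^sub>R norm (f \<tau>)))"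
        using fs[of x] unfolding set_integrable_def by (rule integrable_mult_right)
      fix \<tau>
      show "indicator {..x - d} \<tau> * (frac_kernel \<nu> (x - \<tau>) * norm (F \<tau>)) \<le> d powr (\<nu> - 1) * (indicator {..x} \<tau> *\<^sub>R norm (f \<tau>))"
        using d F_le[of \<tau>] frac_kernel_le[of \<nu> d "x - \<tau>"] \<nu>
        by (auto simp: indicator_def intro!: mult_mono)
    qed
    also have "\<dots> = d powr (\<nu> - 1) * T x"
      unfolding T_def set_lebesgue_integral_def by simp
    finally have "norm (U 0 x) \<le> (Mf * (d powr \<nu> / \<nu>) + d powr (\<nu> - 1) * T x) / Gamma \<nu>"
      using Gamma_pos by (simp add: divide_right_mono)
    also have "\<dots> = Mf * (y / \<nu>) / Gamma \<nu> + d powr (\<nu> - 1) * T x / Gamma \<nu>"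
      by (simp add: d add_divide_distrib)
    also have "\<dots> < e / 2 + e / 2"
    proof (rule add_strict_mono[OF y2])
      have "\<bar>d powr (\<nu> - 1) * T x / Gamma \<nu>\<bar> < e / 2"
        using elim(1) by (simp only: dist_real_def mult_zero_right div_0 diff_zero)
      then show "d powr (\<nu> - 1) * T x / Gamma \<nu> < e / 2"
        by linarith
    qed
    finally show ?case by simp
  qed
qed

lemma Phi_set_integrable:
  assumes s: "Re \<sigma> \<ge> 0"
  shows "set_integrable lborel {..x} (U (Suc m))"
  unfolding set_integrable_def
proof (rule Bochner_Integration.integrable_bound)
  show "integrable lborel (\<lambda>t. exp (Re \<sigma> * x) * norm (G (Suc m) t))"
    using phi_int by simp
  show "(\<lambda>t. indicator {..x} t *\<^sub>R U (Suc m) t) \<in> borel_measurable lborel"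
    unfolding U_def by measurable
  show "AE t in lborel. norm (indicator {..x} t *\<^sub>R U (Suc m) t) \<le> norm (exp (Re \<sigma> * x) * norm (G (Suc m) t))"
    using s by (auto simp: indicator_def U_def norm_mult intro!: mult_right_mono mult_left_mono)
qed

lemma Phi_cont: "continuous_on UNIV (U (Suc m))"
  unfolding U_def[abs_def] by (intro continuous_intros phi_cont)

text \<open>The two sides differ by a constant, which is the limit of \<open>U m\<close> at -
  infinity; since \<open>U 0\<close> tends to 0 there, \<open>iterated_derivative_limit_zero\<close>
  makes it 0. Thus the derivative of order \<alpha> is recovered from the one of order \<alpha> +
  1.\<close>

lemma Um_eq:
  assumes s: "Re \<sigma> \<ge> 0"
  shows "U m x = (LBINT t:{..x}. U (Suc m) t)"
proof -
  define T where "T x = (LBINT t:{..x}. U (Suc m) t)" for x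
  have "((\<lambda>x. U m x - T x) has_vector_derivative 0) (at x within UNIV)" for x
    using has_vector_derivative_diff[OF U_deriv[of m x] has_vector_derivative_integral_atMost[OF Phi_cont Phi_set_integrable[OF s], of x]]
    by (simp add: T_def[abs_def])
  then obtain c where "\<And>x. U m x - T x = c"
    using has_vector_derivative_zero_constant[of UNIV "\<lambda>x. U m x - T x"] by auto
  then have c: "U m x = c + T x" for x by (simp add: diff_eq_eq)
  have "(T \<longlongrightarrow> 0) at_bot"
    unfolding T_def using Phi_set_integrable[OF s]
    by (intro tendsto_integral_atMost_at_bot borel_measurable_continuous_onI Phi_cont)
  then have "((\<lambda>x. c + T x) \<longlongrightarrow> c + 0) at_bot"
    by (intro tendsto_intros)
  then have "(U m \<longlongrightarrow> c) at_bot"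
    by (simp flip: c)
  then have "c = 0"
    using iterated_derivative_limit_zero[of at_bot m U c] U_deriv U0_at_bot[OF s] by auto
  then show ?thesis using c by (simp add: T_def)
qed

lemma Gm_eq:
  assumes s: "Re \<sigma> \<ge> 0"
  shows "G m x = (LBINT t. exp (- \<sigma> * of_real t) * complex_of_real (frac_kernel 1 t) * G (Suc m) (x - t))"
proof -
  let ?l = "\<lambda>t. exp (- \<sigma> * x) * (indicator {..x} (x - t) *\<^sub>R U (Suc m) (x - t))"
  let ?k = "\<lambda>t. exp (- \<sigma> * of_real t) * complex_of_real (frac_kernel 1 t) * G (Suc m) (x - t)"
  have "G m x = exp (- \<sigma> * x) * U m x"
    by (simp add: U_def exp_minus)
  also have "U m x = (LBINT t. indicator {..x} (x - t) *\<^sub>R U (Suc m) (x - t))"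
    unfolding Um_eq[OF s] set_lebesgue_integral_def
    by (rule lborel_integral_minus[symmetric, of "\<lambda>t. indicator {..x} t *\<^sub>R U (Suc m) t"])
  also have "exp (- \<sigma> * x) * \<dots> = (LBINT t. ?l t)"
    by (rule integral_mult_right_zero[symmetric])
  also have "\<dots> = (LBINT t. ?k t)"
  proof (rule integral_cong_AE)
    have [measurable]: "U (Suc m) \<in> borel_measurable borel" by (intro borel_measurable_continuous_onI Phi_cont)
    show "(\<lambda>t. ?l t) \<in> borel_measurable lborel"
      by measurable
    show "(\<lambda>t. ?k t) \<in> borel_measurable lborel"
      by measurable
    have *: "exp (- \<sigma> * complex_of_real x) * exp (\<sigma> * complex_of_real (x - t)) = exp (- \<sigma> * complex_of_real t)" for t
      by (simp add: algebra_simps flip: exp_add)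
    \<comment> \<open>At t = 0 the two sides may differ: the indicator is 1, but
      \<open>frac_kernel 1 0 = 0\<close>.\<close>
    have **: "?l t = ?k t"
      if "t \<noteq> 0" for t
      using *[of t] that by (auto simp: U_def frac_kernel_def indicator_def mult.assoc[symmetric] simp del: of_real_diff)
    show "AE t in lborel. ?l t = ?k t"
      using AE_lborel_singleton[of "0::real"] by eventually_elim (rule **)
  qed
  finally show ?thesis .
qed

text \<open>The extra damping \<open>e\<close> makes the kernel integrable also for \<open>Re \<sigma> = 0\<close>, so that Fubini applies; \<open>e\<close> tends to \<open>0\<close> in \<open>Gm_eq_synth\<close> below.\<close>

lemma Gm_regularised:
  assumes s: "Re \<sigma> \<ge> 0" and e: "e > 0"
  shows "(LBINT t. exp (- (\<sigma> + of_real e) * of_real t) * complex_of_real (frac_kernel 1 t) * G (Suc m) (x - t))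
     = (LBINT w. b w * iexp (- (w * x)) / (\<sigma> - \<i> * w + e))"
proof -
  let ?k = "\<lambda>t. exp (- (\<sigma> + of_real e) * of_real t) * complex_of_real (frac_kernel 1 t)"
  have pos: "Re (\<sigma> + of_real e) > 0" using s e by simp
  have ki: "integrable lborel ?k"
    using powr_exp_integrable[OF zero_less_one pos] by (simp add: frac_kernel_def)
  have inner: "(LBINT t. ?k t * iexp (- (w * (x - t)))) = iexp (- (w * x)) / (\<sigma> - \<i> * w + e)" for w
  proof -
    let ?q = "\<sigma> - \<i> * w + e"
    have "?k t * iexp (- (w * (x - t))) = iexp (- (w * x)) * (exp (- ?q * of_real t) * complex_of_real (indicator {0..} t * t powr (1 - 1)))" for t
      by (simp add: frac_kernel_def algebra_simps flip: exp_add)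
    then have "(LBINT t. ?k t * iexp (- (w * (x - t)))) = iexp (- (w * x)) * (LBINT t. exp (- ?q * of_real t) * complex_of_real (indicator {0..} t * t powr (1 - 1)))"
      by (simp only: integral_mult_right_zero)
    also have "(LBINT t. exp (- ?q * of_real t) * complex_of_real (indicator {0..} t * t powr (1 - 1))) = 1 / ?q"
      using powr_exp_integral[of 1 ?q] pos by (simp add: powr_minus divide_inverse)
    finally show ?thesis by simp
  qed
  have "(LBINT t. ?k t * G (Suc m) (x - t)) = (LBINT t. ?k t * (LBINT w. b w * iexp (- (w * (x - t)))))"
    unfolding phi fourier_synth_def ..
  also have "\<dots> = (LBINT w. b w * (LBINT t. ?k t * iexp (- (w * (x - t)))))"
    by (rule lborel_Fubini_bounded[OF ki b, where B=1]) (auto simp del: of_real_diff of_real_mult)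
  finally show ?thesis unfolding inner by (simp add: mult.assoc)
qed

end

section \<open>Unit differences and the relation between the two spectral densities\<close>

text \<open>The singularities at 0 and 1 are integrable, and by the mean value theorem the
  difference gains one power of decay at infinity, t powr (\<nu> - 2) instead of t powr (\<nu> -
  1).\<close>

lemma frac_kernel_diff_integrable:
  assumes \<nu>: "0 < \<nu>" "\<nu> \<le> 1"
  shows "integrable lborel (\<lambda>t. frac_kernel \<nu> t - frac_kernel \<nu> (t - 1))"
proof (rule Bochner_Integration.integrable_bound)
  \<comment> \<open>For \<nu> = 1 the power alone is 1/t and not integrable; the factor 1 - \<nu>
    from the mean value theorem makes the term 0.\<close>
  have tail: "integrable lborel (\<lambda>t. (1 - \<nu>) * (indicator {1..} (t - 1) * (t - 1) powr (\<nu> - 2)))"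
  proof (cases "\<nu> = 1")
    case False
    have "((\<lambda>x. x powr (\<nu> - 2)) has_integral - (1 powr (\<nu> - 2 + 1)) / (\<nu> - 2 + 1)) {1..}"
      using \<nu> False by (intro has_integral_powr_to_inf) auto
    then have "(\<integral>\<^sup>+ x. ennreal (indicator {1..} x * x powr (\<nu> - 2)) \<partial>lborel) = ennreal (- (1 powr (\<nu> - 2 + 1)) / (\<nu> - 2 + 1))"
      using nn_integral_has_integral_lebesgue[of "{1..}" "\<lambda>x. x powr (\<nu> - 2)"] by simp
    then have "has_bochner_integral lborel (\<lambda>t. indicator {1..} t * t powr (\<nu> - 2)) (- (1 powr (\<nu> - 2 + 1)) / (\<nu> - 2 + 1))"
      using \<nu> False by (intro has_bochner_integral_nn_integral) (auto simp: field_simps)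
    then have "integrable lborel (\<lambda>t. indicator {1..} (t - 1) * (t - 1) powr (\<nu> - 2))"
      using lborel_integrable_shift_iff[of "\<lambda>t. indicator {1..} t * t powr (\<nu> - 2)" 1] by (simp add: has_bochner_integral_iff)
    then show ?thesis by (rule integrable_mult_right)
  qed simp
  have near: "integrable lborel (\<lambda>t. indicator {..d} t * frac_kernel \<nu> t)" if "0 \<le> d" for d
    using frac_kernel_has_integral[OF \<nu>(1) that] by (simp add: has_bochner_integral_iff)
  have near': "integrable lborel (\<lambda>t. indicator {..1} (t - 1) * frac_kernel \<nu> (t - 1))"
    using near[of 1] lborel_integrable_shift_iff[of "\<lambda>t. indicator {..1} t * frac_kernel \<nu> t" 1] by simp
  let ?D = "\<lambda>t. indicator {..2} t * frac_kernel \<nu> t + indicator {..1} (t - 1) * frac_kernel \<nu> (t - 1)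
     + (1 - \<nu>) * (indicator {1..} (t - 1) * (t - 1) powr (\<nu> - 2))"
  show "integrable lborel ?D"
    using near near' tail by (intro Bochner_Integration.integrable_add) auto
  show "AE t in lborel. norm (frac_kernel \<nu> t - frac_kernel \<nu> (t - 1)) \<le> norm (?D t)"
  proof (rule AE_I2)
    fix t :: real
    have D0: "?D t \<ge> 0" using \<nu> by (intro add_nonneg_nonneg mult_nonneg_nonneg) auto
    have "\<bar>frac_kernel \<nu> t - frac_kernel \<nu> (t - 1)\<bar> \<le> ?D t"
    proof (cases "t \<le> 2")
      case True
      have "0 \<le> (1 - \<nu>) * (indicator {1..} (t - 1) * (t - 1) powr (\<nu> - 2))"
        using \<nu> by (intro mult_nonneg_nonneg) auto
      then show ?thesis using True frac_kernel_nonneg[of \<nu> t] frac_kernel_nonneg[of \<nu> "t - 1"]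
        by (simp del: frac_kernel_nonneg)
    next
      case False
      have "\<exists>z>t - 1. z < t \<and> t powr (\<nu> - 1) - (t - 1) powr (\<nu> - 1) = (t - (t - 1)) * ((\<nu> - 1) * z powr (\<nu> - 1 - 1))"
        using False by (intro MVT2) (auto intro!: derivative_eq_intros)
      then obtain z where z: "z > t - 1" "z < t" "t powr (\<nu> - 1) - (t - 1) powr (\<nu> - 1) = (\<nu> - 1) * z powr (\<nu> - 2)"
        by auto
      have "z powr (\<nu> - 2) \<le> (t - 1) powr (\<nu> - 2)"
        using z False \<nu> by (intro powr_mono2') auto
      then have "\<bar>t powr (\<nu> - 1) - (t - 1) powr (\<nu> - 1)\<bar> \<le> (1 - \<nu>) * (t - 1) powr (\<nu> - 2)"
        using \<nu> unfolding z(3) by (auto simp: abs_mult intro!: mult_left_mono)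
      then show ?thesis using False by (simp add: frac_kernel_def)
    qed
    then show "norm (frac_kernel \<nu> t - frac_kernel \<nu> (t - 1)) \<le> norm (?D t)"
      using D0 by (simp only: real_norm_def abs_of_nonneg)
  qed
qed auto

context subst_core
begin

text \<open>The symbol of D_s: applied to exp(- \<i> w x), it multiplies by
  \<open>p w\<close>.\<close>

definition p :: "real \<Rightarrow> complex" where "p w = \<sigma> - \<i> * w"
definition sdiff :: "(real \<Rightarrow> complex) \<Rightarrow> real \<Rightarrow> complex" where
  "sdiff g x = g x - exp (- \<sigma>) * g (x - 1)"
text \<open>This is (1 - exp(- p)) / p, written as the transform of a kernel on [0, 1] so that the
  removable singularity at p = 0 needs no case distinction.\<close>

definition bk :: "real \<Rightarrow> complex" where
  "bk w = (LBINT t. (complex_of_real (indicator {0..1} t) * exp (- \<sigma> * of_real t)) * iexp (w * t))"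

lemma p_measurable [measurable]: "p \<in> borel_measurable borel"
  unfolding p_def by measurable

lemma bk_measurable [measurable]: "bk \<in> borel_measurable borel"
  unfolding bk_def by measurable

lemma bk_kernel_integrable: "integrable lborel (\<lambda>t. complex_of_real (indicator {0..1} t) * exp (- \<sigma> * of_real t))"
  using borel_integrable_atLeastAtMost'[of 0 1 "\<lambda>t. exp (- \<sigma> * complex_of_real t)"]
  by (simp add: set_integrable_def scaleR_conv_of_real continuous_intros)

lemma bk_bound: "norm (bk w) \<le> (LBINT t. norm (complex_of_real (indicator {0..1} t) * exp (- \<sigma> * of_real t)))"
  unfolding bk_def by (rule norm_integral_le[OF integrable_norm[OF bk_kernel_integrable]]) (simp add: norm_mult)

lemma p_mult_bk: "p w * bk w = 1 - exp (- p w)"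
proof -
  have "(LBINT t. indicator {0..1} t *\<^sub>R (p w * exp (- p w * of_real t))) = - exp (- p w * of_real 1) - (- exp (- p w * of_real 0))"
  proof (rule integral_FTC_atLeastAtMost)
    fix t :: real
    have "((\<lambda>t. - exp (- p w * of_real t)) has_vector_derivative (- (exp (- p w * of_real t) * (- p w)))) (at t within {0..1})"
      by (auto intro!: derivative_eq_intros has_vector_derivative_real_field)
    then show "((\<lambda>t. - exp (- p w * of_real t)) has_vector_derivative (p w * exp (- p w * of_real t))) (at t within {0..1})"
      by (simp add: mult.commute)
  qed (auto intro!: continuous_intros)
  moreover have "indicator {0..1} t *\<^sub>R (p w * exp (- p w * of_real t)) = p w * ((complex_of_real (indicator {0..1} t) * exp (- \<sigma> * of_real t)) * iexp (w * t))" for t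
    by (simp add: p_def scaleR_conv_of_real algebra_simps flip: exp_add)
  ultimately have "p w * bk w = - exp (- p w * of_real 1) - (- exp (- p w * of_real 0))"
    unfolding bk_def by (simp only: integral_mult_right_zero)
  then show ?thesis by simp
qed

lemma bk_mult_integrable: "integrable lborel \<psi> \<Longrightarrow> integrable lborel (\<lambda>w. bk w * \<psi> w)"
  by (rule integrable_mult_bounded(2)[OF _ _ bk_bound]) auto

text \<open>Integrating exp(- \<sigma> t) (D_s g)(x - t) over 0 \<le> t \<le> 1 gives exactly
  \<open>sdiff g x\<close>. The identity is local, so \<open>g\<close> may grow arbitrarily.\<close>

lemma sdiff_eq_synth:
  assumes \<psi>: "integrable lborel \<psi>"
    and g: "\<And>x. (g has_vector_derivative (fourier_synth \<psi> x - \<sigma> * g x)) (at x)"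
  shows "sdiff g = fourier_synth (\<lambda>w. bk w * \<psi> w)"
proof
  fix x
  let ?k = "\<lambda>t. complex_of_real (indicator {0..1} t) * exp (- \<sigma> * of_real t)"
  have "(LBINT t. indicator {0..1} t *\<^sub>R (exp (- \<sigma> * of_real t) * fourier_synth \<psi> (x - t))) =
      - exp (- \<sigma> * of_real 1) * g (x - 1) - (- exp (- \<sigma> * of_real 0) * g (x - 0))"
  proof (rule integral_FTC_atLeastAtMost)
    fix t :: real
    have 1: "((\<lambda>t. - exp (- \<sigma> * of_real t)) has_vector_derivative (- (exp (- \<sigma> * of_real t) * (- \<sigma>)))) (at t)"
      by (auto intro!: derivative_eq_intros has_vector_derivative_real_field)
    have 2: "((\<lambda>t. g (x - t)) has_vector_derivative (-1) *\<^sub>R (fourier_synth \<psi> (x - t) - \<sigma> * g (x - t))) (at t)"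
      by (rule vector_diff_chain_at[of "\<lambda>t. x - t" "-1" t g, unfolded o_def])
         (auto intro!: derivative_eq_intros g)
    have "((\<lambda>t. - exp (- \<sigma> * of_real t) * g (x - t)) has_vector_derivative (exp (- \<sigma> * of_real t) * fourier_synth \<psi> (x - t))) (at t)"
      using has_vector_derivative_mult[OF 1 2] by (simp add: algebra_simps)
    then show "((\<lambda>t. - exp (- \<sigma> * of_real t) * g (x - t)) has_vector_derivative (exp (- \<sigma> * of_real t) * fourier_synth \<psi> (x - t))) (at t within {0..1})"
      by (rule has_vector_derivative_at_within)
  qed (auto intro!: continuous_intros continuous_on_compose2[OF continuous_fourier_synth[OF \<psi>]])
  then have "sdiff g x = (LBINT t. ?k t * fourier_synth \<psi> (x - t))"
    by (simp add: sdiff_def scaleR_conv_of_real mult.assoc)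
  also have "\<dots> = (LBINT t. ?k t * (LBINT w. \<psi> w * iexp (- (w * (x - t)))))"
    unfolding fourier_synth_def ..
  also have "\<dots> = (LBINT w. \<psi> w * (LBINT t. ?k t * iexp (- (w * (x - t)))))"
    by (rule lborel_Fubini_bounded[OF bk_kernel_integrable \<psi>, where B=1]) (auto simp del: of_real_diff of_real_mult)
  also have "\<dots> = fourier_synth (\<lambda>w. bk w * \<psi> w) x"
    unfolding fourier_synth_def
  proof (rule Bochner_Integration.integral_cong[OF refl])
    fix w
    have "?k t * iexp (- (w * (x - t))) = iexp (- (w * x)) * (?k t * iexp (w * t))" for t
      by (simp add: algebra_simps flip: exp_add)
    then have "(LBINT t. ?k t * iexp (- (w * (x - t)))) = iexp (- (w * x)) * bk w"
      unfolding bk_def by (simp only: integral_mult_right_zero)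
    then show "\<psi> w * (LBINT t. ?k t * iexp (- (w * (x - t)))) = bk w * \<psi> w * iexp (- (w * x))"
      by simp
  qed
  finally show "sdiff g x = fourier_synth (\<lambda>w. bk w * \<psi> w) x" .
qed

lemma sdiff_deriv:
  assumes g: "\<And>x. (g has_vector_derivative (g' x - \<sigma> * g x)) (at x)"
  shows "(sdiff g has_vector_derivative (sdiff g' x - \<sigma> * sdiff g x)) (at x)"
proof -
  have "((\<lambda>x. g (x - 1)) has_vector_derivative 1 *\<^sub>R (g' (x - 1) - \<sigma> * g (x - 1))) (at x)"
    by (rule vector_diff_chain_at[of "\<lambda>x. x - 1" 1 x g, unfolded o_def])
       (auto intro!: derivative_eq_intros g)
  then have "((\<lambda>x. g x - exp (- \<sigma>) * g (x - 1)) has_vector_derivative ((g' x - \<sigma> * g x) - exp (- \<sigma>) * (g' (x - 1) - \<sigma> * g (x - 1)))) (at x)"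
    using g by (intro has_vector_derivative_diff has_vector_derivative_mult_right) auto
  then show ?thesis
    unfolding sdiff_def[abs_def] by (simp add: algebra_simps)
qed

lemma sdiff_funpow_deriv:
  assumes g: "\<And>x. (g has_vector_derivative (g' x - \<sigma> * g x)) (at x)"
  shows "((sdiff ^^ n) g has_vector_derivative ((sdiff ^^ n) g' x - \<sigma> * (sdiff ^^ n) g x)) (at x)"
  using g by (induction n arbitrary: x) (auto intro: sdiff_deriv)

text \<open>Descends from the top derivative: undoing one D_s costs one more difference and one
  factor \<open>bk\<close>, since \<open>sdiff\<close> commutes with D_s. At j = m it reaches the
  fractional integral itself.\<close>

lemma sdiff_funpow_G:
  "j \<le> m \<Longrightarrow> (sdiff ^^ Suc j) (G (m - j)) = fourier_synth (\<lambda>w. bk w ^ Suc j * b w) \<and> integrable lborel (\<lambda>w. bk w ^ Suc j * b w)"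
proof (induction j)
  case 0
  show ?case using sdiff_eq_synth[OF b, of "G m"] Gd[of m] bk_mult_integrable[OF b] by (simp add: phi)
next
  case (Suc j)
  let ?g = "(sdiff ^^ Suc j) (G (m - Suc j))"
  have IH: "(sdiff ^^ Suc j) (G (m - j)) = fourier_synth (\<lambda>w. bk w ^ Suc j * b w)" "integrable lborel (\<lambda>w. bk w ^ Suc j * b w)"
    using Suc by auto
  have "(G (m - Suc j) has_vector_derivative (G (m - j) x - \<sigma> * G (m - Suc j) x)) (at x)" for x
    using Gd[of "m - Suc j" x] Suc.prems by (simp add: Suc_diff_Suc)
  from sdiff_funpow_deriv[OF this, of "Suc j"]
  have "sdiff ?g = fourier_synth (\<lambda>w. bk w * (bk w ^ Suc j * b w))"
    unfolding IH(1) by (intro sdiff_eq_synth IH)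
  with bk_mult_integrable[OF IH(2)] show ?case by (simp add: mult.assoc)
qed

lemma sdiff_synth:
  assumes \<psi>: "integrable lborel \<psi>"
  shows "sdiff (fourier_synth \<psi>) = fourier_synth (\<lambda>w. (1 - exp (- p w)) * \<psi> w)"
proof
  fix x
  have "sdiff (fourier_synth \<psi>) x = (LBINT w. \<psi> w * iexp (- (w * x)) - exp (- \<sigma>) * (\<psi> w * iexp (- (w * (x - 1)))))"
    unfolding sdiff_def fourier_synth_def
    using fourier_synth_integrable[OF \<psi>]
    by (subst Bochner_Integration.integral_diff) (auto simp del: of_real_diff of_real_mult)
  also have "\<dots> = fourier_synth (\<lambda>w. (1 - exp (- p w)) * \<psi> w) x"
    unfolding fourier_synth_def
    by (intro Bochner_Integration.integral_cong) (auto simp: p_def algebra_simps simp flip: exp_add)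
  finally show "sdiff (fourier_synth \<psi>) x = fourier_synth (\<lambda>w. (1 - exp (- p w)) * \<psi> w) x" .
qed

lemma one_minus_exp_p_bound: "norm (1 - exp (- p w)) \<le> 1 + exp (- Re \<sigma>)"
  using norm_triangle_ineq4[of 1 "exp (- p w)"] by (simp add: p_def)

lemma sdiff_funpow_synth:
  assumes \<psi>: "integrable lborel \<psi>"
  shows "(sdiff ^^ n) (fourier_synth \<psi>) = fourier_synth (\<lambda>w. (1 - exp (- p w)) ^ n * \<psi> w) \<and> integrable lborel (\<lambda>w. (1 - exp (- p w)) ^ n * \<psi> w)"
proof (induction n)
  case (Suc n)
  then show ?case
    using sdiff_synth[of "\<lambda>w. (1 - exp (- p w)) ^ n * \<psi> w"]
      integrable_mult_bounded(2)[of lborel "\<lambda>w. (1 - exp (- p w)) ^ n * \<psi> w" "\<lambda>w. 1 - exp (- p w)", OF _ _ one_minus_exp_p_bound]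
    by (simp add: mult.assoc)
qed (use \<psi> in simp)

text \<open>The factor exp(- \<sigma>) in \<open>sdiff\<close> matches the shift of the damping, so
  \<open>sdiff\<close> turns the kernel of the fractional integral into exp(- \<sigma> t) K t /
  Gamma \<nu>. This is integrable when Re \<sigma> \<ge> 0, and \<open>kap\<close> is its
  multiplier.\<close>

definition K :: "real \<Rightarrow> real" where "K t = frac_kernel \<nu> t - frac_kernel \<nu> (t - 1)"
definition kap :: "real \<Rightarrow> complex" where
  "kap w = complex_of_real (1 / Gamma \<nu>) * (LBINT t. (complex_of_real (K t) * exp (- \<sigma> * of_real t)) * iexp (w * t))"

lemma K_measurable [measurable]: "K \<in> borel_measurable borel"
  unfolding K_def by measurable

lemma K_integrable: "integrable lborel K"
  unfolding K_def[abs_def] by (rule frac_kernel_diff_integrable[OF \<nu>])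

lemma K_neg: "t < 0 \<Longrightarrow> K t = 0"
  by (simp add: K_def frac_kernel_neg)

lemma K_exp_integrable:
  assumes "Re q \<ge> 0"
  shows "integrable lborel (\<lambda>t. complex_of_real (K t) * exp (- q * of_real t))"
proof (rule Bochner_Integration.integrable_bound[OF K_integrable])
  show "AE t in lborel. norm (complex_of_real (K t) * exp (- q * of_real t)) \<le> norm (K t)"
  proof (rule AE_I2)
    fix t :: real
    show "norm (complex_of_real (K t) * exp (- q * of_real t)) \<le> norm (K t)"
      using assms by (cases "t < 0") (auto simp: K_neg norm_mult intro!: mult_left_le)
  qed
qed measurable

lemma kap_measurable [measurable]: "kap \<in> borel_measurable borel"
  unfolding kap_def by measurable

lemma kap_bound:
  assumes s: "Re \<sigma> \<ge> 0"
  shows "norm (kap w) \<le> norm (complex_of_real (1 / Gamma \<nu>)) * (LBINT t. norm (complex_of_real (K t) * exp (- \<sigma> * of_real t)))"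
  unfolding kap_def
  by (subst norm_mult, rule mult_left_mono, rule norm_integral_le[OF integrable_norm[OF K_exp_integrable[OF s]]]) (simp_all add: norm_mult)

lemma G0_conv:
  "G 0 x = complex_of_real (1 / Gamma \<nu>) * (LBINT t. complex_of_real (frac_kernel \<nu> t) * exp (- \<sigma> * of_real t) * f (x - t))"
  and G0_conv_integrable: "integrable lborel (\<lambda>t. complex_of_real (frac_kernel \<nu> t) * exp (- \<sigma> * of_real t) * f (x - t))"
proof -
  have eq: "exp (- \<sigma> * x) * (complex_of_real (frac_kernel \<nu> (x - (x - t))) * F (x - t)) = complex_of_real (frac_kernel \<nu> t) * exp (- \<sigma> * of_real t) * f (x - t)" for t
    by (simp add: F_def algebra_simps flip: exp_add)
  let ?g = "\<lambda>\<tau>. exp (- \<sigma> * x) * (complex_of_real (frac_kernel \<nu> (x - \<tau>)) * F \<tau>)"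
  have g: "integrable lborel ?g" by (rule integrable_mult_right[OF frac_F_integrable])
  show "integrable lborel (\<lambda>t. complex_of_real (frac_kernel \<nu> t) * exp (- \<sigma> * of_real t) * f (x - t))"
    using g unfolding lborel_integrable_minus_iff[of ?g x, symmetric] eq .
  have "G 0 x = exp (- \<sigma> * x) * U 0 x" by (simp add: U_def exp_minus)
  also have "\<dots> = complex_of_real (1 / Gamma \<nu>) * (LBINT \<tau>. ?g \<tau>)"
    unfolding U0 by simp
  also have "(LBINT \<tau>. ?g \<tau>) = (LBINT t. complex_of_real (frac_kernel \<nu> t) * exp (- \<sigma> * of_real t) * f (x - t))"
    unfolding lborel_integral_minus[of ?g x, symmetric] eq ..
  finally show "G 0 x = complex_of_real (1 / Gamma \<nu>) * (LBINT t. complex_of_real (frac_kernel \<nu> t) * exp (- \<sigma> * of_real t) * f (x - t))" .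
qed

lemma sdiff_G0:
  assumes s: "Re \<sigma> \<ge> 0"
  shows "sdiff (G 0) = fourier_synth (\<lambda>w. kap w * a w)" "integrable lborel (\<lambda>w. kap w * a w)"
proof -
  show "integrable lborel (\<lambda>w. kap w * a w)"
    by (rule integrable_mult_bounded(2)[OF a _ kap_bound[OF s]]) auto
  show "sdiff (G 0) = fourier_synth (\<lambda>w. kap w * a w)"
  proof
    fix x
    let ?g = "\<lambda>y t. complex_of_real (frac_kernel \<nu> t) * exp (- \<sigma> * of_real t) * f (y - t)"
    let ?k = "\<lambda>t. complex_of_real (K t) * exp (- \<sigma> * of_real t)"
    have sh: "exp (- \<sigma>) * ?g (x - 1) (t - 1) = complex_of_real (frac_kernel \<nu> (t - 1)) * exp (- \<sigma> * of_real t) * f (x - t)" for t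
      by (simp add: algebra_simps flip: exp_add)
    have i2: "integrable lborel (\<lambda>t. exp (- \<sigma>) * ?g (x - 1) (t - 1))"
      using G0_conv_integrable[of "x - 1"] lborel_integrable_shift_iff[of "?g (x - 1)" 1] by (intro integrable_mult_right) simp
    have "sdiff (G 0) x = complex_of_real (1 / Gamma \<nu>) * ((LBINT t. ?g x t) - (LBINT t. exp (- \<sigma>) * ?g (x - 1) (t - 1)))"
      unfolding sdiff_def G0_conv integral_mult_right_zero lborel_integral_shift[of "?g (x - 1)" 1]
      by (simp add: algebra_simps)
    also have "(LBINT t. ?g x t) - (LBINT t. exp (- \<sigma>) * ?g (x - 1) (t - 1)) = (LBINT t. ?g x t - exp (- \<sigma>) * ?g (x - 1) (t - 1))"
      by (rule Bochner_Integration.integral_diff[OF G0_conv_integrable i2, symmetric])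
    also have "\<dots> = (LBINT t. ?k t * (LBINT w. a w * iexp (- (w * (x - t)))))"
      unfolding sh by (intro Bochner_Integration.integral_cong) (auto simp: K_def f fourier_synth_def algebra_simps)
    also have "\<dots> = (LBINT w. a w * (LBINT t. ?k t * iexp (- (w * (x - t)))))"
      by (rule lborel_Fubini_bounded[OF K_exp_integrable[OF s] a, where B=1]) (auto simp del: of_real_diff of_real_mult)
    also have "complex_of_real (1 / Gamma \<nu>) * \<dots> = (LBINT w. complex_of_real (1 / Gamma \<nu>) * (a w * (LBINT t. ?k t * iexp (- (w * (x - t))))))"
      by (rule integral_mult_right_zero[symmetric])
    also have "\<dots> = (LBINT w. kap w * a w * iexp (- (w * x)))"
    proof (rule Bochner_Integration.integral_cong[OF refl])
      fix w
      have "?k t * iexp (- (w * (x - t))) = iexp (- (w * x)) * (?k t * iexp (w * t))" for t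
        by (simp add: algebra_simps flip: exp_add)
      then have "(LBINT t. ?k t * iexp (- (w * (x - t)))) = iexp (- (w * x)) * (LBINT t. ?k t * iexp (w * t))"
        by (simp only: integral_mult_right_zero)
      then show "complex_of_real (1 / Gamma \<nu>) * (a w * (LBINT t. ?k t * iexp (- (w * (x - t))))) = kap w * a w * iexp (- (w * x))"
        unfolding kap_def by simp
    qed
    finally show "sdiff (G 0) x = fourier_synth (\<lambda>w. kap w * a w) x"
      by (simp add: fourier_synth_def)
  qed
qed

lemma K_laplace:
  fixes q :: complex
  assumes q: "Re q > 0"
  shows "(LBINT t. complex_of_real (K t) * exp (- q * of_real t)) = (1 - exp (- q)) * (Gamma \<nu> * q powr (- \<nu>))"
proof -
  let ?g = "\<lambda>t. exp (- q * of_real t) * complex_of_real (frac_kernel \<nu> t)"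
  have g: "integrable lborel ?g"
    using powr_exp_integrable[OF \<nu>(1) q] by (simp add: frac_kernel_def)
  have G: "(LBINT t. ?g t) = Gamma \<nu> * q powr (- \<nu>)"
    using powr_exp_integral[OF \<nu>(1) q] by (simp add: frac_kernel_def)
  have g1: "integrable lborel (\<lambda>t. exp (- q) * ?g (t - 1))"
    using g lborel_integrable_shift_iff[of ?g 1] by (intro integrable_mult_right) simp
  have "complex_of_real (K t) * exp (- q * of_real t) = ?g t - exp (- q) * ?g (t - 1)" for t
    by (simp add: K_def algebra_simps flip: exp_add)
  then have "(LBINT t. complex_of_real (K t) * exp (- q * of_real t)) = (LBINT t. ?g t) - (LBINT t. exp (- q) * ?g (t - 1))"
    using Bochner_Integration.integral_diff[OF g g1] by simp
  also have "(LBINT t. exp (- q) * ?g (t - 1)) = exp (- q) * (LBINT t. ?g t)"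
    by (simp only: integral_mult_right_zero lborel_integral_shift[of ?g 1])
  finally show ?thesis unfolding G by (simp add: algebra_simps)
qed

text \<open>If Re \<sigma> = 0, then \<open>p w\<close> lies on the imaginary axis, outside the
  reach of \<open>K_laplace\<close>. It is approached from the right under the majorant |K|; as p w
  \<noteq> 0, the limit stays off the branch cut.\<close>

lemma kap_eq:
  assumes s: "Re \<sigma> \<ge> 0" and pw: "p w \<noteq> 0"
  shows "kap w = (1 - exp (- p w)) * p w powr (- \<nu>)"
proof -
  define q where "q n = p w + of_real (inverse (real (Suc n)))" for n
  have Rp: "Re (p w) \<ge> 0" using s by (simp add: p_def)
  have q: "Re (q n) > 0" for n using Rp by (simp add: q_def add_nonneg_pos)
  have ql: "q \<longlonglongrightarrow> p w"
  proof -
    have "q \<longlonglongrightarrow> p w + of_real 0"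
      unfolding q_def by (intro tendsto_intros LIMSEQ_inverse_real_of_nat)
    then show ?thesis by simp
  qed
  have "(\<lambda>n. LBINT t. complex_of_real (K t) * exp (- q n * of_real t)) \<longlonglongrightarrow> (LBINT t. complex_of_real (K t) * exp (- p w * of_real t))"
  proof (rule integral_dominated_convergence)
    show "integrable lborel (\<lambda>t. norm (K t))" using K_integrable by simp
    show "AE t in lborel. (\<lambda>n. complex_of_real (K t) * exp (- q n * of_real t)) \<longlonglongrightarrow> complex_of_real (K t) * exp (- p w * of_real t)"
      by (intro AE_I2 tendsto_intros ql)
    show "AE t in lborel. norm (complex_of_real (K t) * exp (- q n * of_real t)) \<le> norm (K t)" for n
    proof (rule AE_I2)
      fix t :: real
      show "norm (complex_of_real (K t) * exp (- q n * of_real t)) \<le> norm (K t)"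
        using q[of n] by (cases "t < 0") (auto simp: K_neg norm_mult intro!: mult_left_le)
    qed
  qed measurable
  moreover have "(\<lambda>n. (1 - exp (- q n)) * (Gamma \<nu> * q n powr (- \<nu>))) \<longlonglongrightarrow> (1 - exp (- p w)) * (Gamma \<nu> * p w powr (- \<nu>))"
  proof -
    have "p w \<notin> \<real>\<^sub>\<le>\<^sub>0" using Rp pw by (auto simp: complex_nonpos_Reals_iff complex_eq_iff)
    then have "isCont (\<lambda>z. z powr complex_of_real (- \<nu>)) (p w)"
      using has_field_derivative_powr DERIV_isCont by blast
    then have l: "(\<lambda>n. q n powr complex_of_real (- \<nu>)) \<longlonglongrightarrow> p w powr complex_of_real (- \<nu>)"
      using isCont_tendsto_compose ql by blast
    then show ?thesis by (intro tendsto_mult tendsto_diff tendsto_const tendsto_exp tendsto_minus ql l)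
  qed
  ultimately have "(LBINT t. complex_of_real (K t) * exp (- p w * of_real t)) = (1 - exp (- p w)) * (Gamma \<nu> * p w powr (- \<nu>))"
    unfolding K_laplace[OF q] using LIMSEQ_unique by blast
  moreover have "(complex_of_real (K t) * exp (- \<sigma> * of_real t)) * iexp (w * t) = complex_of_real (K t) * exp (- p w * of_real t)" for t
    by (simp add: p_def algebra_simps flip: exp_add)
  ultimately have "kap w = complex_of_real (1 / Gamma \<nu>) * ((1 - exp (- p w)) * (Gamma \<nu> * p w powr (- \<nu>)))"
    unfolding kap_def by (simp only:)
  then show ?thesis
    using Gamma_nonzero by simp
qed

text \<open>The (m + 1)-fold difference of \<open>G 0\<close> is computed from above, through
  \<open>b\<close>, and from below, through \<open>a\<close>; densities of equal syntheses agree.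
  The common factor (1 - exp(- p)) ^ Suc m vanishes only on a countable set and is cancelled,
  leaving the exponent m + 1 - \<nu> = \<alpha> + 1.\<close>

lemma b_eq_AE:
  assumes s: "Re \<sigma> \<ge> 0"
  shows "AE w in lborel. b w = p w powr (\<alpha> + 1) * a w"
proof -
  have "(sdiff ^^ Suc m) (G 0) = fourier_synth (\<lambda>w. bk w ^ Suc m * b w)" and i1: "integrable lborel (\<lambda>w. bk w ^ Suc m * b w)"
    using sdiff_funpow_G[of m] by auto
  moreover have "(sdiff ^^ Suc m) (G 0) = (sdiff ^^ m) (fourier_synth (\<lambda>w. kap w * a w))"
    by (simp only: funpow_Suc_right o_apply sdiff_G0[OF s])
  moreover have "(sdiff ^^ m) (fourier_synth (\<lambda>w. kap w * a w)) = fourier_synth (\<lambda>w. (1 - exp (- p w)) ^ m * (kap w * a w))"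
    and i2: "integrable lborel (\<lambda>w. (1 - exp (- p w)) ^ m * (kap w * a w))"
    using sdiff_funpow_synth[OF sdiff_G0(2)[OF s], of m] by auto
  ultimately have eq: "AE w in lborel. bk w ^ Suc m * b w = (1 - exp (- p w)) ^ m * (kap w * a w)"
    by (intro fourier_synth_unique) auto
  have cnt: "countable {w. exp (- p w) = 1}"
  proof (rule countable_subset)
    show "{w. exp (- p w) = 1} \<subseteq> range (\<lambda>n::int. Im \<sigma> + of_int (2 * n) * pi)"
    proof
      fix w assume "w \<in> {w. exp (- p w) = 1}"
      then obtain n :: int where "Im (- p w) = of_int (2 * n) * pi" by (auto simp: exp_eq_1)
      then have "w = Im \<sigma> + of_int (2 * n) * pi" by (simp add: p_def)
      then show "w \<in> range (\<lambda>n::int. Im \<sigma> + of_int (2 * n) * pi)" by blast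
    qed
  qed auto
  then have "AE w in lborel. exp (- p w) \<noteq> 1"
    using AE_not_in[OF countable_imp_null_set_lborel[OF cnt]] by simp
  with eq show ?thesis
  proof eventually_elim
    case (elim w)
    then have p0: "p w \<noteq> 0" by auto
    have "(1 - exp (- p w)) ^ Suc m * b w = p w ^ Suc m * (bk w ^ Suc m * b w)"
      by (simp only: p_mult_bk[symmetric] power_mult_distrib mult.assoc)
    also have "\<dots> = p w ^ Suc m * ((1 - exp (- p w)) ^ m * ((1 - exp (- p w)) * p w powr (- \<nu>) * a w))"
      unfolding elim(1) kap_eq[OF s p0] ..
    also have "\<dots> = (1 - exp (- p w)) ^ Suc m * (p w ^ Suc m * p w powr (- \<nu>) * a w)"
      by simp
    finally have "b w = p w ^ Suc m * p w powr (- \<nu>) * a w"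
      using elim(2) by simp
    also have "p w ^ Suc m * p w powr (- \<nu>) = p w powr (\<alpha> + 1)"
    proof -
      have "p w ^ Suc m = p w powr (of_nat (Suc m))" using p0 by (metis powr_complexpow)
      moreover have "of_nat (Suc m) + (- complex_of_real \<nu>) = of_real (\<alpha> + 1)"
        by (simp add: \<nu>_eq)
      ultimately show ?thesis by (metis of_real_minus powr_add)
    qed
    finally show ?case .
  qed
qed

lemma norm_powr_of_real: "norm (z powr complex_of_real r) = norm z powr r"
  by (simp add: norm_powr_real_powr')

lemma pa_integrable:
  assumes s: "Re \<sigma> \<ge> 0"
  shows "integrable lborel (\<lambda>w. p w powr \<alpha> * a w)"
proof (rule Bochner_Integration.integrable_bound)
  show "integrable lborel (\<lambda>w. norm (a w) + norm (b w))"
    using a b by simp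
  show "(\<lambda>w. p w powr \<alpha> * a w) \<in> borel_measurable lborel"
    using a by measurable
  show "AE w in lborel. norm (p w powr \<alpha> * a w) \<le> norm (norm (a w) + norm (b w))"
    using b_eq_AE[OF s]
  proof eventually_elim
    case (elim w)
    \<comment> \<open>Interpolation between the powers 0 and \<alpha> + 1, whose products with
      \<open>a\<close> are known to be integrable.\<close>
    have "norm (p w) powr \<alpha> \<le> 1 + norm (p w) powr (\<alpha> + 1)"
    proof (cases "norm (p w) \<le> 1")
      case True
      then have "norm (p w) powr \<alpha> \<le> 1 powr \<alpha>" using \<alpha> by (intro powr_mono2) auto
      then show ?thesis by (simp add: add_increasing2)
    next
      case False
      then have "norm (p w) powr \<alpha> \<le> norm (p w) powr (\<alpha> + 1)" by (intro powr_mono) auto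
      then show ?thesis by simp
    qed
    then have "norm (p w) powr \<alpha> * norm (a w) \<le> (1 + norm (p w) powr (\<alpha> + 1)) * norm (a w)"
      by (rule mult_right_mono) simp
    moreover have "norm (b w) = norm (p w) powr (\<alpha> + 1) * norm (a w)"
      using elim norm_powr_of_real[of "p w" "\<alpha> + 1"] by (simp only: norm_mult)
    ultimately show ?case by (simp only: norm_mult norm_powr_of_real) (simp add: algebra_simps)
  qed
qed

text \<open>On the time side the damping disappears under the majorant |G (Suc m)|, on the frequency
  side under |b / p|, which is |p| powr \<alpha> times |a|.\<close>

lemma Gm_eq_synth:
  assumes s: "Re \<sigma> \<ge> 0"
  shows "G m = fourier_synth (\<lambda>w. p w powr \<alpha> * a w)"
proof
  fix x
  define e where "e n = inverse (real (Suc n))" for n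
  have e: "e n > 0" for n by (simp add: e_def)
  have e0: "e \<longlonglongrightarrow> 0" unfolding e_def by (rule LIMSEQ_inverse_real_of_nat)
  have [measurable]: "b \<in> borel_measurable borel" "a \<in> borel_measurable borel" using a b by auto
  let ?g = "\<lambda>n t. exp (- (\<sigma> + of_real (e n)) * of_real t) * complex_of_real (frac_kernel 1 t) * G (Suc m) (x - t)"
  let ?l = "\<lambda>t. exp (- \<sigma> * of_real t) * complex_of_real (frac_kernel 1 t) * G (Suc m) (x - t)"
  let ?b = "\<lambda>n w. b w * iexp (- (w * x)) / (\<sigma> - \<i> * w + e n)"
  have "(\<lambda>n. LBINT t. ?g n t) \<longlonglongrightarrow> 
     (LBINT t. ?l t)"
  proof (rule integral_dominated_convergence)
    show "integrable lborel (\<lambda>t. norm (G (Suc m) (x - t)))"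
      using phi_int lborel_integrable_minus_iff[of "G (Suc m)" x] by (intro integrable_norm) simp
    show "AE t in lborel. norm (?g n t) \<le> norm (G (Suc m) (x - t))" for n
    proof (rule AE_I2)
      fix t :: real
      have "norm (exp (- (\<sigma> + of_real (e n)) * of_real t) * complex_of_real (frac_kernel 1 t)) \<le> 1"
      proof (cases "t \<ge> 0")
        case True
        then have "(Re \<sigma> + e n) * t \<ge> 0" using s e[of n] by simp
        then have "norm (exp (- (\<sigma> + of_real (e n)) * of_real t)) \<le> 1" by (simp add: algebra_simps)
        moreover have "norm (complex_of_real (frac_kernel 1 t)) \<le> 1" by (simp add: frac_kernel_def)
        ultimately show ?thesis unfolding norm_mult by (intro mult_le_one) auto
      qed (simp add: frac_kernel_neg)
      then show "norm (?g n t) \<le> norm (G (Suc m) (x - t))"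
        by (subst norm_mult) (rule mult_left_le_one_le, auto)
    qed
    show "AE t in lborel. (\<lambda>n. ?g n t) \<longlonglongrightarrow> ?l t"
    proof (rule AE_I2)
      fix t
      have "(\<lambda>n. ?g n t) \<longlonglongrightarrow> exp (- (\<sigma> + of_real 0) * of_real t) * complex_of_real (frac_kernel 1 t) * G (Suc m) (x - t)"
        by (intro tendsto_intros e0)
      then show "(\<lambda>n. ?g n t) \<longlonglongrightarrow> ?l t"
        by simp
    qed
  qed measurable
  then have 1: "(\<lambda>n. LBINT w. ?b n w) \<longlonglongrightarrow> G m x"
    unfolding Gm_eq[OF s, symmetric] Gm_regularised[OF s e] .
  have 2: "(\<lambda>n. LBINT w. ?b n w) \<longlonglongrightarrow> (LBINT w. p w powr \<alpha> * a w * iexp (- (w * x)))"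
  proof (rule integral_dominated_convergence)
    show "integrable lborel (\<lambda>w. norm (p w powr \<alpha> * a w))" using pa_integrable[OF s] by simp
    have pb: "p w \<noteq> 0 \<Longrightarrow> b w / p w = p w powr \<alpha> * a w" if "b w = p w powr (\<alpha> + 1) * a w" for w
      using that powr_add[of "p w" "complex_of_real \<alpha>" 1] by simp
    have "AE w in lborel. w \<noteq> Im \<sigma>" by (rule AE_lborel_singleton)
    then have p0: "AE w in lborel. p w \<noteq> 0"
      by eventually_elim (auto simp: p_def complex_eq_iff)
    show "AE w in lborel. norm (?b n w) \<le> norm (p w powr \<alpha> * a w)" for n
      using p0 b_eq_AE[OF s]
    proof eventually_elim
      case (elim w)
      \<comment> \<open>Adding a positive number to a complex number of nonnegative real part does
        not decrease its modulus.\<close>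
      have "norm (p w) \<le> norm (p w + e n)"
        using s e[of n] unfolding cmod_def by (intro real_sqrt_le_mono) (auto simp: p_def power_mono)
      then have "norm (b w) / norm (p w + e n) \<le> norm (b w) / norm (p w)"
        using elim(1) by (intro divide_left_mono mult_pos_pos) (auto intro: less_le_trans[of 0 "norm (p w)"] simp del: of_real_of_nat_eq)
      also have "norm (b w) / norm (p w) = norm (p w powr \<alpha> * a w)"
        unfolding pb[OF elim(2,1), symmetric] by (simp add: norm_divide)
      finally show ?case
        by (simp add: norm_mult norm_divide p_def)
    qed
    show "AE w in lborel. (\<lambda>n. ?b n w) \<longlonglongrightarrow> p w powr \<alpha> * a w * iexp (- (w * x))"
      using p0 b_eq_AE[OF s]
    proof eventually_elim
      case (elim w)
      have "(\<lambda>n. b w * iexp (- (w * x)) / (p w + e n)) \<longlonglongrightarrow> b w * iexp (- (w * x)) / (p w + of_real 0)"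
        using elim(1) by (intro tendsto_divide tendsto_add tendsto_of_real tendsto_const e0) simp
      then have "(\<lambda>n. b w * iexp (- (w * x)) / (p w + e n)) \<longlonglongrightarrow> (b w / p w) * iexp (- (w * x))"
        by simp
      then show ?case unfolding pb[OF elim(2,1)] by (simp add: p_def)
    qed
  qed measurable
  show "G m x = fourier_synth (\<lambda>w. p w powr \<alpha> * a w) x"
    unfolding fourier_synth_def using LIMSEQ_unique[OF 1 2] .
qed

lemma norm_exp_p_le:
  assumes s: "Re \<sigma> \<ge> 0" and h: "h > 0"
  shows "norm (exp (- (p w * of_real h))) \<le> 1"
  using s h by (simp add: p_def)

section \<open>The symbol of the difference operator and the first-order error bound\<close>

text \<open>A shift by k h multiplies the density by exp(\<i> w k h); with the damping in
  \<open>g1\<close> this becomes exp(- p h) ^ k, of modulus at most 1. The summable binomial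
  coefficients justify summing under the integral.\<close>

lemma A1_synth:
  assumes s: "Re \<sigma> \<ge> 0" and h: "h > 0"
  shows "(\<lambda>k. g1 \<sigma> \<alpha> h k * f (x - real k * h)) sums fourier_synth (\<lambda>w. (1 - exp (- (p w * of_real h))) powr \<alpha> * a w) x"
proof -
  let ?c = "\<lambda>k. complex_of_real \<alpha> gchoose k"
  define u where "u k w = ?c k * (- exp (- (p w * of_real h))) ^ k * (a w * iexp (- (w * x)))" for k w
  have [measurable]: "a \<in> borel_measurable borel" using a by auto
  have un: "norm (u k w) \<le> norm (?c k) * norm (a w)" for k w
    using norm_exp_p_le[OF s h, of w]
    by (auto simp: u_def norm_mult norm_power intro!: mult_right_mono mult_left_le power_le_one)
  have ui: "integrable lborel (u k)" for k
  proof (rule Bochner_Integration.integrable_bound)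
    show "integrable lborel (\<lambda>w. norm (?c k) * norm (a w))" using a by simp
  qed (use un in \<open>auto simp: u_def[abs_def]\<close>)
  have uint: "(LBINT w. u k w) = g1 \<sigma> \<alpha> h k * f (x - real k * h)" for k
  proof -
    have "u k w = ?c k * (- exp (- \<sigma> * of_real h)) ^ k * (a w * iexp (- (w * (x - real k * h))))" for w
    proof -
      have "(- exp (- (p w * of_real h))) ^ k * iexp (- (w * x)) = (- exp (- \<sigma> * of_real h)) ^ k * iexp (- (w * (x - real k * h)))"
      proof -
        have "exp (- (p w * of_real h)) ^ k * iexp (- (w * x)) = exp (- \<sigma> * of_real h) ^ k * iexp (- (w * (x - real k * h)))"
          by (simp add: p_def algebra_simps flip: exp_add exp_of_nat_mult)
        then show ?thesis
          by (simp only: power_minus[of "exp _"] mult.assoc)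
      qed
      then show ?thesis by (simp add: u_def mult_ac)
    qed
    then show ?thesis
      by (simp only: g1_eq_gchoose f fourier_synth_def integral_mult_right_zero)
  qed
  have sn: "summable (\<lambda>k. norm (u k w))" for w
    by (rule summable_comparison_test[OF _ summable_mult2[OF summable_norm_gbinomial[OF \<alpha>], of "norm (a w)"]])
       (use un in auto)
  have sI: "summable (\<lambda>k. LBINT w. norm (u k w))"
  proof (rule summable_comparison_test[OF _ summable_mult2[OF summable_norm_gbinomial[OF \<alpha>], of Mf]], intro exI allI impI)
    fix k
    have "(LBINT w. norm (u k w)) \<le> (LBINT w. norm (?c k) * norm (a w))"
      using ui a un by (intro integral_mono) auto
    then show "norm (LBINT w. norm (u k w)) \<le> norm (?c k) * Mf"
      by (simp add: Mf_def)
  qed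
  have "(\<lambda>k. LBINT w. u k w) sums (LBINT w. (\<Sum>k. u k w))"
    by (rule sums_integral[OF ui _ sI]) (use sn in auto)
  moreover have "(\<Sum>k. u k w) = (1 - exp (- (p w * of_real h))) powr \<alpha> * a w * iexp (- (w * x))" for w
    using sums_mult2[OF one_minus_powr_sums[OF \<alpha> norm_exp_p_le[OF s h, of w]], of "a w * iexp (- (w * x))"]
    unfolding u_def by (simp add: sums_iff mult.assoc)
  ultimately show ?thesis
    unfolding uint fourier_synth_def by simp
qed

text \<open>The surplus power |p| powr (\<alpha> + 1) times |a| is |b|, so the constant is that of
  \<open>powr_one_minus_exp_bound\<close> times the L1 norm of \<open>b\<close>; it depends neither
  on x nor on h.\<close>

theorem order_estimate_nonneg:
  assumes s: "Re \<sigma> \<ge> 0"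
  shows "\<exists>C. \<forall>h>0. \<forall>x. summable (\<lambda>k. g1 \<sigma> \<alpha> h k * f (x - real k * h)) \<and>
           norm (G m x - A1 \<sigma> \<alpha> h f x) \<le> C * h"
proof -
  obtain C where C: "\<And>z. Re z \<ge> 0 \<Longrightarrow> norm ((1 - exp (- z)) powr complex_of_real \<alpha> - z powr \<alpha>) \<le> C * norm z powr (\<alpha> + 1)"
    using powr_one_minus_exp_bound[OF \<alpha>] by blast
  have "norm (G m x - A1 \<sigma> \<alpha> h f x) \<le> (C * Mphi) * h" if h: "h > 0" for h x
  proof -
    let ?q = "\<lambda>w. (1 - exp (- (p w * of_real h))) powr complex_of_real \<alpha>"
    let ?r = "complex_of_real (1 / h powr \<alpha>)"
    let ?d = "\<lambda>w. p w powr \<alpha> * a w * iexp (- (w * x)) - ?r * (?q w * a w * iexp (- (w * x)))"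
    have [measurable]: "a \<in> borel_measurable borel" using a by auto
    have q2: "norm (1 - exp (- (p w * of_real h))) \<le> 2" for w
    proof -
      have "norm (1 - exp (- (p w * of_real h))) \<le> norm (1 :: complex) + norm (exp (- (p w * of_real h)))"
        by (rule norm_triangle_ineq4)
      also have "\<dots> \<le> 1 + 1" by (intro add_mono norm_exp_p_le[OF s h]) simp
      finally show ?thesis by simp
    qed
    have qi: "integrable lborel (\<lambda>w. ?q w * a w)"
    proof (rule integrable_mult_bounded(2)[OF a])
      show "norm (?q w) \<le> 2 powr \<alpha>" for w
        unfolding norm_powr_of_real using q2 \<alpha> by (intro powr_mono2) auto
    qed measurable
    have "A1 \<sigma> \<alpha> h f x = ?r * fourier_synth (\<lambda>w. ?q w * a w) x"
      unfolding A1_def using A1_synth[OF s h, of x] by (simp add: sums_iff)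
    also have "\<dots> = (LBINT w. ?r * (?q w * a w * iexp (- (w * x))))"
      unfolding fourier_synth_def by (rule integral_mult_right_zero[symmetric])
    finally have A: "A1 \<sigma> \<alpha> h f x = (LBINT w. ?r * (?q w * a w * iexp (- (w * x))))" .
    have "G m x - A1 \<sigma> \<alpha> h f x = (LBINT w. ?d w)"
      unfolding A Gm_eq_synth[OF s] unfolding fourier_synth_def
      by (intro Bochner_Integration.integral_diff[symmetric] fourier_synth_integrable pa_integrable[OF s] integrable_mult_right qi)
    also have "norm \<dots> \<le> (LBINT w. (C * h) * norm (b w))"
    proof (rule norm_integral_le)
      show "integrable lborel (\<lambda>w. (C * h) * norm (b w))" using b by simp
      show "AE w in lborel. norm (?d w) \<le> (C * h) * norm (b w)"
        using b_eq_AE[OF s]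
      proof eventually_elim
        case (elim w)
        have nb: "norm (b w) = norm (p w) powr (\<alpha> + 1) * norm (a w)"
          using elim norm_powr_of_real[of "p w" "\<alpha> + 1"] by (simp only: norm_mult)
        have "(p w * of_real h) powr \<alpha> = p w powr \<alpha> * complex_of_real (h powr \<alpha>)"
          using powr_times_real_left[of "complex_of_real h" "p w" "complex_of_real \<alpha>"] h powr_of_real[of h \<alpha>] by (simp add: mult.commute)
        then have "p w powr \<alpha> = ?r * (p w * of_real h) powr \<alpha>"
          using h by simp
        then have "?d w = - (?r * (?q w - (p w * of_real h) powr \<alpha>) * a w * iexp (- (w * x)))"
          by (simp add: algebra_simps)
        then have "norm (?d w) = norm ?r * norm (?q w - (p w * of_real h) powr \<alpha>) * norm (a w)"
          by (simp only: norm_minus_cancel norm_mult) simp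
        also have "\<dots> \<le> norm ?r * (C * norm (p w * of_real h) powr (\<alpha> + 1)) * norm (a w)"
        proof (intro mult_right_mono mult_left_mono)
          show "norm (?q w - (p w * of_real h) powr \<alpha>) \<le> C * norm (p w * of_real h) powr (\<alpha> + 1)"
            using s h by (intro C) (simp add: p_def)
        qed auto
        also have "\<dots> = (C * h) * norm (b w)"
          unfolding nb using h by (simp add: norm_mult powr_mult powr_add norm_divide)
        finally show ?case .
      qed
    qed
    also have "\<dots> = (C * Mphi) * h" by (simp add: Mphi_def)
    finally show ?thesis .
  qed
  moreover have "summable (\<lambda>k. g1 \<sigma> \<alpha> h k * f (x - real k * h))" if "h > 0" for h x
    using A1_synth[OF s that] by (rule sums_summable)
  ultimately show ?thesis by blast
qed

end

section \<open>Integer order\<close>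

text \<open>Pascal's rule, read as: an (n + 1)-fold backward difference is an n-fold difference of
  first differences.\<close>

lemma alternating_binomial_sum_Suc:
  fixes c :: "nat \<Rightarrow> 'a :: comm_ring_1"
  shows "(\<Sum>k\<le>Suc n. of_nat (Suc n choose k) * (- 1) ^ k * c k) =
         (\<Sum>k\<le>n. of_nat (n choose k) * (- 1) ^ k * (c k - c (Suc k)))"
proof -
  have "(\<Sum>k\<le>Suc n. of_nat (Suc n choose k) * (- 1) ^ k * c k) =
     c 0 + (\<Sum>k\<le>n. of_nat (Suc n choose Suc k) * (- 1) ^ Suc k * c (Suc k))"
    by (subst sum.atMost_Suc_shift) simp
  also have "(\<Sum>k\<le>n. of_nat (Suc n choose Suc k) * (- 1) ^ Suc k * c (Suc k)) =
     (\<Sum>k\<le>n. of_nat (n choose Suc k) * (- 1) ^ Suc k * c (Suc k)) - (\<Sum>k\<le>n. of_nat (n choose k) * (- 1) ^ k * c (Suc k))"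
    unfolding sum_subtractf[symmetric] by (intro sum.cong) (auto simp: algebra_simps)
  also have "c 0 + ((\<Sum>k\<le>n. of_nat (n choose Suc k) * (- 1) ^ Suc k * c (Suc k)) - (\<Sum>k\<le>n. of_nat (n choose k) * (- 1) ^ k * c (Suc k))) =
     (\<Sum>k\<le>Suc n. of_nat (n choose k) * (- 1) ^ k * c k) - (\<Sum>k\<le>n. of_nat (n choose k) * (- 1) ^ k * c (Suc k))"
    by (subst sum.atMost_Suc_shift[where n=n and g="\<lambda>k. of_nat (n choose k) * (- 1) ^ k * c k"]) simp
  also have "(\<Sum>k\<le>Suc n. of_nat (n choose k) * (- 1) ^ k * c k) = (\<Sum>k\<le>n. of_nat (n choose k) * (- 1) ^ k * c k)"
    by (simp add: binomial_eq_0)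
  finally show ?thesis by (simp add: right_diff_distrib sum_subtractf)
qed

lemma norm_diff_le_deriv_bound:
  fixes g :: "real \<Rightarrow> complex"
  assumes "\<And>y. (g has_vector_derivative g' y) (at y)" "h \<ge> 0"
    and "\<And>y. x - h \<le> y \<Longrightarrow> y \<le> x \<Longrightarrow> norm (g' y) \<le> M"
  shows "norm (g x - g (x - h)) \<le> M * h"
proof -
  have "norm (g x - g (x - h)) \<le> M * norm (x - (x - h))"
  proof (rule differentiable_bound[where S="{x - h..x}"])
    fix y assume y: "y \<in> {x - h..x}"
    show "(g has_derivative (\<lambda>t. t *\<^sub>R g' y)) (at y within {x - h..x})"
      using has_vector_derivative_at_within[OF assms(1)] by (simp add: has_vector_derivative_def)
    show "onorm (\<lambda>t. t *\<^sub>R g' y) \<le> M"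
    proof (rule onorm_le)
      fix t :: real
      show "norm (t *\<^sub>R g' y) \<le> M * norm t"
        using mult_left_mono[OF assms(3)[of y], of "\<bar>t\<bar>"] y by (simp add: mult.commute)
    qed
  qed (use assms in auto)
  then show ?thesis using assms(2) by simp
qed

text \<open>Induction through the divided difference \<open>V\<close> of the chain: its top
  derivative is again bounded by \<open>M\<close>, by the mean value theorem, and replacing
  \<open>W (Suc n) x\<close> by \<open>V n x\<close> costs h M. Hence n steps cost n h M.\<close>

lemma finite_difference_error:
  fixes W :: "nat \<Rightarrow> real \<Rightarrow> complex"
  assumes h: "h > 0"
    and W: "\<And>k y. k \<le> n \<Longrightarrow> (W k has_vector_derivative W (Suc k) y) (at y)"
    and M: "\<And>y. x - real n * h \<le> y \<Longrightarrow> y \<le> x \<Longrightarrow> norm (W (Suc n) y) \<le> M"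
  shows "norm (W n x - (\<Sum>k\<le>n. of_nat (n choose k) * (- 1) ^ k * W 0 (x - real k * h)) / of_real (h ^ n)) \<le> real n * h * M"
  using W M
proof (induction n arbitrary: W)
  case 0
  then show ?case by simp
next
  case (Suc n)
  define V where "V k y = (W k y - W k (y - h)) / of_real h" for k y
  have sh: "((\<lambda>y. W k (y - h)) has_vector_derivative W (Suc k) (y - h)) (at y)" if "k \<le> Suc n" for k y
  proof -
    have "((\<lambda>y. W k (y - h)) has_vector_derivative 1 *\<^sub>R W (Suc k) (y - h)) (at y)"
      by (rule vector_diff_chain_at[of "\<lambda>y. y - h" 1 y "W k", unfolded o_def])
         (use that in \<open>auto intro!: derivative_eq_intros Suc.prems\<close>)
    then show ?thesis by simp
  qed
  have V: "(V k has_vector_derivative V (Suc k) y) (at y)" if "k \<le> Suc n" for k y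
    unfolding V_def[abs_def] using that
    by (intro has_vector_derivative_divide has_vector_derivative_diff sh Suc.prems) auto
  have "norm (V n x - (\<Sum>k\<le>n. of_nat (n choose k) * (- 1) ^ k * V 0 (x - real k * h)) / of_real (h ^ n)) \<le> real n * h * M"
  proof (rule Suc.IH)
    show "(V k has_vector_derivative V (Suc k) y) (at y)" if "k \<le> n" for k y
      using that V by simp
    fix y assume y: "x - real n * h \<le> y" "y \<le> x"
    have "norm (W (Suc n) y - W (Suc n) (y - h)) \<le> M * h"
      using h y by (intro norm_diff_le_deriv_bound[of _ "W (Suc (Suc n))"] Suc.prems) (auto simp: algebra_simps)
    then show "norm (V (Suc n) y) \<le> M"
      using h by (simp add: V_def norm_divide divide_le_eq)
  qed
  moreover have "(\<Sum>k\<le>n. of_nat (n choose k) * (- 1) ^ k * V 0 (x - real k * h)) / of_real (h ^ n) =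
     (\<Sum>k\<le>Suc n. of_nat (Suc n choose k) * (- 1) ^ k * W 0 (x - real k * h)) / of_real (h ^ Suc n)"
  proof -
    have "(\<Sum>k\<le>Suc n. of_nat (Suc n choose k) * (- 1) ^ k * W 0 (x - real k * h)) =
      (\<Sum>k\<le>n. of_nat (n choose k) * (- 1) ^ k * (W 0 (x - real k * h) - W 0 (x - real (Suc k) * h)))"
      by (rule alternating_binomial_sum_Suc)
    also have "\<dots> = (\<Sum>k\<le>n. of_nat (n choose k) * (- 1) ^ k * V 0 (x - real k * h)) * of_real h"
    proof -
      have "V 0 (x - real k * h) * of_real h = W 0 (x - real k * h) - W 0 (x - real (Suc k) * h)" for k
      proof -
        have "x - real (Suc k) * h = x - real k * h - h" by (simp add: algebra_simps)
        then show ?thesis using h by (simp only: V_def) simp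
      qed
      then show ?thesis
        by (simp only: sum_distrib_right mult.assoc)
    qed
    finally show ?thesis using h by simp
  qed
  moreover have "norm (W (Suc n) x - V n x) \<le> h * M"
  proof -
    \<comment> \<open>With the linear part removed, the derivative of \<open>g\<close> is
      \<open>W (Suc n) y - W (Suc n) x\<close>, itself at most M h on the step; the increment of
      \<open>g\<close> is then quadratic in h.\<close>
    define g where "g y = W n y - y *\<^sub>R W (Suc n) x" for y
    have "norm (g x - g (x - h)) \<le> (M * h) * h"
    proof (rule norm_diff_le_deriv_bound)
      show "(g has_vector_derivative (W (Suc n) y - W (Suc n) x)) (at y)" for y
        unfolding g_def by (auto intro!: derivative_eq_intros Suc.prems)
      fix y assume y: "x - h \<le> y" "y \<le> x"
      have "x - real (Suc n) * h \<le> x - h" using h by (simp add: algebra_simps)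
      then have "norm (W (Suc n) x - W (Suc n) (x - (x - y))) \<le> M * (x - y)"
        using y h by (intro norm_diff_le_deriv_bound[of _ "W (Suc (Suc n))"] Suc.prems) linarith+
      also have "\<dots> \<le> M * h"
        using y h Suc.prems(2)[of x] order_trans[OF norm_ge_zero Suc.prems(2)[of x]] by (intro mult_left_mono) auto
      finally show "norm (W (Suc n) y - W (Suc n) x) \<le> M * h"
        by (simp add: norm_minus_commute)
    qed (use h in auto)
    moreover have "W (Suc n) x - V n x = - ((g x - g (x - h)) / of_real h)"
      using h by (simp add: g_def V_def field_simps scaleR_conv_of_real)
    ultimately show ?thesis
      using h by (simp add: norm_divide divide_le_eq mult_ac)
  qed
  ultimately have "norm ((W (Suc n) x - V n x) + (V n x - (\<Sum>k\<le>Suc n. of_nat (Suc n choose k) * (- 1) ^ k * W 0 (x - real k * h)) / of_real (h ^ Suc n))) \<le> h * M + real n * h * M"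
    by (intro norm_triangle_le add_mono) auto
  then show ?case by (simp add: algebra_simps)
qed

context subst_core
begin

lemma F_cont: "continuous_on UNIV F"
  unfolding F_def[abs_def] by (intro continuous_intros f_cont)

text \<open>The binomial coefficients vanish beyond n, so the series is a finite backward difference
  of F, and \<open>finite_difference_error\<close> applies to the chain U 1 = F, U 2, ...\<close>

theorem order_estimate_nat:
  assumes \<alpha>n: "\<alpha> = real n"
  shows "\<exists>C. \<forall>h. 0 < h \<and> h < 1 \<longrightarrow> (\<forall>x. summable (\<lambda>k. g1 \<sigma> \<alpha> h k * f (x - real k * h)) \<and>
           norm (G m x - A1 \<sigma> \<alpha> h f x) \<le> C * h)"
proof -
  \<comment> \<open>The integer exceeding \<alpha> strictly is n + 1, not n: the fractional integral
    is then an ordinary one, and its first derivative returns F.\<close>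
  have m: "m = Suc n" and \<nu>1: "\<nu> = 1"
  proof -
    have "real m - real n > 0" "real m - real n \<le> 1" using \<nu> \<nu>_eq \<alpha>n by auto
    then show "m = Suc n" by linarith
    then show "\<nu> = 1" using \<nu>_eq \<alpha>n by simp
  qed
  have U0_int: "U 0 x = (LBINT t:{..x}. F t)" and F_set_int: "set_integrable lborel {..x} F" for x
  proof -
    have ae: "AE t in lborel. complex_of_real (frac_kernel \<nu> (x - t)) * F t = indicator {..x} t *\<^sub>R F t"
      using AE_lborel_singleton[of x] by eventually_elim (auto simp: frac_kernel_def \<nu>1 indicator_def)
    show "U 0 x = (LBINT t:{..x}. F t)"
      unfolding U0 set_lebesgue_integral_def using integral_cong_AE[OF _ _ ae] by (simp add: \<nu>1)
    show "set_integrable lborel {..x} F"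
      unfolding set_integrable_def using integrable_cong_AE[OF _ _ ae] frac_F_integrable[of x] by simp
  qed
  have U1: "U 1 = F"
  proof
    fix x
    have "(U 0 has_vector_derivative F x) (at x)"
      using has_vector_derivative_integral_atMost[OF F_cont F_set_int, of x] by (simp add: U0_int[abs_def])
    then show "U 1 x = F x"
      using U_deriv[of 0 x] vector_derivative_unique_at by force
  qed
  \<comment> \<open>For h < 1 the weight exp(Re \<sigma> y) on [x - n h, x] is at most exp(|Re
    \<sigma>| n) times its value at x; the latter cancels on returning from U to G.\<close>
  define C where "C = real n * (Mphi * exp (\<bar>Re \<sigma>\<bar> * real n))"
  have fin: "(\<lambda>k. g1 \<sigma> \<alpha> h k * f (x - real k * h)) sums (\<Sum>k\<le>n. g1 \<sigma> \<alpha> h k * f (x - real k * h))" for h x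
  proof (rule sums_finite)
    fix k assume "k \<notin> {..n}"
    then have "(complex_of_real \<alpha> gchoose k) = 0"
      by (simp add: \<alpha>n flip: binomial_gbinomial)
    then show "g1 \<sigma> \<alpha> h k * f (x - real k * h) = 0"
      by (simp add: g1_eq_gchoose)
  qed simp
  have "norm (G m x - A1 \<sigma> \<alpha> h f x) \<le> C * h" if h: "0 < h" "h < 1" for h x
  proof -
    have A: "exp (\<sigma> * x) * A1 \<sigma> \<alpha> h f x = (\<Sum>k\<le>n. of_nat (n choose k) * (- 1) ^ k * F (x - real k * h)) / of_real (h ^ n)"
    proof -
      have "exp (\<sigma> * x) * (g1 \<sigma> \<alpha> h k * f (x - real k * h)) = of_nat (n choose k) * (- 1) ^ k * F (x - real k * h)" for k
      proof -
        have "exp (\<sigma> * x) * exp (- \<sigma> * complex_of_real h) ^ k = exp (\<sigma> * complex_of_real (x - real k * h))"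
          by (simp add: algebra_simps flip: exp_add exp_of_nat_mult)
        then have "exp (\<sigma> * x) * (- exp (- \<sigma> * complex_of_real h)) ^ k = (- 1) ^ k * exp (\<sigma> * complex_of_real (x - real k * h))"
          by (simp only: power_minus[of "exp _"] mult.left_commute)
        moreover have "(complex_of_real \<alpha> gchoose k) = of_nat (n choose k)"
          by (simp add: \<alpha>n flip: binomial_gbinomial)
        moreover have "exp (\<sigma> * x) * (g1 \<sigma> \<alpha> h k * f (x - real k * h)) = (complex_of_real \<alpha> gchoose k) * (exp (\<sigma> * x) * (- exp (- \<sigma> * complex_of_real h)) ^ k) * f (x - real k * h)"
          by (simp only: g1_eq_gchoose mult_ac)
        ultimately show ?thesis
          by (simp only: F_def mult.assoc)
      qed
      then have "exp (\<sigma> * x) * (\<Sum>k\<le>n. g1 \<sigma> \<alpha> h k * f (x - real k * h)) = (\<Sum>k\<le>n. of_nat (n choose k) * (- 1) ^ k * F (x - real k * h))"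
        by (simp only: sum_distrib_left)
      moreover have "h powr \<alpha> = h ^ n" using h by (simp add: \<alpha>n powr_realpow)
      ultimately show ?thesis
        using sums_unique[OF fin[of h x]] by (simp add: A1_def)
    qed
    have "norm (U m x - exp (\<sigma> * x) * A1 \<sigma> \<alpha> h f x) \<le> real n * h * (Mphi * exp (\<bar>Re \<sigma>\<bar> * real n) * exp (Re \<sigma> * x))"
      unfolding A m U1[symmetric] One_nat_def
    proof (rule finite_difference_error[where W="\<lambda>k. U (Suc k)"])
      show "0 < h" by fact
      show "(U (Suc k) has_vector_derivative U (Suc (Suc k)) y) (at y)" if "k \<le> n" for k y
        using that by (intro U_deriv) (simp add: m)
      fix y assume y: "x - real n * h \<le> y" "y \<le> x"
      have "Re \<sigma> * y \<le> \<bar>Re \<sigma>\<bar> * real n + Re \<sigma> * x"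
      proof -
        have "x - y \<le> real n * 1" using y(1) h mult_left_mono[of h 1 "real n"] by linarith
        then have "\<bar>Re \<sigma>\<bar> * (x - y) \<le> \<bar>Re \<sigma>\<bar> * real n" by (intro mult_left_mono) auto
        moreover have "- Re \<sigma> * (x - y) \<le> \<bar>Re \<sigma>\<bar> * (x - y)" using y by (intro mult_right_mono) auto
        ultimately show ?thesis by (simp add: algebra_simps)
      qed
      then have e: "exp (Re \<sigma> * y) \<le> exp (\<bar>Re \<sigma>\<bar> * real n) * exp (Re \<sigma> * x)"
        by (simp flip: exp_add)
      have M0: "0 \<le> Mphi" using order_trans[OF norm_ge_zero phi_bound[of y]] .
      have "norm (U (Suc (Suc n)) y) \<le> exp (Re \<sigma> * y) * Mphi"
        using phi_bound[of y] by (simp add: U_def norm_mult m)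
      also have "\<dots> \<le> (exp (\<bar>Re \<sigma>\<bar> * real n) * exp (Re \<sigma> * x)) * Mphi"
        by (rule mult_right_mono[OF e M0])
      finally show "norm (U (Suc (Suc n)) y) \<le> Mphi * exp (\<bar>Re \<sigma>\<bar> * real n) * exp (Re \<sigma> * x)"
        by (simp only: mult_ac)
    qed
    moreover have "G m x - A1 \<sigma> \<alpha> h f x = exp (- \<sigma> * x) * (U m x - exp (\<sigma> * x) * A1 \<sigma> \<alpha> h f x)"
      by (simp add: U_def exp_minus flip: right_diff_distrib)
    ultimately have "norm (G m x - A1 \<sigma> \<alpha> h f x) \<le> exp (- Re \<sigma> * x) * (real n * h * (Mphi * exp (\<bar>Re \<sigma>\<bar> * real n) * exp (Re \<sigma> * x)))"
      by (simp add: norm_mult mult_left_mono)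
    also have "\<dots> = C * h"
      by (simp add: C_def exp_minus)
    finally show ?thesis .
  qed
  moreover have "summable (\<lambda>k. g1 \<sigma> \<alpha> h k * f (x - real k * h))" for h x
    using fin[of h x] by (rule sums_summable)
  ultimately show ?thesis by (intro exI[of _ C]) simp
qed

end

section \<open>Negative real part of the damping, non-integer order\<close>

text \<open>The bound on the derivative has tail integral C / r exp(- r x), so \<open>g\<close> is
  Cauchy at infinity and approaches its limit at this rate.\<close>

lemma exp_decay_limit:
  fixes g :: "real \<Rightarrow> complex"
  assumes g: "\<And>y. (g has_vector_derivative g' y) (at y)" and r: "r > 0"
    and bound: "\<And>y. y \<ge> 0 \<Longrightarrow> norm (g' y) \<le> C * exp (- r * y)"
  shows "\<exists>L. \<forall>x\<ge>0. norm (g x - L) \<le> C / r * exp (- r * x)"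
proof -
  have C0: "C \<ge> 0" using order_trans[OF norm_ge_zero bound[of 0]] by simp
  have diff: "norm (g y - g x) \<le> C / r * exp (- r * x)" if "0 \<le> x" "x \<le> y" for x y
  proof (cases "x = y")
    case True
    then show ?thesis using C0 r by simp
  next
    case False
    have "norm (g y - g x) \<le> - (C / r * exp (- r * y)) - (- (C / r * exp (- r * x)))"
    proof (rule differentiable_bound_general[where \<phi>="\<lambda>y. - (C / r * exp (- r * y))" and \<phi>'="\<lambda>y. C * exp (- r * y)" and f'=g'])
      show "x < y" using that False by simp
      show "continuous_on {x..y} g"
        using g by (intro continuous_at_imp_continuous_on) (auto intro: has_vector_derivative_continuous)
      show "((\<lambda>y. - (C / r * exp (- r * y))) has_vector_derivative C * exp (- r * z)) (at z)" for z
        using r by (auto intro!: derivative_eq_intros simp: has_real_derivative_iff_has_vector_derivative[symmetric])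
      show "norm (g' z) \<le> C * exp (- r * z)" if "x < z" "z < y" for z
        using that \<open>0 \<le> x\<close> by (intro bound) simp
    qed (use r in \<open>auto intro!: continuous_intros g\<close>)
    also have "\<dots> \<le> C / r * exp (- r * x)" using C0 r by simp
    finally show ?thesis .
  qed
  have elim: "((\<lambda>x. C / r * exp (- r * x)) \<longlongrightarrow> C / r * 0) at_top"
    using r by (intro tendsto_mult tendsto_const) real_asymp
  have "Cauchy (\<lambda>n. g (real n))"
  proof (rule metric_CauchyI)
    fix e :: real assume "e > 0"
    then have "\<forall>\<^sub>F x in at_top. C / r * exp (- r * x) < e / 2"
      using order_tendstoD(2)[OF elim, of "e / 2"] by simp
    then obtain N where N: "\<And>x. x \<ge> N \<Longrightarrow> C / r * exp (- r * x) < e / 2"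
      by (auto simp: eventually_at_top_linorder)
    obtain M where M: "real M \<ge> N" using real_arch_simple by blast
    have half: "norm (g (real k) - g (real M)) < e / 2" if "k \<ge> M" for k
      by (rule order_le_less_trans[OF diff N[OF M]]) (use that in auto)
    have "dist (g (real m)) (g (real n)) < e" if "m \<ge> M" "n \<ge> M" for m n
      using norm_triangle_ineq4[of "g (real m) - g (real M)" "g (real n) - g (real M)"] half[OF that(1)] half[OF that(2)]
      by (simp add: dist_norm)
    then show "\<exists>M. \<forall>m\<ge>M. \<forall>n\<ge>M. dist (g (real m)) (g (real n)) < e"
      by (intro exI[of _ M]) simp
  qed
  then obtain L where L: "(\<lambda>n. g (real n)) \<longlonglongrightarrow> L"
    using Cauchy_convergent[of "\<lambda>n. g (real n)"] by (auto simp: convergent_def)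
  have "norm (g x - L) \<le> C / r * exp (- r * x)" if x: "x \<ge> 0" for x
  proof (rule tendsto_upperbound)
    show "(\<lambda>n. norm (g x - g (real n))) \<longlonglongrightarrow> norm (g x - L)"
      by (intro tendsto_intros L)
    obtain M where "real M \<ge> x" using real_arch_simple by blast
    then show "\<forall>\<^sub>F n in sequentially. norm (g x - g (real n)) \<le> C / r * exp (- r * x)"
      using x diff[of x] by (intro eventually_sequentiallyI[of M]) (auto simp: norm_minus_commute[of "g x"])
  qed simp
  then show ?thesis by blast
qed

text \<open>
  Inversion of the Laplace transform \<open>H\<close> of \<open>h\<close>: for large \<open>n\<close> the series
  \<open>\<Sum>k\<ge>1. (- 1)\<^bsup>k+1\<^esup> e\<^bsup>kna\<^esup> H(kn) / k! = \<integral> h(l) (1 - exp (- e\<^bsup>n(a-l)\<^esup>)) dl\<close> approximates \<open>\<integral>\<^bsub>l\<le>a\<^esub> h\<close>, and the decay of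
  \<open>H\<close> makes it tend to \<open>0\<close>.
\<close>

lemma laplace_decay_imp_integral_eq_0:
  fixes h :: "real \<Rightarrow> complex"
  assumes h: "integrable lborel h" and h0: "\<And>l. l < 0 \<Longrightarrow> h l = 0"
    and bound: "\<And>x. x \<ge> 0 \<Longrightarrow> norm (LBINT l. h l * exp (- (of_real x * of_real l))) \<le> C * exp (- r * x)"
    and a: "0 < a" "a < r"
  shows "(LBINT l:{..a}. h l) = 0"
proof -
  define H where "H x = (LBINT l. h l * exp (- (of_real x * of_real l)))" for x :: real
  define y where "y n l = exp (real n * (a - l))" for n and l :: real
  have [measurable]: "h \<in> borel_measurable borel" using h by auto
  have y0: "y n l > 0" for n l by (simp add: y_def)
  have ymeas[measurable]: "y n \<in> borel_measurable borel" for n unfolding y_def by measurable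
  let ?c = "\<lambda>n k. complex_of_real ((- exp (real n * a)) ^ Suc k / fact (Suc k)) * H (real n * real (Suc k))"
  let ?h = "\<lambda>n l. h l * complex_of_real (exp (- y n l))"
  have ser: "(LBINT l. ?h n l) = H 0 + (\<Sum>k. ?c n k)"
    and ser_bound: "norm (\<Sum>k. ?c n k) \<le> C * (exp (exp (- real n * (r - a))) - 1)"
    for n
  proof -
    define u where "u k l = h l * complex_of_real ((- y n l) ^ k / fact k)" for k l
    define c where "c k = complex_of_real ((- exp (real n * a)) ^ k / fact k) * H (real n * real k)" for k
    have ub: "norm (u k l) \<le> norm (h l) * (exp (real n * a) ^ k / fact k)" for k l
    proof (cases "l < 0")
      case False
      then have "y n l \<le> exp (real n * a)" unfolding y_def by (simp add: mult_left_mono)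
      then have "y n l ^ k \<le> exp (real n * a) ^ k" using y0[of n l] by (intro power_mono) auto
      then show ?thesis
        using y0[of n l] unfolding u_def norm_mult norm_of_real abs_divide power_abs abs_minus_cancel
        by (intro mult_left_mono) (auto intro!: divide_right_mono)
    qed (simp add: u_def h0)
    have ui: "integrable lborel (u k)" for k
      by (rule Bochner_Integration.integrable_bound[of lborel "\<lambda>l. norm (h l) * (exp (real n * a) ^ k / fact k)"])
         (use h ub in \<open>auto simp: u_def[abs_def]\<close>)
    have sums_exp: "(\<lambda>k. z ^ k / fact k) sums exp z" for z :: real
      using exp_converges[of z] by (simp add: divide_inverse mult.commute)
    have sI: "summable (\<lambda>k. LBINT l. norm (u k l))"
    proof (rule summable_comparison_test, intro exI allI impI)
      show "summable (\<lambda>k. (LBINT l. norm (h l)) * (exp (real n * a) ^ k / fact k))"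
        by (intro summable_mult sums_summable[OF sums_exp])
      fix k
      have "(LBINT l. norm (u k l)) \<le> (LBINT l. norm (h l) * (exp (real n * a) ^ k / fact k))"
        using ui h ub by (intro integral_mono integrable_norm integrable_mult_left) auto
      then show "norm (LBINT l. norm (u k l)) \<le> (LBINT l. norm (h l)) * (exp (real n * a) ^ k / fact k)"
        by simp
    qed
    have usum: "(\<lambda>k. u k l) sums (?h n l)" for l
      unfolding u_def by (intro sums_mult sums_of_real sums_exp)
    have uabs: "summable (\<lambda>k. norm (u k l))" for l
      by (rule summable_comparison_test[OF _ summable_mult[OF sums_summable[OF sums_exp[of "exp (real n * a)"]], of "norm (h l)"]])
         (use ub in auto)
    have "(\<lambda>k. LBINT l. u k l) sums (LBINT l. (\<Sum>k. u k l))"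
      by (rule sums_integral[OF ui _ sI]) (use uabs in auto)
    moreover have "(\<Sum>k. u k l) = ?h n l" for l
      using usum[of l] by (simp add: sums_iff)
    moreover have "(LBINT l. u k l) = c k" for k
    proof -
      have "complex_of_real ((- y n l) ^ k / fact k) = complex_of_real ((- exp (real n * a)) ^ k / fact k) * exp (- (of_real (real n * real k) * of_real l))" for l
      proof -
        have "y n l ^ k = exp (real n * a) ^ k * exp (- (real n * real k * l))"
          by (simp add: y_def algebra_simps flip: exp_of_nat_mult exp_add)
        then have "(- y n l) ^ k / fact k = ((- exp (real n * a)) ^ k / fact k) * exp (- (real n * real k * l))"
          by (simp add: power_minus[of "y n l"] power_minus[of "exp _"])
        then show ?thesis by (simp only: of_real_mult exp_of_real[symmetric] of_real_minus)
      qed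
      then have "u k l = complex_of_real ((- exp (real n * a)) ^ k / fact k) * (h l * exp (- (of_real (real n * real k) * of_real l)))" for l
        by (simp only: u_def mult_ac)
      then show ?thesis
        by (simp only: c_def H_def integral_mult_right_zero)
    qed
    ultimately have cs: "c sums (LBINT l. ?h n l)" by simp
    then show "(LBINT l. ?h n l) = H 0 + (\<Sum>k. ?c n k)"
      using suminf_split_head[OF sums_summable[OF cs]] sums_unique[OF cs] by (simp add: c_def)
    \<comment> \<open>The k-th coefficient grows like exp(n a k), while the transform at n k decays
      like exp(- r n k); as a < r, the product is z ^ k with z tending to 0 as n grows.\<close>
    define z where "z = exp (- real n * (r - a))"
    have cb: "norm (c k) \<le> C * (z ^ k / fact k)" for k
    proof -
      have "norm (c k) = exp (real n * a) ^ k / fact k * norm (H (real n * real k))"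
        by (simp add: c_def norm_mult norm_divide norm_power)
      also have "\<dots> \<le> exp (real n * a) ^ k / fact k * (C * exp (- r * (real n * real k)))"
        unfolding H_def by (intro mult_left_mono bound) auto
      also have "\<dots> = C * ((exp (real n * a) ^ k * exp (- r * (real n * real k))) / fact k)"
        by simp
      also have "exp (real n * a) ^ k * exp (- r * (real n * real k)) = z ^ k"
        by (simp add: z_def algebra_simps flip: exp_of_nat_mult exp_add)
      finally show ?thesis .
    qed
    have zs: "(\<lambda>k. C * (z ^ Suc k / fact (Suc k))) sums (C * (exp z - 1))"
      using sums_Suc_imp[of "\<lambda>k. z ^ k / fact k" "exp z - 1"] sums_split_initial_segment[OF sums_exp[of z], of 1]
      by (intro sums_mult) simp
    have "norm (\<Sum>k. c (Suc k)) \<le> (\<Sum>k. C * (z ^ Suc k / fact (Suc k)))"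
      by (rule norm_suminf_le[OF cb sums_summable[OF zs]])
    also have "\<dots> = C * (exp z - 1)" using sums_unique[OF zs] by simp
    finally show "norm (\<Sum>k. ?c n k) \<le> C * (exp (exp (- real n * (r - a))) - 1)"
      unfolding c_def z_def .
  qed
  have "(\<lambda>n. \<Sum>k. ?c n k) \<longlonglongrightarrow> 0"
  proof (rule Lim_null_comparison)
    show "\<forall>\<^sub>F n in sequentially. norm (\<Sum>k. ?c n k) \<le> C * (exp (exp (- real n * (r - a))) - 1)"
      using ser_bound by simp
    have "(\<lambda>n. exp (- real n * (r - a))) \<longlonglongrightarrow> 0"
      using a by real_asymp
    then have "(\<lambda>n. C * (exp (exp (- real n * (r - a))) - 1)) \<longlonglongrightarrow> C * (exp 0 - 1)"
      by (intro tendsto_intros)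
    then show "(\<lambda>n. C * (exp (exp (- real n * (r - a))) - 1)) \<longlonglongrightarrow> 0" by simp
  qed
  then have "(\<lambda>n. H 0 + (\<Sum>k. ?c n k)) \<longlonglongrightarrow> H 0 + 0"
    by (intro tendsto_intros)
  then have l1: "(\<lambda>n. LBINT l. ?h n l) \<longlonglongrightarrow> (LBINT l. h l)"
    unfolding ser by (simp add: H_def)
  \<comment> \<open>exp(- y n l) is a smoothed step: \<open>y n l\<close> tends to 0 for l > a and
    to infinity for l < a. Together with \<open>l1\<close>, this equates the full integral with the
    one over l > a.\<close>
  have l2: "(\<lambda>n. LBINT l. ?h n l) \<longlonglongrightarrow> (LBINT l. indicator {a<..} l *\<^sub>R h l)"
  proof (rule integral_dominated_convergence)
    show "integrable lborel (\<lambda>l. norm (h l))" using h by simp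
    show "AE l in lborel. norm (?h n l) \<le> norm (h l)" for n
      using y0 by (intro AE_I2) (simp add: norm_mult mult_left_le less_imp_le)
    have "(\<lambda>n. exp (- y n l)) \<longlonglongrightarrow> indicator {a<..} l" if "l \<noteq> a" for l
    proof (cases "l > a")
      case True
      then have "(\<lambda>n. exp (- exp (real n * (a - l)))) \<longlonglongrightarrow> 1" by real_asymp
      then show ?thesis using True by (simp add: y_def)
    next
      case False
      then have "l < a" using that by simp
      then have "(\<lambda>n. exp (- exp (real n * (a - l)))) \<longlonglongrightarrow> 0" by real_asymp
      then show ?thesis using False by (simp add: y_def)
    qed
    then have "(\<lambda>n. ?h n l) \<longlonglongrightarrow> indicator {a<..} l *\<^sub>R h l" if "l \<noteq> a" for l
      using that unfolding scaleR_conv_of_real mult.commute[of _ "h l"] by (intro tendsto_intros) auto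
    then show "AE l in lborel. (\<lambda>n. ?h n l) \<longlonglongrightarrow> indicator {a<..} l *\<^sub>R h l"
      using AE_lborel_singleton[of a] by auto
  qed auto
  have "(LBINT l. h l) = (LBINT l. indicator {a<..} l *\<^sub>R h l)"
    using LIMSEQ_unique[OF l1 l2] .
  moreover have "(LBINT l. indicator {..a} l *\<^sub>R h l) = (LBINT l. h l - indicator {a<..} l *\<^sub>R h l)"
    by (intro Bochner_Integration.integral_cong) (auto simp: indicator_def)
  moreover have "\<dots> = (LBINT l. h l) - (LBINT l. indicator {a<..} l *\<^sub>R h l)"
    using h by (intro Bochner_Integration.integral_diff integrable_mult_indicator) auto
  ultimately show ?thesis by (simp add: set_lebesgue_integral_def)
qed

text \<open>\<open>\<Gamma>(1 - \<nu>) t\<^bsup>\<nu>-1\<^esup> = \<integral> l\<^bsup>-\<nu>\<^esup> e\<^bsup>-tl\<^esup> dl\<close> over \<open>l > 0\<close>; the truncated kernel keeps only \<open>l \<le> r\<close>.\<close>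

definition trunc_kernel :: "real \<Rightarrow> real \<Rightarrow> real \<Rightarrow> real" where
  "trunc_kernel \<nu> r t = (LBINT l. indicator {..r} l * frac_kernel (1 - \<nu>) l * exp (- (t * l)))"

lemma trunc_kernel_integrable:
  assumes "\<nu> < 1" "r > 0"
  shows "integrable lborel (\<lambda>l. indicator {..r} l * frac_kernel (1 - \<nu>) l * exp (- (t * l)))"
proof (rule Bochner_Integration.integrable_bound)
  let ?k = "\<lambda>l. indicator {..r} l * frac_kernel (1 - \<nu>) l"
  show "integrable lborel (\<lambda>l. exp (\<bar>t\<bar> * r) * (?k l))"
    using frac_kernel_has_integral[of "1 - \<nu>" r] assms by (intro integrable_mult_right) (auto simp: has_bochner_integral_iff)
  show "AE l in lborel. norm (?k l * exp (- (t * l))) \<le> norm (exp (\<bar>t\<bar> * r) * (?k l))"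
  proof (rule AE_I2)
    fix l :: real
    consider "l < 0" | "l > r" | "0 \<le> l" "l \<le> r" by linarith
    then show "norm (?k l * exp (- (t * l))) \<le> norm (exp (\<bar>t\<bar> * r) * (?k l))"
    proof cases
      case 3
      have "- (t * l) \<le> \<bar>t\<bar> * l" using 3 by (metis abs_ge_minus_self minus_mult_left mult_right_mono)
      also have "\<dots> \<le> \<bar>t\<bar> * r" using 3 by (intro mult_left_mono) auto
      finally show ?thesis using 3 by (simp add: mult_left_mono mult.commute)
    qed (auto simp: frac_kernel_neg)
  qed
qed auto

text \<open>For t > 0 the omitted part l > r is shifted to l - r, which extracts exp(- r t) and
  leaves at most the full integral. For t \<le> 0 the fractional kernel is 0, and the truncated
  integral is bounded by exp(- r t) times the integral of l powr (- \<nu>) up to r.\<close>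

lemma trunc_kernel_approx:
  assumes \<nu>: "0 < \<nu>" "\<nu> < 1" and r: "r > 0"
  shows "\<bar>trunc_kernel \<nu> r t - Gamma (1 - \<nu>) * frac_kernel \<nu> t\<bar> \<le> exp (- (r * t)) * (Gamma (1 - \<nu>) * frac_kernel \<nu> t + r powr (1 - \<nu>) / (1 - \<nu>))"
proof (cases "t > 0")
  case True
  let ?g = "\<lambda>l. frac_kernel (1 - \<nu>) l * exp (- (t * l))"
  have full: "has_bochner_integral lborel ?g (Gamma (1 - \<nu>) * frac_kernel \<nu> t)"
    using powr_exp_has_integral_real[of "1 - \<nu>" t] \<nu> True by (simp add: frac_kernel_def)
  have gi: "integrable lborel ?g" and gI: "(LBINT l. ?g l) = Gamma (1 - \<nu>) * frac_kernel \<nu> t"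
    using full by (auto simp: has_bochner_integral_iff)
  have eq: "Gamma (1 - \<nu>) * frac_kernel \<nu> t - trunc_kernel \<nu> r t = (LBINT l. ?g l - indicator {..r} l * frac_kernel (1 - \<nu>) l * exp (- (t * l)))"
    unfolding gI[symmetric] trunc_kernel_def
    by (rule Bochner_Integration.integral_diff[OF gi trunc_kernel_integrable[OF \<nu>(2) r], symmetric])
  have "norm (Gamma (1 - \<nu>) * frac_kernel \<nu> t - trunc_kernel \<nu> r t) \<le> (LBINT l. exp (- (r * t)) * ?g (l - r))"
    unfolding eq
  proof (rule norm_integral_le)
    show "integrable lborel (\<lambda>l. exp (- (r * t)) * ?g (l - r))"
      using gi lborel_integrable_shift_iff[of ?g r] by (intro integrable_mult_right) simp
    show "AE l in lborel. norm (?g l - indicator {..r} l * frac_kernel (1 - \<nu>) l * exp (- (t * l))) \<le> exp (- (r * t)) * ?g (l - r)"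
    proof (rule AE_I2)
      fix l :: real
      show "norm (?g l - indicator {..r} l * frac_kernel (1 - \<nu>) l * exp (- (t * l))) \<le> exp (- (r * t)) * ?g (l - r)"
      proof (cases "l > r")
        case l: True
        have "l powr (- \<nu>) \<le> (l - r) powr (- \<nu>)"
          using \<nu> r l by (intro powr_mono2') auto
        then have e1: "frac_kernel (1 - \<nu>) l \<le> frac_kernel (1 - \<nu>) (l - r)"
          using r l by (simp add: frac_kernel_def)
        have e2: "exp (- (r * t)) * exp (- (t * (l - r))) = exp (- (t * l))"
          by (simp add: algebra_simps flip: exp_add)
        have "norm (?g l - indicator {..r} l * frac_kernel (1 - \<nu>) l * exp (- (t * l))) = frac_kernel (1 - \<nu>) l * exp (- (t * l))"
          using l by simp
        also have "\<dots> \<le> frac_kernel (1 - \<nu>) (l - r) * exp (- (t * l))"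
          by (rule mult_right_mono[OF e1]) simp
        also have "\<dots> = exp (- (r * t)) * ?g (l - r)"
          unfolding e2[symmetric] by (simp only: mult_ac)
        finally show ?thesis .
      next
        case False
        then have "norm (?g l - indicator {..r} l * frac_kernel (1 - \<nu>) l * exp (- (t * l))) = 0" by simp
        also have "0 \<le> exp (- (r * t)) * ?g (l - r)" by (intro mult_nonneg_nonneg) simp_all
        finally show ?thesis .
      qed
    qed
  qed
  also have "(LBINT l. exp (- (r * t)) * ?g (l - r)) = exp (- (r * t)) * (Gamma (1 - \<nu>) * frac_kernel \<nu> t)"
    using lborel_integral_shift[of ?g r] gI by (subst integral_mult_right_zero) simp
  also have "\<dots> \<le> exp (- (r * t)) * (Gamma (1 - \<nu>) * frac_kernel \<nu> t + r powr (1 - \<nu>) / (1 - \<nu>))"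
    using \<nu> by (intro mult_left_mono) auto
  finally show ?thesis by (simp add: abs_minus_commute)
next
  case False
  then have 0: "frac_kernel \<nu> t = 0" by (auto simp: frac_kernel_def indicator_def)
  have "has_bochner_integral lborel (\<lambda>l. exp (- (r * t)) * (indicator {..r} l * frac_kernel (1 - \<nu>) l)) (exp (- (r * t)) * (r powr (1 - \<nu>) / (1 - \<nu>)))"
    using frac_kernel_has_integral[of "1 - \<nu>" r] \<nu> r by (intro has_bochner_integral_mult_right) auto
  then have *: "integrable lborel (\<lambda>l. exp (- (r * t)) * (indicator {..r} l * frac_kernel (1 - \<nu>) l))"
    "(LBINT l. exp (- (r * t)) * (indicator {..r} l * frac_kernel (1 - \<nu>) l)) = exp (- (r * t)) * (r powr (1 - \<nu>) / (1 - \<nu>))"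
    by (auto simp only: has_bochner_integral_iff)
  have "norm (trunc_kernel \<nu> r t) \<le> exp (- (r * t)) * (r powr (1 - \<nu>) / (1 - \<nu>))"
    unfolding trunc_kernel_def *(2)[symmetric]
  proof (rule norm_integral_le[OF *(1)], rule AE_I2)
    fix l :: real
    show "norm (indicator {..r} l * frac_kernel (1 - \<nu>) l * exp (- (t * l))) \<le> exp (- (r * t)) * (indicator {..r} l * frac_kernel (1 - \<nu>) l)"
    proof (cases "l \<le> r")
      case True
      have "- (t * l) \<le> - (r * t)" using True False mult_right_mono_neg[of l r t] by (simp add: mult.commute)
      then show ?thesis using True by (simp add: mult.commute mult_left_mono)
    qed simp
  qed
  with 0 show ?thesis by simp
qed

text \<open>Up to t = 1 the power is at least 1; beyond it, exp(- c t) \<le> 1 / (c t). The kernel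
  thus serves as majorant for exponentials on the negative half-line, where integrability of F is
  known only against this kernel.\<close>

lemma exp_neg_le_frac_kernel:
  assumes "0 < \<nu>" "\<nu> \<le> 1" "c > 0" "t > 0"
  shows "exp (- (c * t)) \<le> (1 + 1 / c) * frac_kernel \<nu> t"
proof (cases "t \<le> 1")
  case True
  have "exp (- (c * t)) \<le> 1" using assms by simp
  also have "1 \<le> t powr (\<nu> - 1)" using powr_mono2'[of "\<nu> - 1" t 1] assms True by simp
  also have "\<dots> \<le> (1 + 1 / c) * t powr (\<nu> - 1)" using assms by (simp add: mult_le_cancel_right1)
  finally show ?thesis using assms by (simp add: frac_kernel_def)
next
  case False
  have "c * t \<le> exp (c * t)" using exp_ge_add_one_self[of "c * t"] by linarith
  then have "exp (- (c * t)) \<le> 1 / (c * t)"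
    using assms by (simp add: exp_minus field_simps)
  also have "\<dots> = (1 / c) * t powr - 1" using assms by (simp add: powr_minus field_simps)
  also have "\<dots> \<le> (1 / c) * t powr (\<nu> - 1)"
    using assms False by (intro mult_left_mono powr_mono) auto
  also have "\<dots> \<le> (1 + 1 / c) * t powr (\<nu> - 1)"
    by (intro mult_right_mono) auto
  finally show ?thesis using assms by (simp add: frac_kernel_def)
qed

locale subst_core_neg = subst_core +
  assumes s: "Re \<sigma> < 0" and \<nu>1: "\<nu> < 1"
begin

definition r :: real where "r = - Re \<sigma>"

lemma r: "r > 0" using s by (simp add: r_def)

lemma norm_F': "norm (F x) = exp (- (r * x)) * norm (f x)"
  by (simp add: norm_F r_def)

lemma norm_f_eq: "norm (f x) = exp (r * x) * norm (F x)"
  by (simp add: norm_F' flip: exp_add mult.assoc)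

lemma frac_F0_integrable: "integrable lborel (\<lambda>\<tau>. frac_kernel \<nu> (- \<tau>) * norm (F \<tau>))"
  using norm_frac_F_integrable[of 0] by simp

text \<open>Towards - infinity F carries the growing weight exp(- r \<tau>), and only the existence
  of the fractional integral at 0 controls it. As the kernel decreases, that integrand majorises all
  later ones on \<tau> < 0, and |f| takes over for \<tau> \<ge> 0.\<close>

lemma U0_at_top: "(U 0 \<longlongrightarrow> 0) at_top"
proof -
  let ?I = "\<lambda>x \<tau>. indicator {..x - 1} \<tau> * (frac_kernel \<nu> (x - \<tau>) * norm (F \<tau>))"
  let ?w = "\<lambda>\<tau>. frac_kernel \<nu> (- \<tau>) * norm (F \<tau>) + norm (f \<tau>)"
  define R where "R x = (LBINT \<tau>. ?I x \<tau>)" for x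
  have R: "(R \<longlongrightarrow> (LINT (\<tau>::real)|lborel. 0)) at_top"
    unfolding R_def
  proof (rule integral_dominated_convergence_at_top[where w="\<lambda>\<tau>. ?w \<tau>"])
    show "integrable lborel (\<lambda>\<tau>. ?w \<tau>)"
      using frac_F0_integrable fi by simp
    have le: "norm (?I x \<tau>) \<le> ?w \<tau>"
      if x: "x \<ge> 1" for x \<tau>
    proof (cases "\<tau> \<le> x - 1")
      case True
      show ?thesis
      proof (cases "\<tau> < 0")
        case neg: True
        have "frac_kernel \<nu> (x - \<tau>) \<le> frac_kernel \<nu> (- \<tau>)"
          using neg x \<nu> powr_mono2'[of "\<nu> - 1" "- \<tau>" "x - \<tau>"] by (simp add: frac_kernel_def)
        then have "frac_kernel \<nu> (x - \<tau>) * norm (F \<tau>) \<le> frac_kernel \<nu> (- \<tau>) * norm (F \<tau>)"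
          by (rule mult_right_mono) simp
        then show ?thesis using True by (simp add: add_increasing2)
      next
        case False
        have "frac_kernel \<nu> (x - \<tau>) \<le> 1"
          using frac_kernel_le[of \<nu> 1 "x - \<tau>"] \<nu> True by simp
        moreover have "norm (F \<tau>) \<le> norm (f \<tau>)"
          using False r mult_right_mono[of "exp (- (r * \<tau>))" 1 "norm (f \<tau>)"] by (simp add: norm_F')
        ultimately have "frac_kernel \<nu> (x - \<tau>) * norm (F \<tau>) \<le> 1 * norm (f \<tau>)"
          by (intro mult_mono) auto
        then show ?thesis using True by (simp add: add_increasing)
      qed
    qed simp
    show "\<forall>\<^sub>F x in at_top. AE \<tau> in lborel. norm (?I x \<tau>) \<le> ?w \<tau>"
      using eventually_ge_at_top[of 1] by eventually_elim (use le in auto)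
    show "AE \<tau> in lborel. ((\<lambda>x. ?I x \<tau>) \<longlongrightarrow> 0) at_top"
    proof (rule AE_I2)
      fix \<tau> :: real
      have "((\<lambda>x. (x - \<tau>) powr (\<nu> - 1) * norm (F \<tau>)) \<longlongrightarrow> 0 * norm (F \<tau>)) at_top"
        using \<nu>1 by (intro tendsto_mult tendsto_const tendsto_neg_powr filterlim_tendsto_add_at_top[OF tendsto_const[of "- \<tau>"] filterlim_ident, simplified]) auto
      moreover have "\<forall>\<^sub>F x in at_top. (x - \<tau>) powr (\<nu> - 1) * norm (F \<tau>) = ?I x \<tau>"
        using eventually_ge_at_top[of "\<tau> + 1"] by eventually_elim (auto simp: frac_kernel_def)
      ultimately show "((\<lambda>x. ?I x \<tau>) \<longlongrightarrow> 0) at_top"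
        using Lim_transform_eventually by force
    qed
  qed auto
  have le: "norm (U 0 x) \<le> (Mf * exp (- (r * (x - 1))) * (1 powr \<nu> / \<nu>) + R x) / Gamma \<nu>" for x
    unfolding R_def
  proof (rule U0_bound)
    fix \<tau> assume t: "x - 1 \<le> \<tau>" "\<tau> \<le> x"
    have "exp (- (r * \<tau>)) * norm (f \<tau>) \<le> exp (- (r * (x - 1))) * Mf"
      using t r f_bound by (intro mult_mono) auto
    then show "norm (F \<tau>) \<le> Mf * exp (- (r * (x - 1)))"
      by (simp add: norm_F' mult.commute)
  qed simp
  have "((\<lambda>x. exp (- (r * (x - 1)))) \<longlongrightarrow> 0) at_top" using r by real_asymp
  then have "((\<lambda>x. (Mf * exp (- (r * (x - 1))) * (1 powr \<nu> / \<nu>) + R x) / Gamma \<nu>) \<longlongrightarrow> (Mf * 0 * (1 powr \<nu> / \<nu>) + 0) / Gamma \<nu>) at_top"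
    using R Gamma_nonzero by (intro tendsto_intros) auto
  then have lim: "((\<lambda>x. (Mf * exp (- (r * (x - 1))) * (1 powr \<nu> / \<nu>) + R x) / Gamma \<nu>) \<longlongrightarrow> 0) at_top" by simp
  show ?thesis
    by (rule Lim_null_comparison[OF _ lim]) (use le in simp)
qed

text \<open>Downward induction on the level, starting from the bounded \<open>G (Suc m)\<close>.
  Each integration leaves a limit L, which is excluded by \<open>U0_at_top\<close> and
  \<open>iterated_derivative_limit_zero\<close>; j = Suc m gives the fractional integral.\<close>

lemma U_decay:
  assumes "j \<le> Suc m"
  shows "\<exists>C. \<forall>x\<ge>0. norm (U (Suc m - j) x) \<le> C * exp (- r * x)"
  using assms
proof (induction j)
  case 0
  have "norm (U (Suc m) x) \<le> Mphi * exp (- r * x)" for x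
    using phi_bound[of x] by (simp add: U_def norm_mult r_def mult.commute)
  then show ?case by auto
next
  case (Suc j)
  define k where "k = Suc m - Suc j"
  have k: "Suc m - j = Suc k" "k \<le> m" using Suc.prems by (auto simp: k_def)
  obtain C where C: "\<And>x. x \<ge> 0 \<Longrightarrow> norm (U (Suc k) x) \<le> C * exp (- r * x)"
    using Suc unfolding k(1) by auto
  obtain L where L: "\<And>x. x \<ge> 0 \<Longrightarrow> norm (U k x - L) \<le> C / r * exp (- r * x)"
    using exp_decay_limit[OF U_deriv[OF k(2)] r C] by blast
  have "((\<lambda>x. C / r * exp (- r * x)) \<longlongrightarrow> C / r * 0) at_top"
    using r by (intro tendsto_mult tendsto_const) real_asymp
  then have "((\<lambda>x. U k x - L) \<longlongrightarrow> 0) at_top"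
    by (intro Lim_null_comparison[of "\<lambda>x. U k x - L" "\<lambda>x. C / r * exp (- r * x)"] eventually_mono[OF eventually_ge_at_top[of 0]] L) auto
  then have "(U k \<longlongrightarrow> L) at_top" by (simp add: LIM_zero_iff)
  then have "L = 0"
    using iterated_derivative_limit_zero[of at_top k U L] U_deriv k U0_at_top by auto
  then show ?case using L unfolding k_def by (intro exI[of _ "C / r"]) simp
qed

section \<open>The two-sided Laplace transform of F and its vanishing\<close>

definition Fh :: "real \<Rightarrow> complex" where "Fh l = (LBINT \<tau>. exp (of_real l * of_real \<tau>) * F \<tau>)"
text \<open>The density that appears when the integral for \<open>trunc_kernel\<close> is inserted
  into \<open>trunc_F\<close> and the integrals are exchanged: \<open>trunc_F\<close> becomes the
  Laplace transform of \<open>hh\<close>.\<close>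

definition hh :: "real \<Rightarrow> complex" where "hh l = complex_of_real (indicator {..r} l * frac_kernel (1 - \<nu>) l) * Fh l"

abbreviation trunc_F :: "real \<Rightarrow> complex" where
  "trunc_F x \<equiv> (LBINT \<tau>. complex_of_real (trunc_kernel \<nu> r (x - \<tau>)) * F \<tau>)"

text \<open>The truncation error exp(- r (x - \<tau>)) times the weight exp(- r \<tau>) of F is
  exp(- r x), free of \<tau>; what remains is integrable against |f|. Gamma \<nu> undoes the
  normalisation of \<open>U 0\<close>, and Mf / \<nu> bounds the singular part near \<tau> =
  x.\<close>

lemma trunc_F_bound:
  shows trunc_F_integrable: "integrable lborel (\<lambda>\<tau>. complex_of_real (trunc_kernel \<nu> r (x - \<tau>)) * F \<tau>)"
    and "norm (trunc_F x - complex_of_real (Gamma (1 - \<nu>) * Gamma \<nu>) * U 0 x)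
      \<le> (Gamma (1 - \<nu>) * (Mf / \<nu> + (LBINT \<tau>. norm (f \<tau>))) + r powr (1 - \<nu>) / (1 - \<nu>) * (LBINT \<tau>. norm (f \<tau>))) * exp (- r * x)"
proof -
  have [measurable]: "trunc_kernel \<nu> r \<in> borel_measurable borel" unfolding trunc_kernel_def by measurable
  let ?c1 = "r powr (1 - \<nu>) / (1 - \<nu>)"
  let ?A = "\<lambda>\<tau>. complex_of_real (trunc_kernel \<nu> r (x - \<tau>)) * F \<tau>"
  let ?B = "\<lambda>\<tau>. complex_of_real (Gamma (1 - \<nu>)) * (complex_of_real (frac_kernel \<nu> (x - \<tau>)) * F \<tau>)"
  let ?D = "\<lambda>\<tau>. exp (- r * x) * (Gamma (1 - \<nu>) * (Mf * (indicator {..1} (x - \<tau>) * frac_kernel \<nu> (x - \<tau>)) + norm (f \<tau>)) + ?c1 * norm (f \<tau>))"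
  have G1: "Gamma (1 - \<nu>) > 0" using \<nu>1 by (simp add: Gamma_real_pos)
  have near: "has_bochner_integral lborel (\<lambda>\<tau>. indicator {..1} (x - \<tau>) * frac_kernel \<nu> (x - \<tau>)) (1 / \<nu>)"
    using frac_kernel_has_integral[of \<nu> 1] \<nu>
    by (simp add: has_bochner_integral_iff lborel_integrable_minus_iff[of "\<lambda>t. indicator {..1} t * frac_kernel \<nu> t"]
      lborel_integral_minus[of "\<lambda>t. indicator {..1} t * frac_kernel \<nu> t"])
  have fI: "has_bochner_integral lborel (\<lambda>\<tau>. norm (f \<tau>)) (LBINT \<tau>. norm (f \<tau>))"
    using fi by (simp add: has_bochner_integral_iff)
  have "has_bochner_integral lborel ?D (exp (- r * x) * (Gamma (1 - \<nu>) * (Mf * (1 / \<nu>) + (LBINT \<tau>. norm (f \<tau>))) + ?c1 * (LBINT \<tau>. norm (f \<tau>))))"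
    by (intro has_bochner_integral_mult_right has_bochner_integral_add near fI)
  then have DI: "integrable lborel ?D"
    and DI': "(LBINT \<tau>. ?D \<tau>) = exp (- r * x) * (Gamma (1 - \<nu>) * (Mf * (1 / \<nu>) + (LBINT \<tau>. norm (f \<tau>))) + ?c1 * (LBINT \<tau>. norm (f \<tau>)))"
    by (simp_all only: has_bochner_integral_iff)
  have B: "integrable lborel ?B" by (rule integrable_mult_right[OF frac_F_integrable])
  have le: "norm (?A \<tau> - ?B \<tau>) \<le> ?D \<tau>" for \<tau>
  proof -
    have "norm (?A \<tau> - ?B \<tau>) = \<bar>trunc_kernel \<nu> r (x - \<tau>) - Gamma (1 - \<nu>) * frac_kernel \<nu> (x - \<tau>)\<bar> * norm (F \<tau>)"
    proof -
      have "?A \<tau> - ?B \<tau> = complex_of_real (trunc_kernel \<nu> r (x - \<tau>) - Gamma (1 - \<nu>) * frac_kernel \<nu> (x - \<tau>)) * F \<tau>"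
        by (simp add: left_diff_distrib mult.assoc)
      then show ?thesis by (simp only: norm_mult norm_of_real)
    qed
    also have "\<dots> \<le> exp (- (r * (x - \<tau>))) * (Gamma (1 - \<nu>) * frac_kernel \<nu> (x - \<tau>) + ?c1) * norm (F \<tau>)"
      by (intro mult_right_mono trunc_kernel_approx \<nu> \<nu>1 r) simp
    also have "\<dots> = exp (- r * x) * ((Gamma (1 - \<nu>) * frac_kernel \<nu> (x - \<tau>) + ?c1) * norm (f \<tau>))"
    proof -
      have "exp (- (r * (x - \<tau>))) = exp (- r * x) * exp (r * \<tau>)" by (simp add: algebra_simps flip: exp_add)
      then show ?thesis by (simp add: norm_f_eq)
    qed
    also have "\<dots> \<le> ?D \<tau>"
    proof (intro mult_left_mono)
      have "frac_kernel \<nu> (x - \<tau>) * norm (f \<tau>) \<le> Mf * (indicator {..1} (x - \<tau>) * frac_kernel \<nu> (x - \<tau>)) + norm (f \<tau>)"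
      proof (cases "x - \<tau> \<le> 1")
        case True
        then show ?thesis using mult_left_mono[OF f_bound[of \<tau>], of "frac_kernel \<nu> (x - \<tau>)"] norm_ge_zero[of "f \<tau>"]
          by (simp add: mult.commute del: norm_ge_zero)
      next
        case False
        then have "frac_kernel \<nu> (x - \<tau>) \<le> 1" using frac_kernel_le[of \<nu> 1 "x - \<tau>"] \<nu> by simp
        from mult_right_mono[OF this, of "norm (f \<tau>)"] show ?thesis using False by simp
      qed
      then show "(Gamma (1 - \<nu>) * frac_kernel \<nu> (x - \<tau>) + ?c1) * norm (f \<tau>) \<le> Gamma (1 - \<nu>) * (Mf * (indicator {..1} (x - \<tau>) * frac_kernel \<nu> (x - \<tau>)) + norm (f \<tau>)) + ?c1 * norm (f \<tau>)"
        using G1 by (simp add: distrib_right mult.assoc)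
    qed simp
    finally show ?thesis .
  qed
  have AB: "integrable lborel (\<lambda>\<tau>. ?A \<tau> - ?B \<tau>)"
  proof (rule Bochner_Integration.integrable_bound[OF DI])
    show "AE \<tau> in lborel. norm (?A \<tau> - ?B \<tau>) \<le> norm (?D \<tau>)"
      using order_trans[OF le abs_ge_self] by (simp only: real_norm_def AE_I2)
  qed measurable
  show A: "integrable lborel ?A"
    using Bochner_Integration.integrable_add[OF AB B] by simp
  have eq: "(LBINT \<tau>. ?A \<tau>) - complex_of_real (Gamma (1 - \<nu>) * Gamma \<nu>) * U 0 x = (LBINT \<tau>. ?A \<tau> - ?B \<tau>)"
    unfolding Bochner_Integration.integral_diff[OF A B] integral_mult_right_zero U0 using Gamma_nonzero by simp
  show "norm ((LBINT \<tau>. ?A \<tau>) - complex_of_real (Gamma (1 - \<nu>) * Gamma \<nu>) * U 0 x)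
      \<le> (Gamma (1 - \<nu>) * (Mf / \<nu> + (LBINT \<tau>. norm (f \<tau>))) + ?c1 * (LBINT \<tau>. norm (f \<tau>))) * exp (- r * x)"
    unfolding eq using norm_integral_le[OF DI AE_I2[OF le]] unfolding DI' by (simp add: mult.commute)
qed

lemma trunc_F_decay:
  "\<exists>C. \<forall>x\<ge>0. norm (trunc_F x) \<le> C * exp (- r * x)"
proof -
  obtain C0 where C0: "\<And>x. x \<ge> 0 \<Longrightarrow> norm (U 0 x) \<le> C0 * exp (- r * x)"
    using U_decay[of "Suc m"] by auto
  define C1 where "C1 = Gamma (1 - \<nu>) * (Mf / \<nu> + (LBINT \<tau>. norm (f \<tau>))) + r powr (1 - \<nu>) / (1 - \<nu>) * (LBINT \<tau>. norm (f \<tau>))"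
  have "norm (trunc_F x) \<le> (C1 + \<bar>Gamma (1 - \<nu>) * Gamma \<nu>\<bar> * C0) * exp (- r * x)"
    if "x \<ge> 0" for x
  proof -
    let ?I = "trunc_F x"
    let ?V = "complex_of_real (Gamma (1 - \<nu>) * Gamma \<nu>) * U 0 x"
    have "norm ?I \<le> norm (?I - ?V) + norm ?V"
      using norm_triangle_ineq[of "?I - ?V" ?V] by simp
    also have "\<dots> \<le> C1 * exp (- r * x) + \<bar>Gamma (1 - \<nu>) * Gamma \<nu>\<bar> * (C0 * exp (- r * x))"
      unfolding C1_def norm_mult norm_of_real by (intro add_mono trunc_F_bound(2) mult_left_mono C0 that) auto
    finally show ?thesis by (simp add: algebra_simps)
  qed
  then show ?thesis by blast
qed

text \<open>The truncated kernel is nonnegative, so integrating the modulus over l gives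
  \<open>trunc_kernel\<close> times |F|, integrable by \<open>trunc_F_integrable\<close>. At x = 0
  the other marginal is \<open>hh\<close>.\<close>

lemma hh_Fubini:
  shows hh_integrable: "integrable lborel hh"
    and hh_laplace: "x \<ge> 0 \<Longrightarrow> (LBINT l. hh l * exp (- (of_real x * of_real l))) = trunc_F x"
proof -
  let ?k = "\<lambda>l. complex_of_real (indicator {..r} l * frac_kernel (1 - \<nu>) l)"
  let ?J = "\<lambda>x \<tau> l. ?k l * exp (- (of_real (x - \<tau>) * of_real l)) * F \<tau>"
  have cplx: "?k l * exp (- (of_real t * of_real l)) = complex_of_real (indicator {..r} l * frac_kernel (1 - \<nu>) l * exp (- (t * l)))" for t l
    by (simp add: exp_of_real[symmetric])
  have nJ: "norm (?J x \<tau> l) = (indicator {..r} l * frac_kernel (1 - \<nu>) l * exp (- ((x - \<tau>) * l))) * norm (F \<tau>)" for x \<tau> l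
    unfolding cplx norm_mult norm_of_real by simp
  have int: "integrable (lborel \<Otimes>\<^sub>M lborel) (\<lambda>(\<tau>, l). ?J x \<tau> l)" for x
  proof (rule lborel_pair.Fubini_integrable)
    show "(\<lambda>(\<tau>, l). ?J x \<tau> l) \<in> borel_measurable (lborel \<Otimes>\<^sub>M lborel)" by measurable
    have nonneg: "0 \<le> trunc_kernel \<nu> r t" for t
      unfolding trunc_kernel_def by (intro integral_nonneg_AE AE_I2) auto
    have "(LBINT l. norm (?J x \<tau> l)) = norm (complex_of_real (trunc_kernel \<nu> r (x - \<tau>)) * F \<tau>)" for \<tau>
      unfolding nJ integral_mult_left_zero using nonneg[of "x - \<tau>"] by (simp add: norm_mult trunc_kernel_def)
    then show "integrable lborel (\<lambda>\<tau>. LBINT l. norm (case (\<tau>, l) of (\<tau>, l) \<Rightarrow> ?J x \<tau> l))"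
      using integrable_norm[OF trunc_F_integrable[of x]] by simp
    show "AE \<tau> in lborel. integrable lborel (\<lambda>l. case (\<tau>, l) of (\<tau>, l) \<Rightarrow> ?J x \<tau> l)"
    proof (rule AE_I2)
      fix \<tau>
      show "integrable lborel (\<lambda>l. case (\<tau>, l) of (\<tau>, l) \<Rightarrow> ?J x \<tau> l)"
        unfolding cplx prod.case
        by (intro integrable_mult_left integrable_of_real trunc_kernel_integrable[OF \<nu>1 r])
    qed
  qed
  have inner: "(LBINT \<tau>. ?J x \<tau> l) = hh l * exp (- (of_real x * of_real l))" for x l
  proof -
    have "?J x \<tau> l = ?k l * exp (- (of_real x * of_real l)) * (exp (of_real l * of_real \<tau>) * F \<tau>)" for \<tau>
      by (simp add: algebra_simps flip: exp_add)
    then have "(LBINT \<tau>. ?J x \<tau> l) = ?k l * exp (- (of_real x * of_real l)) * Fh l"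
      unfolding Fh_def by (simp only: integral_mult_right_zero)
    then show ?thesis by (simp add: hh_def mult_ac)
  qed
  show "integrable lborel hh"
    using lborel_pair.integrable_snd[OF int[of 0]] unfolding inner by simp
  have swap: "(LBINT l. LBINT \<tau>. ?J x \<tau> l) = (LBINT \<tau>. LBINT l. ?J x \<tau> l)"
    by (rule lborel_pair.Fubini_integral[OF int])
  have inner': "(LBINT l. ?J x \<tau> l) = complex_of_real (trunc_kernel \<nu> r (x - \<tau>)) * F \<tau>" for \<tau>
    unfolding cplx trunc_kernel_def by (simp only: integral_mult_left_zero integral_complex_of_real)
  show "(LBINT l. hh l * exp (- (of_real x * of_real l))) = trunc_F x"
    using swap unfolding inner inner' .
qed

lemma hh_zero_below:
  assumes "c < r"
  shows "(LBINT l:{..c}. hh l) = 0"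
proof (cases "c > 0")
  case True
  obtain C where C: "\<And>x. x \<ge> 0 \<Longrightarrow> norm (trunc_F x) \<le> C * exp (- r * x)"
    using trunc_F_decay by blast
  show ?thesis
  proof (rule laplace_decay_imp_integral_eq_0[OF hh_integrable, where C=C and r=r])
    show "hh l = 0" if "l < 0" for l using that by (simp add: hh_def frac_kernel_neg)
    show "norm (LBINT l. hh l * exp (- (of_real x * of_real l))) \<le> C * exp (- r * x)" if "x \<ge> 0" for x
      unfolding hh_laplace[OF that] by (rule C[OF that])
  qed (use True assms in auto)
next
  case False
  have z: "indicator {..c} l *\<^sub>R hh l = 0" for l
    using False by (auto simp: indicator_def hh_def frac_kernel_def)
  show ?thesis unfolding set_lebesgue_integral_def z by simp
qed

text \<open>Any interval inside (0, r) would do, because the analytic continuation in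
  \<open>f_eq_0\<close> only asks for an accumulation point of zeros; r / 2 keeps a distance from
  the end of the truncation.\<close>

lemma hh_AE_zero: "AE l in lborel. l \<le> r / 2 \<longrightarrow> hh l = 0"
proof -
  have hs: "set_integrable lborel A hh" if "A \<in> sets borel" for A
    unfolding set_integrable_def by (rule integrable_mult_indicator[OF _ hh_integrable]) (use that in simp)
  have hm[measurable]: "hh \<in> borel_measurable borel" using borel_measurable_integrable[OF hh_integrable] by simp
  have "AE l in lborel. indicator {..r / 2} l *\<^sub>R hh l = 0"
  proof (rule AE_eq_0_if_interval_integrals_eq_0)
    show "integrable lborel (\<lambda>l. indicator {..r / 2} l *\<^sub>R hh l)"
      using hs[of "{..r / 2}"] by (simp add: set_integrable_def)
    fix c d :: real assume "c \<le> d"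
    define e where "e = min d (r / 2)"
    have er: "e < r" using r by (simp add: e_def min_def)
    have "(LBINT l:{c..d}. indicator {..r / 2} l *\<^sub>R hh l) = (LBINT l:{c..e}. hh l)"
      unfolding set_lebesgue_integral_def
      by (intro Bochner_Integration.integral_cong) (auto simp: indicator_def e_def)
    also have "\<dots> = 0"
    proof (cases "c \<le> e")
      case True
      have "(LBINT l:{..e}. hh l) = (LBINT l:{..<c}. hh l) + (LBINT l:{c..e}. hh l)"
        using True by (subst set_integral_Un[symmetric]) (auto intro!: hs simp: ivl_disj_un)
      moreover have "(LBINT l:{..<c}. hh l) = (LBINT l:{..c}. hh l)"
      proof (rule set_integral_cong_set)
        show "set_borel_measurable lborel {..<c} hh" "set_borel_measurable lborel {..c} hh"
          unfolding set_borel_measurable_def by measurable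
        show "AE l in lborel. (l \<in> {..c}) = (l \<in> {..<c})"
          using AE_lborel_singleton[of c] by eventually_elim auto
      qed
      ultimately show ?thesis using hh_zero_below[OF er] hh_zero_below[of c] er True by simp
    qed (simp add: set_lebesgue_integral_def)
    finally show "(LBINT l:{c..d}. indicator {..r / 2} l *\<^sub>R hh l) = 0" .
  qed
  then show ?thesis by eventually_elim (auto simp: indicator_def)
qed

text \<open>On the right half-line Re z < r gives the majorant exp(r \<tau>) |F| = |f|; on the left,
  Re z > 0 allows \<open>exp_neg_le_frac_kernel\<close>, and the fractional integral at 0
  converges.\<close>

lemma exp_F_integrable:
  assumes "0 < Re z" "Re z < r"
  shows "integrable lborel (\<lambda>\<tau>. exp (z * of_real \<tau>) * F \<tau>)"
proof (rule Bochner_Integration.integrable_bound)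
  let ?D = "\<lambda>\<tau>. norm (f \<tau>) + (1 + 1 / Re z) * (frac_kernel \<nu> (- \<tau>) * norm (F \<tau>))"
  show "integrable lborel ?D"
    using fi frac_F0_integrable by (intro Bochner_Integration.integrable_add integrable_mult_right integrable_norm)
  show "AE \<tau> in lborel. norm (exp (z * of_real \<tau>) * F \<tau>) \<le> norm (?D \<tau>)"
  proof (rule AE_I2)
    fix \<tau> :: real
    have c: "0 \<le> (1 + 1 / Re z) * (frac_kernel \<nu> (- \<tau>) * norm (F \<tau>))"
      using assms by (intro mult_nonneg_nonneg) auto
    have "norm (exp (z * of_real \<tau>) * F \<tau>) = exp (Re z * \<tau>) * norm (F \<tau>)" by (simp add: norm_mult)
    also have "\<dots> \<le> ?D \<tau>"
    proof (cases "\<tau> \<ge> 0")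
      case True
      then have "exp (Re z * \<tau>) * norm (F \<tau>) \<le> exp (r * \<tau>) * norm (F \<tau>)"
        using assms by (intro mult_right_mono) (auto intro: mult_right_mono)
      with c show ?thesis by (simp only: norm_f_eq)
    next
      case False
      then have "exp (Re z * \<tau>) * norm (F \<tau>) \<le> (1 + 1 / Re z) * frac_kernel \<nu> (- \<tau>) * norm (F \<tau>)"
        using exp_neg_le_frac_kernel[of \<nu> "Re z" "- \<tau>"] \<nu> assms by (intro mult_right_mono) auto
      then show ?thesis using norm_ge_zero[of "f \<tau>"] by (simp only: mult.assoc)
    qed
    also have "\<dots> \<le> norm (?D \<tau>)" by simp
    finally show "norm (exp (z * of_real \<tau>) * F \<tau>) \<le> norm (?D \<tau>)" .
  qed
qed measurable

theorem f_eq_0: "f x = 0"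
proof -
  define S where "S = {z. 0 < Re z} \<inter> {z. Re z < r}"
  define T where "T z = (LBINT \<tau>. exp (z * of_real \<tau>) * F \<tau>)" for z :: complex
  have oS: "open S" unfolding S_def by (intro open_Int open_halfspace_Re_lt open_halfspace_Re_gt)
  have holT: "T holomorphic_on S"
    unfolding T_def by (intro laplace_transform_holomorphic oS exp_F_integrable) (auto simp: S_def)
  define Z where "Z = {l. 0 < l \<and> l < r / 2 \<and> Fh l = 0}"
  have T0: "T z = 0" if "z \<in> S" for z
  proof (rule analytic_continuation[OF holT oS, where U="complex_of_real ` Z" and \<xi>="of_real (r / 4)"])
    show "connected S"
      unfolding S_def by (intro convex_connected convex_Int convex_halfspace_Re_lt convex_halfspace_Re_gt)
    show "complex_of_real ` Z \<subseteq> S" "complex_of_real (r / 4) \<in> S" "z \<in> S"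
      using r that by (auto simp: S_def Z_def)
    show "T y = 0" if "y \<in> complex_of_real ` Z" for y
      using that by (auto simp: Z_def T_def Fh_def)
    show "complex_of_real (r / 4) islimpt complex_of_real ` Z"
      unfolding islimpt_approachable
    proof (intro allI impI)
      fix e :: real assume e: "e > 0"
      define d where "d = min e (r / 4)"
      have d: "d > 0" "d \<le> e" "d \<le> r / 4" using e r by (auto simp: d_def)
      \<comment> \<open>\<open>Fh\<close> vanishes only almost everywhere so far; an interval of
        positive length nevertheless contains a zero, and such zeros accumulate at r / 4.\<close>
      have "\<exists>l. r / 4 < l \<and> l < r / 4 + d \<and> Fh l = 0"
      proof (rule ccontr)
        assume no: "\<not> ?thesis"
        have "AE l in lborel. l \<notin> {r / 4<..<r / 4 + d}"
          using hh_AE_zero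
        proof eventually_elim
          case (elim l)
          show ?case
          proof
            assume l: "l \<in> {r / 4<..<r / 4 + d}"
            then have l2: "0 < l" "l < r / 2" using r d by auto
            then have "hh l = 0" using elim by simp
            then have "Fh l = 0" using l2 r by (simp add: hh_def frac_kernel_def)
            with no l show False by auto
          qed
        qed
        then have "emeasure lborel {r / 4<..<r / 4 + d} = 0"
          by (subst (asm) AE_iff_measurable[of "{r / 4<..<r / 4 + d}"]) auto
        then show False using d by simp
      qed
      then obtain l where l: "r / 4 < l" "l < r / 4 + d" "Fh l = 0" by blast
      show "\<exists>x'\<in>complex_of_real ` Z. x' \<noteq> complex_of_real (r / 4) \<and> dist x' (complex_of_real (r / 4)) < e"
      proof (intro bexI[of _ "complex_of_real l"] conjI)
        show "complex_of_real l \<noteq> complex_of_real (r / 4)" using l by (simp only: of_real_eq_iff)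
        show "dist (complex_of_real l) (complex_of_real (r / 4)) < e"
          using l d by (simp only: dist_of_real) (simp add: dist_real_def)
        show "complex_of_real l \<in> complex_of_real ` Z" using l d r by (auto simp: Z_def)
      qed
    qed
  qed
  \<comment> \<open>On the vertical line Re z = r / 2 the Laplace transform of F is the Fourier
    synthesis of \<open>g\<close>, so uniqueness of Fourier densities finishes the argument.\<close>
  define g where "g \<tau> = exp (of_real (r / 2) * of_real \<tau>) * F \<tau>" for \<tau> :: real
  have gi: "integrable lborel g"
    unfolding g_def using r by (intro exp_F_integrable) auto
  have "AE \<tau> in lborel. g \<tau> = 0"
  proof (rule fourier_synth_eq_0_imp[OF gi])
    fix y :: real
    have "fourier_synth g y = T (of_real (r / 2) - \<i> * y)"
      unfolding fourier_synth_def T_def g_def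
      by (intro Bochner_Integration.integral_cong) (auto simp: algebra_simps simp flip: exp_add)
    also have "\<dots> = 0" using r by (intro T0) (simp add: S_def)
    finally show "fourier_synth g y = 0" .
  qed
  then have "AE \<tau> in lborel. f \<tau> = 0"
    by eventually_elim (simp add: g_def F_def)
  then have "AE \<tau> in lebesgue. f \<tau> = 0" by (rule AE_completion)
  then obtain N where "negligible N" "{x. f x \<noteq> 0} \<subseteq> N"
    unfolding eventually_ae_filter_negligible by auto
  moreover have "open {x. f x \<noteq> 0}"
    using f_cont by (intro open_Collect_neq continuous_on_const)
  ultimately show ?thesis
    using open_not_negligible[of "{x. f x \<noteq> 0}"] negligible_subset by blast
qed

theorem order_estimate_vanishing: "summable (\<lambda>k. g1 \<sigma> \<alpha> h k * f (x - real k * h)) \<and> norm (G m x - A1 \<sigma> \<alpha> h f x) = 0"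
proof -
  have U: "U k x = 0" if "k \<le> m" for k x
    using that
  proof (induction k arbitrary: x)
    case 0
    show ?case by (simp add: U0 F_def f_eq_0)
  next
    case (Suc k)
    then have "U k = (\<lambda>x. 0)" by auto
    then have "(U k has_vector_derivative 0) (at x)" by simp
    moreover have "(U k has_vector_derivative U (Suc k) x) (at x)" using Suc.prems by (intro U_deriv) simp
    ultimately show ?case by (rule vector_derivative_unique_at[symmetric])
  qed
  then have "G m x = 0" using U[of m x] by (simp add: U_def)
  then show ?thesis by (simp add: A1_def f_eq_0)
qed

end

section \<open>Reduction to continuous representatives\<close>

lemma order_estimate_continuous:
  fixes \<alpha> \<nu> :: real and \<sigma> :: complex and f :: "real \<Rightarrow> complex" and G :: "nat \<Rightarrow> real \<Rightarrow> complex"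
  assumes \<alpha>: "\<alpha> > 0" and \<nu>: "\<nu> = real m - \<alpha>" "0 < \<nu>" "\<nu> \<le> 1"
    and a: "integrable lborel a" and f: "f = fourier_synth a" and fi: "integrable lborel f"
    and b: "integrable lborel b" and phi: "G (Suc m) = fourier_synth b" and phi_int: "integrable lborel (G (Suc m))"
    and kint: "\<And>x. set_integrable lborel {..x} (subst_kernel \<sigma> \<nu> f x)"
    and G0: "\<And>x. G 0 x = complex_of_real (1 / Gamma \<nu>) * (LBINT \<tau>:{..x}. subst_kernel \<sigma> \<nu> f x \<tau>)"
    and Gd: "\<And>k x. k \<le> m \<Longrightarrow> (G k has_vector_derivative (G (Suc k) x - \<sigma> * G k x)) (at x)"
  shows "\<exists>C. \<exists>h\<^sub>0>0. \<forall>h. 0 < h \<and> h < h\<^sub>0 \<longrightarrow>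
      (\<forall>x. summable (\<lambda>m. g1 \<sigma> \<alpha> h m * f (x - real m * h)) \<and>
           norm (G m x - A1 \<sigma> \<alpha> h f x) \<le> C * h)"
proof -
  interpret subst_core \<alpha> \<nu> \<sigma> f G m a b
    by (unfold_locales) (fact assms)+
  \<comment> \<open>\<nu> = 1 means that \<alpha> is the integer m - 1; for all other orders \<nu> <
    1, and the sign of Re \<sigma> decides. The first two cases overlap.\<close>
  consider "Re \<sigma> \<ge> 0" | "\<alpha> = real (m - 1)" | "Re \<sigma> < 0" "\<nu> < 1"
  proof -
    have "m > 0" using assms(1-3) by (cases m) auto
    then have 1: "\<alpha> = real (m - 1)" if "\<nu> = 1" using that assms(2) by (simp add: of_nat_diff)
    show ?thesis
    proof (cases "\<nu> = 1")
      case True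
      then show ?thesis by (intro that(2) 1)
    next
      case False
      then have "\<nu> < 1" using assms(4) by simp
      then show ?thesis using that(1,3) by (cases "Re \<sigma> \<ge> 0") auto
    qed
  qed
  then show ?thesis
  proof cases
    case 1
    obtain C where C: "\<forall>h>0. \<forall>x. summable (\<lambda>k. g1 \<sigma> \<alpha> h k * f (x - real k * h)) \<and>
           norm (G m x - A1 \<sigma> \<alpha> h f x) \<le> C * h"
      using order_estimate_nonneg[OF 1] ..
    show ?thesis
      by (rule exI[of _ C], rule exI[of _ 1]) (use C in simp)
  next
    case 2
    obtain C where C: "\<forall>h. 0 < h \<and> h < 1 \<longrightarrow> (\<forall>x. summable (\<lambda>k. g1 \<sigma> \<alpha> h k * f (x - real k * h)) \<and>
           norm (G m x - A1 \<sigma> \<alpha> h f x) \<le> C * h)"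
      using order_estimate_nat[OF 2] ..
    show ?thesis
      by (rule exI[of _ C], rule exI[of _ 1]) (use C in simp)
  next
    case 3
    interpret subst_core_neg \<alpha> \<nu> \<sigma> f G m a b
      by (unfold_locales) (fact 3)+
    show ?thesis
      by (rule exI[of _ 0], rule exI[of _ 1]) (use order_estimate_vanishing in simp)
  qed
qed

lemma lebesgue_borel_version:
  fixes f :: "real \<Rightarrow> complex"
  assumes "f \<in> borel_measurable lebesgue"
  obtains g where "g \<in> borel_measurable borel" "AE x in lborel. f x = g x"
proof -
  have "(\<lambda>x. Re (f x)) \<in> borel_measurable (completion lborel)" "(\<lambda>x. Im (f x)) \<in> borel_measurable (completion lborel)"
    using assms by auto
  then obtain r i where [measurable]: "r \<in> borel_measurable lborel" "i \<in> borel_measurable lborel"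
    and ae: "AE x in lborel. Re (f x) = r x" "AE x in lborel. Im (f x) = i x"
    using completion_ex_borel_measurable_real by metis
  show ?thesis
  proof
    show "(\<lambda>x. Complex (r x) (i x)) \<in> borel_measurable borel"
      unfolding Complex_eq by measurable
    show "AE x in lborel. f x = Complex (r x) (i x)"
      using ae by eventually_elim (simp add: complex_eq_iff)
  qed
qed

text \<open>Changing \<open>f\<close> on a null set leaves \<open>fourier f\<close> the same at
  every point, so the integrability assumed of it passes to the transform of a Borel
  representative.\<close>

lemma fourier_inversion_lebesgue:
  assumes f: "integrable lebesgue f" and ff: "integrable lebesgue (fourier f)"
  obtains a where "integrable lborel a" "integrable lborel (fourier_synth a)" "AE x in lebesgue. f x = fourier_synth a x"
proof -
  obtain g where g[measurable]: "g \<in> borel_measurable borel" and fg: "AE x in lborel. f x = g x"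
    using lebesgue_borel_version f borel_measurable_integrable by metis
  have fg': "AE x in lebesgue. f x = g x" using fg by (rule AE_completion)
  have gI': "integrable lebesgue g"
    using f fg' measurable_completion[of g lborel borel] by (subst integrable_cong_AE[of g _ f]) auto
  then have gI: "integrable lborel g" by (subst (asm) integrable_completion) auto
  define G where "G w = (LBINT y. g y * iexp (w * y))" for w
  have "fourier f = G"
  proof
    fix w
    have e: "(\<lambda>x. exp (\<i> * complex_of_real (w * x))) \<in> borel_measurable lebesgue"
      by (rule measurable_completion) simp
    have fm: "f \<in> borel_measurable lebesgue" "g \<in> borel_measurable lebesgue"
      using f gI' by auto
    have "fourier f w = (LINT x|lebesgue. exp (\<i> * complex_of_real (w * x)) * g x)"
      unfolding fourier_def using fg' by (intro integral_cong_AE borel_measurable_times[OF e] fm) auto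
    also have "\<dots> = (LBINT x. exp (\<i> * complex_of_real (w * x)) * g x)"
      by (subst integral_completion) auto
    finally show "fourier f w = G w" by (simp add: G_def mult.commute)
  qed
  moreover have "G \<in> borel_measurable borel"
    unfolding G_def by measurable
  ultimately have GI: "integrable lborel G"
    using ff by (simp add: integrable_completion)
  have inv: "AE x in lborel. g x = fourier_synth (\<lambda>w. G w / (2 * pi)) x"
    using fourier_inversion[OF gI] GI unfolding G_def by simp
  have aI: "integrable lborel (\<lambda>w. G w / (2 * pi))" using GI by simp
  show ?thesis
  proof
    show "integrable lborel (\<lambda>w. G w / (2 * pi))" by fact
    show "integrable lborel (fourier_synth (\<lambda>w. G w / (2 * pi)))"
      using inv gI fourier_synth_borel[OF aI] by (subst integrable_cong_AE[of _ _ g]) auto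
    show "AE x in lebesgue. f x = fourier_synth (\<lambda>w. G w / (2 * pi)) x"
      using fg' AE_completion[OF inv] by eventually_elim simp
  qed
qed

text \<open>The gauge integral of a derivative recovers H without further assumptions and ignores
  null sets, so H is a primitive of the continuous \<open>g\<close>. This promotes the
  almost-everywhere inversion formula for the top derivative to all points.\<close>

lemma derivative_eq_if_AE_eq_continuous:
  fixes H :: "real \<Rightarrow> complex"
  assumes H: "\<And>x. (H has_vector_derivative H' x) (at x)"
    and cont: "continuous_on UNIV g" and ae: "AE x in lebesgue. H' x = g x"
  shows "H' x = g x"
proof -
  obtain N where N: "negligible N" "{x. H' x \<noteq> g x} \<subseteq> N"
    using ae unfolding eventually_ae_filter_negligible by auto
  have I: "(g has_integral (H y - H (x - 1))) {x - 1..y}" if "y \<ge> x - 1" for y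
  proof (rule has_integral_spike[OF N(1)])
    show "(H' has_integral (H y - H (x - 1))) {x - 1..y}"
      using that H by (intro fundamental_theorem_of_calculus) (auto intro: has_vector_derivative_at_within)
  qed (use N in force)
  have "((\<lambda>y. integral {x - 1..y} g) has_vector_derivative g x) (at x within {x - 1..x + 1})"
    using cont by (intro integral_has_vector_derivative continuous_on_subset[OF cont]) auto
  then have "((\<lambda>y. integral {x - 1..y} g) has_vector_derivative g x) (at x)"
    by (simp add: at_within_Icc_at)
  then have "((\<lambda>y. H (x - 1) + integral {x - 1..y} g) has_vector_derivative g x) (at x)"
    by (auto intro!: derivative_eq_intros)
  then have "(H has_vector_derivative g x) (at x)"
  proof (rule has_vector_derivative_transform_within_open[where S="{x - 1<..<x + 1}"])
    fix y assume "y \<in> {x - 1<..<x + 1}"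
    then show "H (x - 1) + integral {x - 1..y} g = H y"
      using integral_unique[OF I[of y]] by auto
  qed auto
  then show ?thesis
    using H vector_derivative_unique_at by blast
qed

text \<open>Consequently both orders share one fractional integral, of order \<nu> in (0,
  1].\<close>

lemma subst_order_add_1: "0 < \<alpha> \<Longrightarrow> subst_order (\<alpha> + 1) = Suc (subst_order \<alpha>)"
  and subst_order_less: "0 < \<alpha> \<Longrightarrow> \<alpha> < real (subst_order \<alpha>)"
  and subst_order_ge: "0 < \<alpha> \<Longrightarrow> real (subst_order \<alpha>) \<le> \<alpha> + 1"
proof -
  assume \<alpha>: "0 < \<alpha>"
  have ex: "\<exists>n. \<alpha> < real n" by (rule reals_Archimedean2)
  then show l: "\<alpha> < real (subst_order \<alpha>)"
    unfolding subst_order_def by (rule LeastI_ex)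
  have le: "n \<ge> subst_order \<alpha>" if "\<alpha> < real n" for n
    using that unfolding subst_order_def by (rule Least_le)
  show "subst_order (\<alpha> + 1) = Suc (subst_order \<alpha>)"
    unfolding subst_order_def[of "\<alpha> + 1"]
  proof (rule Least_equality)
    fix n assume n: "\<alpha> + 1 < real n"
    then have "n > 0" using \<alpha> by (cases n) auto
    then show "Suc (subst_order \<alpha>) \<le> n" using le[of "n - 1"] n by (auto simp: of_nat_diff)
  qed (use l in auto)
  show "real (subst_order \<alpha>) \<le> \<alpha> + 1"
  proof (rule ccontr)
    assume "\<not> real (subst_order \<alpha>) \<le> \<alpha> + 1"
    then have "\<alpha> < real (subst_order \<alpha> - 1)"
      using l \<alpha> by (cases "subst_order \<alpha>") auto
    from le[OF this] show False using l \<alpha> by (cases "subst_order \<alpha>") auto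
  qed
qed

text \<open>\<open>A1\<close> samples \<open>f\<close> at single points, whereas the fractional
  derivative depends only on \<open>f\<close> modulo null sets; so a general \<open>f\<close> admits
  the bound almost everywhere, and a continuous one everywhere. \<open>C\<close> and
  \<open>h\<^sub>0\<close> are uniform in x.\<close>

theorem theorem3p3:
  fixes \<alpha> :: real and \<sigma> :: complex and f :: "real \<Rightarrow> complex"
  assumes "\<alpha> > 0"
    and "integrable lebesgue f"
    and "integrable lebesgue (fourier f)"
    and "has_subst_deriv \<sigma> (\<alpha> + 1) f"
    and "integrable lebesgue (subst_deriv \<sigma> (\<alpha> + 1) f)"
    and "integrable lebesgue (fourier (subst_deriv \<sigma> (\<alpha> + 1) f))"
  shows "has_subst_deriv \<sigma> \<alpha> f \<and>
    (\<exists>C. \<exists>h\<^sub>0>0. \<forall>h. 0 < h \<and> h < h\<^sub>0 \<longrightarrow>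
      (AE x in lebesgue.
         summable (\<lambda>m. g1 \<sigma> \<alpha> h m * f (x - real m * h)) \<and>
         norm (subst_deriv \<sigma> \<alpha> f x - A1 \<sigma> \<alpha> h f x) \<le> C * h) \<and>
      (continuous_on UNIV f \<longrightarrow>
         (\<forall>x. summable (\<lambda>m. g1 \<sigma> \<alpha> h m * f (x - real m * h)) \<and>
              norm (subst_deriv \<sigma> \<alpha> f x - A1 \<sigma> \<alpha> h f x) \<le> C * h)))"
proof
  note \<alpha> = assms(1)
  define m where "m = subst_order \<alpha>"
  define \<nu> where "\<nu> = real m - \<alpha>"
  have ord: "subst_order (\<alpha> + 1) = Suc m" using subst_order_add_1[OF \<alpha>] by (simp add: m_def)
  have \<nu>: "0 < \<nu>" "\<nu> \<le> 1" using subst_order_less[OF \<alpha>] subst_order_ge[OF \<alpha>] by (auto simp: \<nu>_def m_def)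
  have \<nu>': "real (Suc m) - (\<alpha> + 1) = \<nu>" by (simp add: \<nu>_def)
  define G where "G k = (Ds \<sigma> ^^ k) (subst_integral \<sigma> \<nu> f)" for k
  have ki: "set_integrable lebesgue {..x} (subst_kernel \<sigma> \<nu> f x)" for x
    using assms(4) unfolding has_subst_deriv_def ord \<nu>' by blast
  have diff: "G k differentiable (at x)" if "k < Suc m" for k x
    using assms(4) that unfolding has_subst_deriv_def ord \<nu>' G_def by blast
  show "has_subst_deriv \<sigma> \<alpha> f"
    unfolding has_subst_deriv_def m_def[symmetric] \<nu>_def[symmetric]
    using ki diff by (auto simp: G_def)
  have Gm: "subst_deriv \<sigma> \<alpha> f = G m"
    by (simp add: subst_deriv_def G_def \<nu>_def m_def)
  have GSm: "subst_deriv \<sigma> (\<alpha> + 1) f = G (Suc m)"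
    by (simp only: subst_deriv_def ord \<nu>' G_def)
  obtain a where a: "integrable lborel a" "integrable lborel (fourier_synth a)"
    and fa: "AE x in lebesgue. f x = fourier_synth a x"
    using fourier_inversion_lebesgue[OF assms(2,3)] .
  obtain b where b: "integrable lborel b" "integrable lborel (fourier_synth b)"
    and Gb: "AE x in lebesgue. G (Suc m) x = fourier_synth b x"
    using fourier_inversion_lebesgue[OF assms(5,6)] unfolding GSm .
  define g where "g = fourier_synth a"
  have g_cont: "continuous_on UNIV g" unfolding g_def by (rule continuous_fourier_synth[OF a(1)])
  have [measurable]: "g \<in> borel_measurable borel" using g_cont by (rule borel_measurable_continuous_onI)
  have g_leb: "g \<in> borel_measurable lebesgue" by (rule measurable_completion) simp
  have f_leb: "f \<in> borel_measurable lebesgue" using assms(2) by auto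
  have K_leb: "(\<lambda>\<tau>. indicator {..x} \<tau> *\<^sub>R (complex_of_real ((x - \<tau>) powr (\<nu> - 1)) * exp (- \<sigma> * complex_of_real (x - \<tau>)))) \<in> borel_measurable lebesgue" for x
    by (rule measurable_completion) simp
  have kf_leb: "(\<lambda>\<tau>. indicator {..x} \<tau> *\<^sub>R subst_kernel \<sigma> \<nu> u x \<tau>) \<in> borel_measurable lebesgue"
    if "u \<in> borel_measurable lebesgue" for x u
    using borel_measurable_times[OF K_leb[of x] that] by (simp add: subst_kernel_def)
  have kg_bor: "(\<lambda>\<tau>. indicator {..x} \<tau> *\<^sub>R subst_kernel \<sigma> \<nu> g x \<tau>) \<in> borel_measurable lborel" for x
    unfolding subst_kernel_def by simp
  have k_eq: "AE \<tau> in lebesgue. indicator {..x} \<tau> *\<^sub>R subst_kernel \<sigma> \<nu> f x \<tau> = indicator {..x} \<tau> *\<^sub>R subst_kernel \<sigma> \<nu> g x \<tau>" for x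
    using fa by eventually_elim (simp add: subst_kernel_def g_def)
  have kg: "set_integrable lborel {..x} (subst_kernel \<sigma> \<nu> g x)" for x
  proof -
    have "integrable lebesgue (\<lambda>\<tau>. indicator {..x} \<tau> *\<^sub>R subst_kernel \<sigma> \<nu> g x \<tau>)"
      using ki[of x] integrable_cong_AE[OF kf_leb[OF f_leb] kf_leb[OF g_leb] k_eq] by (simp add: set_integrable_def)
    then show ?thesis
      using kg_bor[of x] by (simp add: set_integrable_def integrable_completion)
  qed
  have G0: "G 0 x = complex_of_real (1 / Gamma \<nu>) * (LBINT \<tau>:{..x}. subst_kernel \<sigma> \<nu> g x \<tau>)" for x
    unfolding G_def subst_integral_def set_lebesgue_integral_def
    using integral_cong_AE[OF kf_leb[OF f_leb] kf_leb[OF g_leb] k_eq] integral_completion[OF kg_bor]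
    by simp
  have Gd: "(G k has_vector_derivative (G (Suc k) x - \<sigma> * G k x)) (at x)" if "k \<le> m" for k x
  proof -
    have "(G k has_vector_derivative vector_derivative (G k) (at x)) (at x)"
      using diff[of k x] that vector_derivative_works by auto
    moreover have "G (Suc k) x = vector_derivative (G k) (at x) + \<sigma> * G k x"
      by (simp add: G_def Ds_def)
    ultimately show ?thesis by simp
  qed
  have GSm': "G (Suc m) = fourier_synth b"
  proof
    fix x
    \<comment> \<open>The weight turns D_s into an honest derivative, to which
      \<open>derivative_eq_if_AE_eq_continuous\<close> applies.\<close>
    have "exp (\<sigma> * x) * G (Suc m) x = exp (\<sigma> * x) * fourier_synth b x"
    proof (rule derivative_eq_if_AE_eq_continuous[where H="\<lambda>x. exp (\<sigma> * x) * G m x"])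
      fix x :: real
      have "((\<lambda>x. exp (\<sigma> * of_real x)) has_vector_derivative exp (\<sigma> * of_real x) * \<sigma>) (at x)"
        by (auto intro!: derivative_eq_intros has_vector_derivative_real_field)
      from has_vector_derivative_mult[OF this Gd[OF order_refl, of x]]
      show "((\<lambda>x. exp (\<sigma> * of_real x) * G m x) has_vector_derivative exp (\<sigma> * x) * G (Suc m) x) (at x)"
        by (simp add: algebra_simps)
      show "AE x in lebesgue. exp (\<sigma> * complex_of_real x) * G (Suc m) x = exp (\<sigma> * complex_of_real x) * fourier_synth b x"
        using Gb by eventually_elim simp
    qed (intro continuous_intros continuous_fourier_synth[OF b(1)])
    then show "G (Suc m) x = fourier_synth b x" by simp
  qed
  obtain C h0 where h0: "h0 > 0" and C: "\<And>h x. 0 < h \<Longrightarrow> h < h0 \<Longrightarrow>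
     summable (\<lambda>m. g1 \<sigma> \<alpha> h m * g (x - real m * h)) \<and> norm (G m x - A1 \<sigma> \<alpha> h g x) \<le> C * h"
    using order_estimate_continuous[OF \<alpha> \<nu>_def \<nu> a(1) g_def _ b(1) GSm' _ kg G0 Gd] a(2) b(2) unfolding g_def[symmetric] GSm' by auto
  obtain N where N: "negligible N" "{x. f x \<noteq> g x} \<subseteq> N"
    using fa unfolding g_def eventually_ae_filter_negligible by auto
  have A1_cong: "A1 \<sigma> \<alpha> h f x = A1 \<sigma> \<alpha> h g x" "(\<lambda>m. g1 \<sigma> \<alpha> h m * f (x - real m * h)) = (\<lambda>m. g1 \<sigma> \<alpha> h m * g (x - real m * h))"
    if "\<And>m. f (x - real m * h) = g (x - real m * h)" for h x
    using that by (simp_all add: A1_def)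
  show "\<exists>C. \<exists>h\<^sub>0>0. \<forall>h. 0 < h \<and> h < h\<^sub>0 \<longrightarrow>
      (AE x in lebesgue.
         summable (\<lambda>m. g1 \<sigma> \<alpha> h m * f (x - real m * h)) \<and>
         norm (subst_deriv \<sigma> \<alpha> f x - A1 \<sigma> \<alpha> h f x) \<le> C * h) \<and>
      (continuous_on UNIV f \<longrightarrow>
         (\<forall>x. summable (\<lambda>m. g1 \<sigma> \<alpha> h m * f (x - real m * h)) \<and>
              norm (subst_deriv \<sigma> \<alpha> f x - A1 \<sigma> \<alpha> h f x) \<le> C * h))"
  proof (rule exI[of _ C], rule exI[of _ h0], intro conjI[OF h0] allI impI)
    fix h assume h: "0 < h \<and> h < h0"
    \<comment> \<open>The exceptional set consists of countably many translates of \<open>N\<close>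
      by multiples of h. It depends on h, which is why h is fixed before the almost-everywhere
      claim.\<close>
    have "negligible (\<Union>m. (+) (real m * h) ` N)"
      by (intro negligible_countable_Union) (auto intro: negligible_translation N)
    moreover have "{x. \<not> (\<forall>m. f (x - real m * h) = g (x - real m * h))} \<subseteq> (\<Union>m. (+) (real m * h) ` N)"
    proof
      fix x assume "x \<in> {x. \<not> (\<forall>m. f (x - real m * h) = g (x - real m * h))}"
      then obtain m where "x - real m * h \<in> N" using N(2) by auto
      then show "x \<in> (\<Union>m. (+) (real m * h) ` N)"
        by (auto intro!: exI[of _ m] image_eqI[of _ _ "x - real m * h"])
    qed
    ultimately have "AE x in lebesgue. \<forall>m. f (x - real m * h) = g (x - real m * h)"
      unfolding eventually_ae_filter_negligible by blast
    then have "AE x in lebesgue.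
         summable (\<lambda>m. g1 \<sigma> \<alpha> h m * f (x - real m * h)) \<and>
         norm (subst_deriv \<sigma> \<alpha> f x - A1 \<sigma> \<alpha> h f x) \<le> C * h"
    proof eventually_elim
      case (elim x)
      then show ?case using C[of h x] h A1_cong[of x h] by (simp add: Gm)
    qed
    moreover have "summable (\<lambda>m. g1 \<sigma> \<alpha> h m * f (x - real m * h)) \<and>
         norm (subst_deriv \<sigma> \<alpha> f x - A1 \<sigma> \<alpha> h f x) \<le> C * h"
      if cont: "continuous_on UNIV f" for x
    proof -
    have "open {x. f x \<noteq> g x}"
      using cont g_cont by (intro open_Collect_neq)
    moreover have "negligible {x. f x \<noteq> g x}" using N negligible_subset by blast
    ultimately have "f y = g y" for y using open_not_negligible by fastforce
    then have fg: "f = g" by auto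
    then show ?thesis
      using C[of h x] h Gm by simp
    qed
    ultimately show "(AE x in lebesgue.
         summable (\<lambda>m. g1 \<sigma> \<alpha> h m * f (x - real m * h)) \<and>
         norm (subst_deriv \<sigma> \<alpha> f x - A1 \<sigma> \<alpha> h f x) \<le> C * h) \<and>
      (continuous_on UNIV f \<longrightarrow>
         (\<forall>x. summable (\<lambda>m. g1 \<sigma> \<alpha> h m * f (x - real m * h)) \<and>
              norm (subst_deriv \<sigma> \<alpha> f x - A1 \<sigma> \<alpha> h f x) \<le> C * h))"
      by blast
  qed
qed

end
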